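(* Let $S\subset\mathbf{R}^2$ be a planar Gutkin billiard table. Consider the billiard ball map $T$ inside $S$ on the phase cylinder, with coordinates $(x,\alpha)$, $x\in S$, $\alpha\in(0,\pi)$ the angle between the outgoing ray and the tangent line at $x$. Let $0\le\delta_1<\delta_2\le\pi/2$ be two neighboring values such that the constant-angle curves $\{\alpha=\delta_1\}$ and $\{\alpha=\delta_2\}$ are $T$-invariant (where $\{\alpha=0\}$ denotes the boundary of the cylinder), and let $\Omega_{\delta_1\delta_2}=\{\delta_1\le\alpha\le\delta_2\}$ be the strip between them. If $\Omega_{\delta_1\delta_2}$ is foliated by rotational $T$-invariant curves (continuous invariant curves which are graphs over $S$, i.e. homotopic to the base circle of the cylinder), then $S$ is a circle.
   Context: A Gutkin billiard table in $\mathbf{R}^2$ is a smooth closed curve $S$ bounding a compact convex domain, with strictly positive curvature, for which there exists $\delta\in(0,\pi/2)$ such that for every pair of distinct points $p,q\in S$: if the angle between the vector $\overrightarrow{pq}$ and the tangent line $T_pS$ equals $\delta$, then the angle between $\overrightarrow{pq}$ and the tangent line $T_qS$ also equals $\delta$. The billiard ball map sends a chord leaving $x$ at angle $\alpha$ and hitting $S$ at $y$ to the chord leaving $y$ obtained by the law of reflection. *)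

theory Defs
  imports "HOL-Analysis.Analysis"
begin

text \<open>The plane R^2 is modelled by the complex numbers. A closed curve is given by
  an L-periodic parametrisation gamma : real => complex.\<close>

definition vderiv :: "(real \<Rightarrow> complex) \<Rightarrow> real \<Rightarrow> complex" where
  "vderiv f = (\<lambda>t. vector_derivative f (at t))"

definition smooth_param :: "(real \<Rightarrow> complex) \<Rightarrow> bool" where
  "smooth_param \<gamma> \<longleftrightarrow> (\<forall>n t. ((vderiv ^^ n) \<gamma>) differentiable (at t))"

text \<open>Smooth simple closed regular curve, counterclockwise, strictly positive (signed)
  curvature, bounding a compact convex domain.\<close>
definition convex_table :: "(real \<Rightarrow> complex) \<Rightarrow> real \<Rightarrow> bool" where
  "convex_table \<gamma> L \<longleftrightarrow>
     L > 0 \<and> smooth_param \<gamma> \<and> (\<forall>t. \<gamma> (t + L) = \<gamma> t) \<and> inj_on \<gamma> {0..<L} \<and>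
     (\<forall>t. vderiv \<gamma> t \<noteq> 0) \<and>
     (\<forall>t. Im (cnj (vderiv \<gamma> t) * vderiv (vderiv \<gamma>) t) > 0) \<and>
     (\<exists>K. compact K \<and> convex K \<and> interior K \<noteq> {} \<and> frontier K = \<gamma> ` {0..<L})"

definition curve_set :: "(real \<Rightarrow> complex) \<Rightarrow> real \<Rightarrow> complex set" where
  "curve_set \<gamma> L = \<gamma> ` {0..<L}"

definition unit_tangent :: "(real \<Rightarrow> complex) \<Rightarrow> real \<Rightarrow> complex \<Rightarrow> complex" where
  "unit_tangent \<gamma> L x =
     (let s = (SOME s. s \<in> {0..<L} \<and> \<gamma> s = x)
      in vderiv \<gamma> s / of_real (norm (vderiv \<gamma> s)))"

definition line_angle :: "complex \<Rightarrow> complex \<Rightarrow> real" where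
  "line_angle v t = (let a = arccos ((v \<bullet> t) / norm v) in min a (pi - a))"

definition gutkin_table :: "(real \<Rightarrow> complex) \<Rightarrow> real \<Rightarrow> bool" where
  "gutkin_table \<gamma> L \<longleftrightarrow> convex_table \<gamma> L \<and>
     (\<exists>\<delta>. 0 < \<delta> \<and> \<delta> < pi / 2 \<and>
        (\<forall>p \<in> curve_set \<gamma> L. \<forall>q \<in> curve_set \<gamma> L. p \<noteq> q \<longrightarrow>
           line_angle (q - p) (unit_tangent \<gamma> L p) = \<delta> \<longrightarrow>
           line_angle (q - p) (unit_tangent \<gamma> L q) = \<delta>))"

text \<open>Billiard ball map on the closed phase cylinder S x [0, pi]. The angle alpha is
  measured counterclockwise from the oriented unit tangent, so the outgoing direction at x
  is (unit tangent) * cis alpha, which points into the domain for 0 < alpha < pi.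
  The boundary circles alpha = 0 and alpha = pi are fixed pointwise (the standard
  continuous extension).\<close>
definition hit_point :: "(real \<Rightarrow> complex) \<Rightarrow> real \<Rightarrow> complex \<Rightarrow> real \<Rightarrow> complex" where
  "hit_point \<gamma> L x \<alpha> =
     (THE y. y \<in> curve_set \<gamma> L \<and> y \<noteq> x \<and>
        (\<exists>r>0. y = x + of_real r * (unit_tangent \<gamma> L x * cis \<alpha>)))"

definition reflect_line :: "complex \<Rightarrow> complex \<Rightarrow> complex" where
  "reflect_line t u = of_real (2 * (u \<bullet> t)) * t - u"

definition billiard_map :: "(real \<Rightarrow> complex) \<Rightarrow> real \<Rightarrow> complex \<times> real \<Rightarrow> complex \<times> real" where
  "billiard_map \<gamma> L = (\<lambda>(x, \<alpha>).
     if \<alpha> = 0 \<or> \<alpha> = pi then (x, \<alpha>)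
     else (let y = hit_point \<gamma> L x \<alpha>;
               u = (y - x) / of_real (norm (y - x));
               w = reflect_line (unit_tangent \<gamma> L y) u
           in (y, arccos (w \<bullet> unit_tangent \<gamma> L y))))"

definition T_invariant :: "(real \<Rightarrow> complex) \<Rightarrow> real \<Rightarrow> (complex \<times> real) set \<Rightarrow> bool" where
  "T_invariant \<gamma> L C \<longleftrightarrow> billiard_map \<gamma> L ` C = C"

definition level_curve :: "(real \<Rightarrow> complex) \<Rightarrow> real \<Rightarrow> real \<Rightarrow> (complex \<times> real) set" where
  "level_curve \<gamma> L \<delta> = {(x, \<delta>) | x. x \<in> curve_set \<gamma> L}"

definition strip :: "(real \<Rightarrow> complex) \<Rightarrow> real \<Rightarrow> real \<Rightarrow> real \<Rightarrow> (complex \<times> real) set" where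
  "strip \<gamma> L \<delta>1 \<delta>2 = {(x, \<alpha>) | x \<alpha>. x \<in> curve_set \<gamma> L \<and> \<delta>1 \<le> \<alpha> \<and> \<alpha> \<le> \<delta>2}"

definition rotational_invariant_curve :: "(real \<Rightarrow> complex) \<Rightarrow> real \<Rightarrow> (complex \<times> real) set \<Rightarrow> bool" where
  "rotational_invariant_curve \<gamma> L C \<longleftrightarrow>
     (\<exists>f. continuous_on (curve_set \<gamma> L) f \<and> C = {(x, f x) | x. x \<in> curve_set \<gamma> L}) \<and>
     T_invariant \<gamma> L C"

definition foliated_by_rotational_invariant_curves ::
  "(real \<Rightarrow> complex) \<Rightarrow> real \<Rightarrow> (complex \<times> real) set \<Rightarrow> bool" where
  "foliated_by_rotational_invariant_curves \<gamma> L \<Omega> \<longleftrightarrow>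
     (\<exists>\<F>. (\<forall>C \<in> \<F>. rotational_invariant_curve \<gamma> L C \<and> C \<subseteq> \<Omega>) \<and>
          (\<forall>p \<in> \<Omega>. \<exists>!C. C \<in> \<F> \<and> p \<in> C))"

end

theory Submission
  imports Defs
begin

text \<open>Parametrise the table by its tangent angle, so that a chord from \<open>\<theta>\<close> to \<open>y\<close> has length \<open>H(\<theta>, y)\<close>, the
  billiard map is generated by \<open>H\<close>, and an invariant curve of constant angle \<open>\<delta>\<close> is the line
  \<open>y = \<theta> + 2\<delta>\<close>. Hence the strip and its invariant measure \<open>H\<^sub>1\<^sub>2 d\<theta> dy\<close> are preserved by the rotations
  \<open>(\<theta>, y) \<mapsto> (\<theta> + \<epsilon>, y + \<epsilon>)\<close> and by the map, respectively. Every orbit on an invariant graph maximises length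
  (the graph is calibrated by \<open>U\<close> with \<open>U' = \<rho> cos f\<close>), so the gain of length under rotation, summed along an
  orbit, stays bounded and its integral over the strip is nonpositive. Expanding to second order in \<open>\<epsilon>\<close>
  yields Hopf's inequality \<open>(g \<delta>2 - g \<delta>1) \<integral>\<rho>\<^sup>2 \<le> \<integral> H d\<mu>\<close> with \<open>g \<delta> = \<delta> - sin \<delta> cos \<delta>\<close>. By Green's theorem and
  the constant-angle property the right-hand side is \<open>2A (g \<delta>2 - g \<delta>1)\<close>, \<open>A\<close> being the enclosed area.
  So \<open>\<integral>\<rho>\<^sup>2 \<le> 2A\<close>, while the isoperimetric inequality (Wirtinger for the support function) and
  Cauchy--Schwarz give the converse, with equality only for constant \<open>\<rho>\<close>.\<close>

section \<open>Calculus\<close>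

text \<open>Hopf's argument usually differentiates the leaves or uses Jacobi fields. Here a leaf is
  only continuous, so finite displacements take their place: chords of a leaf are compared with
  their rotated copies, and only the chord length, which is smooth, is expanded in
  \<open>\<epsilon>\<close>. Advancing both tangent angles together is the symmetry of a circular
  table. The first-order term and the part of the second-order term containing
  \<open>\<rho>'\<close> are differences of one phase function at consecutive bounces, so they
  integrate to zero. What survives is \<open>width - chord\<close> plus the square
  \<open>(width - chord)^2 / chord\<close>, which is dropped. This square vanishes exactly when the
  chord turns as fast as the tangents, as in a circle, so the dropped term costs nothing in the
  extremal case. The recurring obstacle is the diagonal \<open>y = \<theta>\<close>, which belongs
  to the strip when \<open>\<delta>1 = 0\<close>. The chord vanishes there and its direction is
  lost. The average velocity restores continuity, but derivatives are taken only for
  \<open>\<theta> < y\<close>, and each integral identity treats the degenerate edge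
  separately.\<close>

lemma has_real_derivative_Re_Im:
  assumes "(f has_vector_derivative f') F"
  shows "((\<lambda>x. Re (f x)) has_real_derivative Re f') F" "((\<lambda>x. Im (f x)) has_real_derivative Im f') F"
  using bounded_linear.has_vector_derivative[OF bounded_linear_Re assms]
    bounded_linear.has_vector_derivative[OF bounded_linear_Im assms]
  by (simp_all add: has_real_derivative_iff_has_vector_derivative)

lemma has_vector_derivative_cis:
  assumes "(f has_real_derivative f') (at t)"
  shows "((\<lambda>t. cis (f t)) has_vector_derivative \<i> * of_real f' * cis (f t)) (at t)"
proof -
  have "((\<lambda>t. \<i> * complex_of_real (f t)) has_vector_derivative \<i> * of_real f') (at t)"
    using has_vector_derivative_of_real[OF assms]
    by (intro has_vector_derivative_mult_right)
  from field_vector_diff_chain_at[OF this DERIV_exp] show ?thesis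
    by (simp add: o_def cis_conv_exp)
qed

lemma has_real_derivative_norm_curve:
  fixes w :: "real \<Rightarrow> complex"
  assumes "(w has_vector_derivative w') (at t)" "w t \<noteq> 0"
  shows "((\<lambda>t. norm (w t)) has_real_derivative Re (cnj (sgn (w t)) * w')) (at t)"
proof -
  have "((\<lambda>t. norm (w t)) has_derivative (\<lambda>h. sgn (w t) \<bullet> (h *\<^sub>R w'))) (at t)"
    using has_derivative_compose[OF assms(1)[unfolded has_vector_derivative_def] has_derivative_norm[OF assms(2)]]
    by (simp add: inner_commute)
  moreover have "(\<lambda>h. sgn (w t) \<bullet> (h *\<^sub>R w')) = (\<lambda>h. Re (cnj (sgn (w t)) * w') * h)"
    by (auto simp: inner_complex_def algebra_simps)
  ultimately show ?thesis unfolding has_field_derivative_def by simp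
qed

text \<open>A unit vector can only rotate; its angular velocity is the component of
  \<open>w'\<close> normal to \<open>w\<close> divided by the length of \<open>w\<close>. Both the
  turning of chords and the tangent angle of the table come from this formula.\<close>

lemma has_vector_derivative_sgn_curve:
  fixes w :: "real \<Rightarrow> complex"
  assumes "(w has_vector_derivative w') (at t)" "w t \<noteq> 0"
  shows "((\<lambda>t. sgn (w t)) has_vector_derivative
           \<i> * sgn (w t) * of_real (Im (cnj (sgn (w t)) * w') / norm (w t))) (at t)"
proof -
  define n where "n = sgn (w t)"
  define r where "r = norm (w t)"
  have r: "r > 0" using assms by (simp add: r_def)
  have wt: "w t = of_real r * n" using assms(2) by (simp add: n_def r_def sgn_eq)
  have n1: "cnj n * n = 1"
    by (metis assms(2) complex_norm_square mult.commute n_def norm_sgn of_real_1 power_one)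
  have N: "((\<lambda>t. norm (w t)) has_real_derivative Re (cnj n * w')) (at t)"
    unfolding n_def by (rule has_real_derivative_norm_curve[OF assms])
  have I: "((\<lambda>t. inverse (norm (w t))) has_real_derivative - (Re (cnj n * w') / r\<^sup>2)) (at t)"
    using DERIV_inverse_fun[OF N] r by (simp add: r_def power2_eq_square field_simps)
  have "((\<lambda>t. inverse (norm (w t)) *\<^sub>R w t) has_vector_derivative
          (inverse r *\<^sub>R w' + (- (Re (cnj n * w') / r\<^sup>2)) *\<^sub>R w t)) (at t)"
    using has_vector_derivative_scaleR[OF I assms(1)] by (simp add: r_def)
  moreover have "inverse r *\<^sub>R w' + (- (Re (cnj n * w') / r\<^sup>2)) *\<^sub>R w t
     = \<i> * n * of_real (Im (cnj n * w') / r)"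
  proof -
    have "w' = n * (cnj n * w')" using n1 by (simp add: algebra_simps)
    also have "\<dots> = n * (of_real (Re (cnj n * w')) + \<i> * of_real (Im (cnj n * w')))"
      by (metis complex_eq)
    finally have w': "w' = n * (of_real (Re (cnj n * w')) + \<i> * of_real (Im (cnj n * w')))" .
    define a b where "a = Re (cnj n * w')" and "b = Im (cnj n * w')"
    have "inverse r *\<^sub>R w' + (- (a / r\<^sup>2)) *\<^sub>R w t = \<i> * n * of_real (b / r)"
      unfolding wt using w'[folded a_def b_def] r
      by (simp add: scaleR_conv_of_real field_simps power2_eq_square)
    then show ?thesis by (simp add: a_def b_def)
  qed
  ultimately show ?thesis
    by (simp add: n_def r_def sgn_div_norm divide_inverse_commute)
qed

lemma continuous_has_antiderivative:
  fixes f :: "real \<Rightarrow> real"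
  assumes c: "continuous_on UNIV f"
  obtains F where "\<And>x. (F has_real_derivative f x) (at x)"
    "\<And>x y. x \<le> y \<Longrightarrow> integral {x..y} f = F y - F x"
proof -
  define F where "F x = (if x \<ge> 0 then integral {0..x} f else - integral {x..0} f)" for x
  have int: "f integrable_on {x..y}" for x y
    using c continuous_on_subset integrable_continuous_real by blast
  have F: "integral {x..y} f = F y - F x" if "x \<le> y" for x y
  proof -
    consider "0 \<le> x" | "x < 0" "0 \<le> y" | "y < 0" using that by linarith
    then show ?thesis
      by cases (use Henstock_Kurzweil_Integration.integral_combine[OF _ _ int, of 0 x y] Henstock_Kurzweil_Integration.integral_combine[OF _ _ int, of x 0 y]
          Henstock_Kurzweil_Integration.integral_combine[OF _ _ int, of x y 0] that in \<open>auto simp: F_def\<close>)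
  qed
  have F': "(F has_real_derivative f x) (at x)" for x
  proof -
    have "((\<lambda>u. integral {x-1..u} f) has_vector_derivative f x) (at x within {x-1..x+1})"
      by (rule integral_has_vector_derivative) (auto intro: continuous_on_subset[OF c])
    then have "((\<lambda>u. integral {x-1..u} f) has_vector_derivative f x) (at x)"
      by (simp add: at_within_Icc_at)
    then have "((\<lambda>u. integral {x-1..u} f + F (x-1)) has_real_derivative f x) (at x)"
      by (auto simp: has_real_derivative_iff_has_vector_derivative intro!: derivative_eq_intros)
    moreover have "eventually (\<lambda>u. u \<in> {x-1<..}) (nhds x)"
      by (intro eventually_nhds_in_open) auto
    then have "eventually (\<lambda>u. integral {x-1..u} f + F (x-1) = F u) (nhds x)"
      by (rule eventually_mono) (use F in fastforce)
    ultimately show ?thesis by (subst (asm) DERIV_cong_ev[OF refl _ refl]) auto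
  qed
  show thesis by (rule that[OF F' F])
qed

lemma integral_periodic_shift:
  fixes f :: "real \<Rightarrow> real"
  assumes c: "continuous_on UNIV f" and p: "\<And>x. f (x + T) = f x" and T: "T > 0"
  shows "integral {0..T} (\<lambda>x. f (x + a)) = integral {0..T} f"
proof -
  obtain F where F': "\<And>x. (F has_real_derivative f x) (at x)"
    and F: "\<And>x y. x \<le> y \<Longrightarrow> integral {x..y} f = F y - F x"
    using continuous_has_antiderivative[OF c] by blast
  have "((\<lambda>a. F (a + T) - F a) has_real_derivative 0) (at a)" for a
    by (rule derivative_eq_intros DERIV_chain2[OF F'] refl | simp add: p)+
  then have "F (a + T) - F a = F (0 + T) - F 0"
    using DERIV_isconst_all by blast
  then have "integral {0 + a..T + a} f = integral {0..T} f"
    using F[of a "T + a"] F[of 0 T] T by (simp add: add.commute)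
  moreover have "integral {0..T} (f \<circ> (\<lambda>x. x + a)) = integral {0 + a..T + a} f"
    by (rule integral_shift) (rule continuous_on_subset[OF c], simp)
  ultimately show ?thesis by (simp add: o_def)
qed

lemma real_derivative_has_integral:
  fixes f :: "real \<Rightarrow> real"
  assumes "a \<le> b" "\<And>x. x \<in> {a..b} \<Longrightarrow> (f has_real_derivative f' x) (at x)"
  shows "(f' has_integral (f b - f a)) {a..b}"
proof (rule fundamental_theorem_of_calculus[OF assms(1)])
  fix x assume "x \<in> {a..b}"
  from has_field_derivative_at_within[OF assms(2)[OF this]]
  show "(f has_vector_derivative f' x) (at x within {a..b})"
    unfolding has_real_derivative_iff_has_vector_derivative .
qed

lemma integral_periodic_deriv:
  fixes f :: "real \<Rightarrow> real"
  assumes "\<And>x. (f has_real_derivative f' x) (at x)" "f T = f 0" "0 \<le> T"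
  shows "integral {0..T} f' = 0"
  using real_derivative_has_integral[OF assms(3,1)] assms(2) by (simp add: integral_unique)

lemma cis_2pi_shift [simp]: "cis (t + 2 * pi) = cis t" "cis (- t - 2 * pi) = cis (- t)"
  by (simp_all add: complex_eq_iff cos_diff sin_diff)

lemma periodic_bounded:
  fixes f :: "real \<Rightarrow> real"
  assumes "continuous_on UNIV f" "\<And>t. f (t + 2 * pi) = f t"
  obtains B where "B > 0" "\<And>t. \<bar>f t\<bar> \<le> B"
proof -
  interpret periodic_fun_simple f "2 * pi" by standard (use assms in simp)
  have "compact (f ` {0..2*pi})"
    by (intro compact_continuous_image continuous_on_subset[OF assms(1)]) auto
  then obtain B where B: "B > 0" "\<And>y. y \<in> f ` {0..2*pi} \<Longrightarrow> norm y \<le> B"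
    using compact_imp_bounded bounded_pos by metis
  have "\<bar>f t\<bar> \<le> B" for t
  proof -
    define k where "k = \<lfloor>t / (2 * pi)\<rfloor>"
    have "of_int k \<le> t / (2 * pi)" "t / (2 * pi) < of_int k + 1" unfolding k_def by linarith+
    then have "t - of_int k * (2 * pi) \<in> {0..2*pi}" by (simp add: field_simps)
    then have "norm (f (t - of_int k * (2 * pi))) \<le> B" using B(2) by blast
    then show ?thesis by (simp add: minus_of_int)
  qed
  then show thesis using B(1) that by blast
qed

lemma compose_cont:
  assumes F: "continuous_on B (\<lambda>z. F (fst z) (snd z))"
    and "continuous_on A f" "continuous_on A g" "\<And>x. x \<in> A \<Longrightarrow> (f x, g x) \<in> B"
  shows "continuous_on A (\<lambda>x. F (f x) (g x))"
  using continuous_on_compose2[OF F continuous_on_Pair[OF assms(2,3)]] assms(4) by auto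

lemma shift_deriv:
  assumes "\<And>t. (f has_vector_derivative f' t) (at t)"
  shows "((\<lambda>s. f (s + v)) has_vector_derivative f' (s + v)) (at s)"
    "((\<lambda>s. f (s - v)) has_vector_derivative f' (s - v)) (at s)"
    "((\<lambda>v. f (s + v)) has_vector_derivative f' (s + v)) (at v)"
    "((\<lambda>v. f (s - v)) has_vector_derivative - f' (s - v)) (at v)"
proof -
  have 1: "((\<lambda>s. s + v) has_vector_derivative 1) (at s)" "((\<lambda>s. s - v) has_vector_derivative 1) (at s)"
    "((\<lambda>v. s + v) has_vector_derivative 1) (at v)" "((\<lambda>v. s - v) has_vector_derivative - 1) (at v)"
    unfolding has_real_derivative_iff_has_vector_derivative[symmetric]
    by (auto intro!: derivative_eq_intros)
  show "((\<lambda>s. f (s + v)) has_vector_derivative f' (s + v)) (at s)"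
    "((\<lambda>s. f (s - v)) has_vector_derivative f' (s - v)) (at s)"
    "((\<lambda>v. f (s + v)) has_vector_derivative f' (s + v)) (at v)"
    "((\<lambda>v. f (s - v)) has_vector_derivative - f' (s - v)) (at v)"
    using vector_diff_chain_at[OF 1(1) assms] vector_diff_chain_at[OF 1(2) assms]
      vector_diff_chain_at[OF 1(3) assms] vector_diff_chain_at[OF 1(4) assms]
    by (simp_all add: o_def)
qed

lemma Im_divide_eq: "Im (a / b) = Im (cnj b * a) / (norm b)\<^sup>2"
  by (simp add: complex_div_cnj[of a b] mult.commute del: complex_cnj_divide)

section \<open>Wirtinger's inequality\<close>

text \<open>Completing the square: \<open>v'\<^sup>2 - v\<^sup>2 - (v' - v cot)\<^sup>2\<close> is the derivative of \<open>v\<^sup>2 cot\<close>.\<close>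

lemma wirtinger_dirichlet:
  fixes v v' :: "real \<Rightarrow> real"
  assumes v: "\<And>x. (v has_real_derivative v' x) (at x)" and v': "continuous_on UNIV v'"
    and z: "v a = 0" "v (a + pi) = 0"
  shows "integral {a..a+pi} (\<lambda>x. (v x)\<^sup>2) \<le> integral {a..a+pi} (\<lambda>x. (v' x)\<^sup>2)"
proof -
  define B where "B x = (v x)\<^sup>2 * cot (x - a)" for x
  define B' where "B' x = 2 * v x * v' x * cot (x - a) - (v x)\<^sup>2 * inverse ((sin (x - a))\<^sup>2)" for x
  have cv: "continuous_on UNIV v" using v DERIV_isCont continuous_at_imp_continuous_on by blast
  \<comment> \<open>The pole of the cotangent is cancelled by the zero of \<open>v\<close>:
    \<open>v^2 * cot\<close> equals \<open>v * (v / sin) * cos\<close>, where the quotient converges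
    as a ratio of difference quotients and the leading \<open>v\<close> tends to zero.\<close>
  have lim: "(B \<longlongrightarrow> B x) (at x)" if x: "v x = 0" "sin (x - a) = 0" for x
  proof -
    have s: "((\<lambda>x. sin (x - a)) has_real_derivative cos (x - a)) (at x)"
      by (auto intro!: derivative_eq_intros)
    have c0: "cos (x - a) \<noteq> 0" using x(2) by (metis cos_zero_iff sin_zero_iff_int2 sin_cos_squared_add2 zero_power2 add.right_neutral one_neq_zero)
    have A1: "((\<lambda>y. (v y - v x) / (y - x)) \<longlongrightarrow> v' x) (at x)"
      using v[of x] by (simp add: has_field_derivative_iff)
    have A2: "((\<lambda>y. (sin (y - a) - sin (x - a)) / (y - x)) \<longlongrightarrow> cos (x - a)) (at x)"
      using s by (simp add: has_field_derivative_iff)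
    have A3: "(v \<longlongrightarrow> v x) (at x)" using v DERIV_isCont isCont_def by blast
    have A4: "((\<lambda>y. cos (y - a)) \<longlongrightarrow> cos (x - a)) (at x)" by (intro tendsto_intros)
    have "((\<lambda>y. v y * (((v y - v x) / (y - x)) / ((sin (y - a) - sin (x - a)) / (y - x))) * cos (y - a))
        \<longlongrightarrow> v x * (v' x / cos (x - a)) * cos (x - a)) (at x)"
      by (intro tendsto_intros A1 A2 A3 A4 c0)
    moreover have "eventually (\<lambda>y. v y * (((v y - v x) / (y - x)) / ((sin (y - a) - sin (x - a)) / (y - x))) * cos (y - a) = B y) (at x)"
      using x by (auto simp: eventually_at_filter B_def cot_def power2_eq_square)
    ultimately have "(B \<longlongrightarrow> v x * (v' x / cos (x - a)) * cos (x - a)) (at x)"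
      by (rule Lim_transform_eventually)
    then show ?thesis using x by (simp add: B_def)
  qed
  have cB: "continuous_on {a..a+pi} B"
    unfolding continuous_on_def
  proof
    fix x assume x: "x \<in> {a..a+pi}"
    show "(B \<longlongrightarrow> B x) (at x within {a..a+pi})"
    proof (cases "sin (x - a) = 0")
      case True
      have "x = a \<or> x = a + pi"
        using x True sin_gt_zero[of "x - a"] by force
      then have "v x = 0" using z by auto
      from lim[OF this True] show ?thesis by (rule tendsto_within_subset) auto
    next
      case False
      have "isCont B x" unfolding B_def cot_def using False v DERIV_isCont
        by (intro continuous_intros) auto
      then show ?thesis by (simp add: continuous_at_imp_continuous_at_within continuous_within[symmetric])
    qed
  qed
  have dB: "(B has_vector_derivative B' x) (at x)" if x: "x \<in> {a<..<a+pi}" for x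
  proof -
    have "sin (x - a) \<noteq> 0" using x sin_gt_zero[of "x - a"] by force
    then show ?thesis unfolding B_def B'_def has_real_derivative_iff_has_vector_derivative[symmetric]
      by (auto intro!: derivative_eq_intros v DERIV_chain2[OF DERIV_cot, where g = "\<lambda>x. x - a"]
          simp: algebra_simps)
  qed
  have I: "(B' has_integral (B (a+pi) - B a)) {a..a+pi}"
    by (rule fundamental_theorem_of_calculus_interior[OF _ cB dB]) auto
  have le: "B' x \<le> (v' x)\<^sup>2 - (v x)\<^sup>2" if x: "x \<in> {a..a+pi}" for x
  proof (cases "sin (x - a) = 0")
    case True
    have "x = a \<or> x = a + pi"
      using x True sin_gt_zero[of "x - a"] by force
    then show ?thesis using z by (auto simp: B'_def)
  next
    case False
    have "(v' x - v x * cot (x - a))\<^sup>2 \<ge> 0" by simp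
    moreover have "inverse ((sin (x - a))\<^sup>2) = 1 + (cot (x - a))\<^sup>2"
      using False sin_cos_squared_add[of "x - a"] by (simp add: cot_def field_simps)
    ultimately show ?thesis unfolding B'_def
      by (simp add: power2_eq_square algebra_simps)
  qed
  have "B (a+pi) - B a \<le> integral {a..a+pi} (\<lambda>x. (v' x)\<^sup>2 - (v x)\<^sup>2)"
    by (rule has_integral_le[OF I integrable_integral])
      (auto intro!: integrable_continuous_real continuous_intros le
       continuous_on_subset[OF cv] continuous_on_subset[OF v'])
  then show ?thesis using z
    by (subst (asm) integral_diff)
      (auto intro!: integrable_continuous_real continuous_intros
       continuous_on_subset[OF cv] continuous_on_subset[OF v'] simp: B_def)
qed

text \<open>A \<open>2\<pi>\<close>-periodic function takes equal values at some pair of antipodal points; subtracting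
  that value reduces to two Dirichlet problems on half periods.\<close>

lemma wirtinger_periodic:
  fixes u u' :: "real \<Rightarrow> real"
  assumes u: "\<And>x. (u has_real_derivative u' x) (at x)" and u': "continuous_on UNIV u'"
    and per: "\<And>x. u (x + 2 * pi) = u x" "\<And>x. u' (x + 2 * pi) = u' x"
    and mean: "integral {0..2*pi} u = 0"
  shows "integral {0..2*pi} (\<lambda>x. (u x)\<^sup>2) \<le> integral {0..2*pi} (\<lambda>x. (u' x)\<^sup>2)"
proof -
  have cu: "continuous_on A u" for A
    using u DERIV_isCont continuous_at_imp_continuous_on by blast
  have cu': "continuous_on A u'" for A using u' continuous_on_subset by blast
  obtain a where a: "u (a + pi) = u a"
  proof -
    define d where "d x = u (x + pi) - u x" for x
    have cd: "continuous_on A d" for A unfolding d_def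
      by (intro continuous_intros continuous_on_compose2[OF cu[of UNIV]]) auto
    have "d pi = - d 0" using per(1)[of 0] by (simp add: d_def)
    then consider "d 0 \<le> 0" "0 \<le> d pi" | "0 \<le> d 0" "d pi \<le> 0" by linarith
    then have "\<exists>x. d x = 0"
      by cases (use IVT'[of d 0 0 pi] IVT2'[of d pi 0 0] cd in auto)
    then show thesis using that by (auto simp: d_def)
  qed
  define v where "v x = u x - u a" for x
  have dv: "(v has_real_derivative u' x) (at x)" for x
    unfolding v_def by (auto intro!: derivative_eq_intros u)
  have cv: "continuous_on A v" for A
    using dv DERIV_isCont continuous_at_imp_continuous_on by blast
  have "v a = 0" "v (a + pi) = 0" "v (a + pi + pi) = 0"
    using a per(1)[of a] by (auto simp: v_def add.assoc)
  from wirtinger_dirichlet[OF dv u' this(1,2)] wirtinger_dirichlet[OF dv u' this(2,3)]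
  have "integral {a..a+pi} (\<lambda>x. (v x)\<^sup>2) + integral {a+pi..a+pi+pi} (\<lambda>x. (v x)\<^sup>2)
      \<le> integral {a..a+pi} (\<lambda>x. (u' x)\<^sup>2) + integral {a+pi..a+pi+pi} (\<lambda>x. (u' x)\<^sup>2)"
    by linarith
  moreover have int: "(\<lambda>x. (v x)\<^sup>2) integrable_on A" "(\<lambda>x. (u' x)\<^sup>2) integrable_on A" if "A = {x..y}" for A x y
    using that by (auto intro!: integrable_continuous_real continuous_intros cv cu')
  ultimately have le: "integral {a..a+pi+pi} (\<lambda>x. (v x)\<^sup>2) \<le> integral {a..a+pi+pi} (\<lambda>x. (u' x)\<^sup>2)"
    using Henstock_Kurzweil_Integration.integral_combine[of a "a+pi" "a+pi+pi" "\<lambda>x. (v x)\<^sup>2"]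
      Henstock_Kurzweil_Integration.integral_combine[of a "a+pi" "a+pi+pi" "\<lambda>x. (u' x)\<^sup>2"] by auto
  have sh: "integral {a..a+pi+pi} f = integral {0..2*pi} f"
    if c: "continuous_on UNIV f" and p: "\<And>x. f (x + 2*pi) = f x" for f :: "real \<Rightarrow> real"
  proof -
    have "integral {0..2*pi} (f \<circ> (\<lambda>x. x + a)) = integral {0 + a..2*pi + a} f"
      by (rule integral_shift) (rule continuous_on_subset[OF c], simp)
    then show ?thesis using integral_periodic_shift[OF c p, of a] by (simp add: o_def algebra_simps)
  qed
  \<comment> \<open>Since \<open>u\<close> has mean zero, subtracting the constant
    \<open>u a\<close> can only enlarge the integral of the square.\<close>
  have "integral {0..2*pi} (\<lambda>x. (v x)\<^sup>2) = integral {0..2*pi} (\<lambda>x. (u x)\<^sup>2 - (2 * u a) * u x + (u a)\<^sup>2)"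
    by (simp add: v_def power2_diff algebra_simps)
  also have "\<dots> = integral {0..2*pi} (\<lambda>x. (u x)\<^sup>2) - (2 * u a) * integral {0..2*pi} u + 2 * pi * (u a)\<^sup>2"
    by (subst integral_add integral_diff integral_mult_right;
        (intro integrable_continuous_real continuous_intros cu)?)+ auto
  finally have "integral {0..2*pi} (\<lambda>x. (u x)\<^sup>2) \<le> integral {0..2*pi} (\<lambda>x. (v x)\<^sup>2)"
    using mean by simp
  also have "\<dots> = integral {a..a+pi+pi} (\<lambda>x. (v x)\<^sup>2)"
    by (rule sh[symmetric]) (auto intro!: continuous_intros cv, simp add: v_def per)
  also note le
  also have "integral {a..a+pi+pi} (\<lambda>x. (u' x)\<^sup>2) = integral {0..2*pi} (\<lambda>x. (u' x)\<^sup>2)"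
    by (rule sh) (auto intro!: continuous_intros cu' simp: per)
  finally show ?thesis .
qed

section \<open>Ovals parametrised by the tangent angle\<close>

text \<open>An oval parametrised by its tangent angle; \<open>\<rho>\<close> is the radius of curvature.\<close>

locale oval =
  fixes \<Gamma> :: "real \<Rightarrow> complex" and \<rho> \<rho>' :: "real \<Rightarrow> real"
  assumes \<Gamma>_deriv: "(\<Gamma> has_vector_derivative of_real (\<rho> t) * cis t) (at t)"
    and \<rho>_deriv: "(\<rho> has_real_derivative \<rho>' t) (at t)"
    and \<rho>'_cont: "continuous_on UNIV \<rho>'"
    and \<rho>_pos: "\<rho> t > 0"
    and \<Gamma>_periodic: "\<Gamma> (t + 2 * pi) = \<Gamma> t"
begin

lemma \<rho>_cont: "continuous_on A \<rho>"
  using \<rho>_deriv DERIV_isCont continuous_at_imp_continuous_on by blast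

lemma \<Gamma>_cont: "continuous_on A \<Gamma>"
  using \<Gamma>_deriv has_vector_derivative_continuous continuous_at_imp_continuous_on by blast

lemma \<rho>_periodic: "\<rho> (t + 2 * pi) = \<rho> t"
proof -
  have "((\<lambda>t. \<Gamma> (t + 2 * pi)) has_vector_derivative of_real (\<rho> (t + 2 * pi)) * cis (t + 2 * pi)) (at t)"
    using vector_diff_chain_at[OF _ \<Gamma>_deriv, of "\<lambda>t. t + 2 * pi" 1 t, unfolded o_def]
    by (simp add: has_vector_derivative_add_const)
  then have "((\<lambda>t. \<Gamma> t) has_vector_derivative of_real (\<rho> (t + 2 * pi)) * cis t) (at t)"
    by (simp add: \<Gamma>_periodic)
  from vector_derivative_unique_at[OF this \<Gamma>_deriv] show ?thesis by simp
qed

lemma \<rho>'_periodic: "\<rho>' (t + 2 * pi) = \<rho>' t"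
proof -
  have "((\<lambda>t. \<rho> (t + 2 * pi)) has_real_derivative \<rho>' (t + 2 * pi)) (at t)"
    using \<rho>_deriv[of "t + 2 * pi"] by (simp add: DERIV_shift add.commute)
  then show ?thesis using DERIV_unique[OF _ \<rho>_deriv] by (simp add: \<rho>_periodic)
qed

text \<open>The average velocity on \<open>[\<theta>, y]\<close>: it extends the chord direction continuously to the diagonal.\<close>

definition avg :: "real \<Rightarrow> real \<Rightarrow> complex" where
  "avg \<theta> y = integral {0..1} (\<lambda>t. of_real (\<rho> (\<theta> + t * (y - \<theta>))) * cis (\<theta> + t * (y - \<theta>)))"

definition chord :: "real \<Rightarrow> real \<Rightarrow> real" where
  "chord \<theta> y = norm (\<Gamma> y - \<Gamma> \<theta>)"

definition dir :: "real \<Rightarrow> real \<Rightarrow> complex" where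
  "dir \<theta> y = sgn (avg \<theta> y)"

definition cos_out :: "real \<Rightarrow> real \<Rightarrow> real" where
  "cos_out \<theta> y = Re (cis (- \<theta>) * dir \<theta> y)"

definition sin_out :: "real \<Rightarrow> real \<Rightarrow> real" where
  "sin_out \<theta> y = Im (cis (- \<theta>) * dir \<theta> y)"

definition cos_in :: "real \<Rightarrow> real \<Rightarrow> real" where
  "cos_in \<theta> y = Re (cis (- y) * dir \<theta> y)"

text \<open>At the arrival point the chord direction is turned clockwise from the tangent, so the
  sign is reversed to make both sines nonnegative.\<close>

definition sin_in :: "real \<Rightarrow> real \<Rightarrow> real" where
  "sin_in \<theta> y = - Im (cis (- y) * dir \<theta> y)"

text \<open>The mixed derivative \<open>H\<^sub>1\<^sub>2\<close> of the chord length, i.e. the density of the invariant measure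
  in the coordinates \<open>(\<theta>, y)\<close>; division by zero gives the correct limit 0 on the diagonal.\<close>

definition dens :: "real \<Rightarrow> real \<Rightarrow> real" where
  "dens \<theta> y = (\<rho> \<theta> * sin_out \<theta> y) * (\<rho> y * sin_in \<theta> y) / chord \<theta> y"

section \<open>Chords and their angles with the tangents\<close>

lemma chord_avg: "\<Gamma> y - \<Gamma> \<theta> = of_real (y - \<theta>) * avg \<theta> y"
proof -
  have "((\<lambda>t. of_real (y - \<theta>) * (of_real (\<rho> (\<theta> + t * (y - \<theta>))) * cis (\<theta> + t * (y - \<theta>)))) has_integral
     (\<Gamma> (\<theta> + 1 * (y - \<theta>)) - \<Gamma> (\<theta> + 0 * (y - \<theta>)))) {0..1}"
  proof (rule fundamental_theorem_of_calculus)
    fix t :: real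
    have "((\<lambda>t. \<Gamma> (\<theta> + t * (y - \<theta>))) has_vector_derivative
        ((y - \<theta>) *\<^sub>R (of_real (\<rho> (\<theta> + t * (y - \<theta>))) * cis (\<theta> + t * (y - \<theta>))))) (at t)"
      by (rule vector_diff_chain_at[OF _ \<Gamma>_deriv, unfolded o_def])
        (auto intro!: derivative_eq_intros)
    then show "((\<lambda>t. \<Gamma> (\<theta> + t * (y - \<theta>))) has_vector_derivative
       of_real (y - \<theta>) * (of_real (\<rho> (\<theta> + t * (y - \<theta>))) * cis (\<theta> + t * (y - \<theta>)))) (at t within {0..1})"
      by (simp add: scaleR_conv_of_real has_vector_derivative_at_within)
  qed simp
  from integral_unique[OF this] have "\<Gamma> y - \<Gamma> \<theta> =
     integral {0..1} (\<lambda>t. of_real (y - \<theta>) * (of_real (\<rho> (\<theta> + t * (y - \<theta>))) * cis (\<theta> + t * (y - \<theta>))))"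
    by simp
  also have "\<dots> = of_real (y - \<theta>) * avg \<theta> y"
    unfolding avg_def by (rule integral_mult_right)
  finally show ?thesis .
qed

lemma avg_cont: "continuous_on UNIV (\<lambda>z. avg (fst z) (snd z))"
proof -
  have "continuous_on UNIV (\<lambda>z. integral (cbox 0 1)
     (\<lambda>t. complex_of_real (\<rho> (fst z + t * (snd z - fst z))) * cis (fst z + t * (snd z - fst z))))"
    by (rule integral_continuous_on_param)
      (auto simp: split_beta intro!: continuous_intros continuous_on_compose2[OF \<rho>_cont[of UNIV]])
  then show ?thesis by (simp add: avg_def)
qed

lemma avg_diag: "avg \<theta> \<theta> = of_real (\<rho> \<theta>) * cis \<theta>"
  by (simp add: avg_def)

lemma avg_periodic: "avg (\<theta> + 2 * pi) (y + 2 * pi) = avg \<theta> y"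
proof -
  have "\<theta> + 2 * pi + t * (y + 2 * pi - (\<theta> + 2 * pi)) = (\<theta> + t * (y - \<theta>)) + 2 * pi" for t
    by simp
  then show ?thesis unfolding avg_def by (simp only: \<rho>_periodic cis_2pi_shift)
qed

lemma Im_chord_deriv:
  "((\<lambda>x. Im (cis (- \<theta>) * (\<Gamma> x - \<Gamma> \<theta>))) has_real_derivative \<rho> x * sin (x - \<theta>)) (at x)"
proof -
  have "((\<lambda>x. cis (- \<theta>) * (\<Gamma> x - \<Gamma> \<theta>)) has_vector_derivative cis (- \<theta>) * (of_real (\<rho> x) * cis x)) (at x)"
    by (auto intro!: derivative_eq_intros \<Gamma>_deriv)
  from has_real_derivative_Re_Im(2)[OF this]
  show ?thesis by (simp add: sin_diff algebra_simps)
qed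

text \<open>The height over the tangent line at \<open>\<theta>\<close> has derivative
  \<open>\<rho> x * sin (x - \<theta>)\<close>: it rises during the first half turn and falls back
  to zero during the second.\<close>

lemma out_pos:
  assumes "\<theta> < y" "y < \<theta> + 2 * pi"
  shows "Im (cis (- \<theta>) * (\<Gamma> y - \<Gamma> \<theta>)) > 0"
proof -
  define k where "k x = Im (cis (- \<theta>) * (\<Gamma> x - \<Gamma> \<theta>))" for x
  have dk: "(k has_real_derivative \<rho> x * sin (x - \<theta>)) (at x)" for x
    unfolding k_def by (rule Im_chord_deriv)
  have ck: "continuous_on A k" for A
    using dk DERIV_isCont continuous_at_imp_continuous_on by blast
  show ?thesis
  proof (cases "y \<le> \<theta> + pi")
    case True
    have "k \<theta> < k y"
    proof (rule DERIV_pos_imp_increasing_open[OF assms(1) _ ck])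
      fix x assume x: "\<theta> < x" "x < y"
      then have "sin (x - \<theta>) > 0" using True by (intro sin_gt_zero) auto
      then show "\<exists>l. (k has_real_derivative l) (at x) \<and> l > 0" using dk \<rho>_pos mult_pos_pos by blast
    qed
    then show ?thesis by (simp add: k_def)
  next
    case False
    have "k (\<theta> + 2 * pi) < k y"
    proof (rule DERIV_neg_imp_decreasing_open[OF assms(2) _ ck])
      fix x assume x: "y < x" "x < \<theta> + 2 * pi"
      then have "sin (x - \<theta>) < 0" using False by (intro sin_lt_zero) auto
      then show "\<exists>l. (k has_real_derivative l) (at x) \<and> l < 0" using dk \<rho>_pos mult_pos_neg by blast
    qed
    then show ?thesis by (simp add: k_def \<Gamma>_periodic)
  qed
qed

text \<open>This is \<open>out_pos\<close> for the complementary arc, from \<open>y\<close> to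
  \<open>\<theta> + 2 * pi\<close>.\<close>

lemma in_neg:
  assumes "\<theta> < y" "y < \<theta> + 2 * pi"
  shows "Im (cis (- y) * (\<Gamma> y - \<Gamma> \<theta>)) < 0"
  using out_pos[of y "\<theta> + 2 * pi"] assms unfolding \<Gamma>_periodic by (simp add: algebra_simps)

lemma \<Gamma>_neq:
  assumes "\<theta> < y" "y < \<theta> + 2 * pi"
  shows "\<Gamma> y - \<Gamma> \<theta> \<noteq> 0"
  using out_pos[OF assms] by auto

lemma avg_nonzero:
  assumes "\<theta> \<le> y" "y < \<theta> + 2 * pi"
  shows "avg \<theta> y \<noteq> 0"
proof (cases "\<theta> = y")
  case True then show ?thesis using \<rho>_pos[of y] by (simp add: avg_diag)
next
  case False
  then show ?thesis using chord_avg[of y \<theta>] \<Gamma>_neq[of \<theta> y] assms by auto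
qed

lemma chord_pos:
  assumes "\<theta> < y" "y < \<theta> + 2 * pi"
  shows "chord \<theta> y > 0"
  using \<Gamma>_neq[OF assms] by (simp add: chord_def)

lemma chord_diag [simp]: "chord \<theta> \<theta> = 0"
  by (simp add: chord_def)

lemma chord_nonneg [simp]: "chord \<theta> y \<ge> 0"
  by (simp add: chord_def)

lemma dir_eq:
  assumes "\<theta> < y"
  shows "dir \<theta> y = sgn (\<Gamma> y - \<Gamma> \<theta>)"
  unfolding dir_def chord_avg sgn_mult sgn_of_real using assms by simp

lemma dir_diag: "dir \<theta> \<theta> = cis \<theta>"
  using \<rho>_pos[of \<theta>] by (simp add: dir_def avg_diag sgn_mult sgn_of_real sgn_cis)

lemma norm_dir:
  assumes "\<theta> \<le> y" "y < \<theta> + 2 * pi"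
  shows "norm (dir \<theta> y) = 1"
  using avg_nonzero[OF assms] by (simp add: dir_def norm_sgn)

lemma \<Gamma>_diff:
  assumes "\<theta> \<le> y"
  shows "\<Gamma> y - \<Gamma> \<theta> = of_real (chord \<theta> y) * dir \<theta> y"
proof (cases "\<theta> = y")
  case False
  then show ?thesis using assms by (simp add: dir_eq chord_def sgn_eq)
qed simp

lemma diag_simps [simp]: "cos_out \<theta> \<theta> = 1" "cos_in \<theta> \<theta> = 1" "sin_out \<theta> \<theta> = 0" "sin_in \<theta> \<theta> = 0"
  "dens \<theta> \<theta> = 0"
  by (simp_all add: cos_out_def cos_in_def sin_out_def sin_in_def dens_def dir_diag cis_mult)

lemma cis_cos_out: "cis (- \<theta>) * dir \<theta> y = Complex (cos_out \<theta> y) (sin_out \<theta> y)"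
  by (simp add: cos_out_def sin_out_def complex_eq_iff)

lemma cis_cos_in: "cis (- y) * dir \<theta> y = Complex (cos_in \<theta> y) (- sin_in \<theta> y)"
  by (simp add: cos_in_def sin_in_def complex_eq_iff)

lemma cos_sin_out:
  assumes "\<theta> \<le> y" "y < \<theta> + 2 * pi"
  shows "(cos_out \<theta> y)\<^sup>2 + (sin_out \<theta> y)\<^sup>2 = 1"
proof -
  have "norm (cis (- \<theta>) * dir \<theta> y) = 1" using norm_dir[OF assms] by (simp add: norm_mult)
  then show ?thesis unfolding cis_cos_out by (simp add: complex_norm)
qed

lemma cos_sin_in:
  assumes "\<theta> \<le> y" "y < \<theta> + 2 * pi"
  shows "(cos_in \<theta> y)\<^sup>2 + (sin_in \<theta> y)\<^sup>2 = 1"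
proof -
  have "norm (cis (- y) * dir \<theta> y) = 1" using norm_dir[OF assms] by (simp add: norm_mult)
  then show ?thesis unfolding cis_cos_in by (simp add: complex_norm)
qed

lemma sin_out_chord: "\<theta> \<le> y \<Longrightarrow> sin_out \<theta> y * chord \<theta> y = Im (cis (- \<theta>) * (\<Gamma> y - \<Gamma> \<theta>))"
  by (simp add: \<Gamma>_diff sin_out_def algebra_simps)

lemma sin_in_chord: "\<theta> \<le> y \<Longrightarrow> sin_in \<theta> y * chord \<theta> y = - Im (cis (- y) * (\<Gamma> y - \<Gamma> \<theta>))"
  by (simp add: \<Gamma>_diff sin_in_def algebra_simps)

lemma sin_pos:
  assumes "\<theta> < y" "y < \<theta> + 2 * pi"
  shows "sin_out \<theta> y > 0" "sin_in \<theta> y > 0"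
proof -
  have "sin_out \<theta> y * chord \<theta> y > 0" "sin_in \<theta> y * chord \<theta> y > 0"
    using sin_out_chord[of \<theta> y] sin_in_chord[of \<theta> y] out_pos[OF assms] in_neg[OF assms] assms by simp_all
  then show "sin_out \<theta> y > 0" "sin_in \<theta> y > 0"
    using chord_pos[OF assms] by (simp_all add: zero_less_mult_iff)
qed

lemma sin_nonneg:
  assumes "\<theta> \<le> y" "y < \<theta> + 2 * pi"
  shows "sin_out \<theta> y \<ge> 0" "sin_in \<theta> y \<ge> 0"
  using sin_pos[of \<theta> y] assms by (cases "\<theta> = y"; force)+

lemma dens_nonneg:
  assumes "\<theta> \<le> y" "y < \<theta> + 2 * pi"
  shows "dens \<theta> y \<ge> 0"
  unfolding dens_def using sin_nonneg[OF assms] \<rho>_pos[of \<theta>] \<rho>_pos[of y] by simp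

lemma dir_periodic: "dir (\<theta> + 2 * pi) (y + 2 * pi) = dir \<theta> y"
  by (simp add: dir_def avg_periodic)

lemma chord_periodic: "chord (\<theta> + 2 * pi) (y + 2 * pi) = chord \<theta> y"
  by (simp add: chord_def \<Gamma>_periodic)

lemma angle_periodic:
  "cos_out (\<theta> + 2 * pi) (y + 2 * pi) = cos_out \<theta> y"
  "cos_in (\<theta> + 2 * pi) (y + 2 * pi) = cos_in \<theta> y"
  "sin_out (\<theta> + 2 * pi) (y + 2 * pi) = sin_out \<theta> y"
  "sin_in (\<theta> + 2 * pi) (y + 2 * pi) = sin_in \<theta> y"
  by (simp_all add: cos_out_def cos_in_def sin_out_def sin_in_def dir_periodic)

lemma dens_periodic: "dens (\<theta> + 2 * pi) (y + 2 * pi) = dens \<theta> y"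
  by (simp add: dens_def angle_periodic chord_periodic \<rho>_periodic)

section \<open>Variation of chords and continuity up to the diagonal\<close>

lemma chord_deriv:
  assumes "(a has_real_derivative a') (at t)" "(b has_real_derivative b') (at t)"
    and "a t < b t" "b t < a t + 2 * pi"
  shows "((\<lambda>t. chord (a t) (b t)) has_real_derivative
     \<rho> (b t) * cos_in (a t) (b t) * b' - \<rho> (a t) * cos_out (a t) (b t) * a') (at t)"
    and "((\<lambda>t. dir (a t) (b t)) has_vector_derivative
     \<i> * dir (a t) (b t) * of_real ((\<rho> (b t) * sin_in (a t) (b t) * b' + \<rho> (a t) * sin_out (a t) (b t) * a')
        / chord (a t) (b t))) (at t)"
proof -
  define w where "w t = \<Gamma> (b t) - \<Gamma> (a t)" for t
  define w' where "w' = b' *\<^sub>R (of_real (\<rho> (b t)) * cis (b t)) - a' *\<^sub>R (of_real (\<rho> (a t)) * cis (a t))"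
  have w: "(w has_vector_derivative w') (at t)"
    unfolding w_def w'_def
    by (intro has_vector_derivative_diff vector_diff_chain_at[OF _ \<Gamma>_deriv, unfolded o_def])
      (use assms in \<open>auto simp: has_real_derivative_iff_has_vector_derivative\<close>)
  have nz: "w t \<noteq> 0" using \<Gamma>_neq[OF assms(3,4)] by (simp add: w_def)
  have d: "dir (a t) (b t) = sgn (w t)" using assms(3) by (simp add: dir_eq w_def)
  have "Re (cnj (dir (a t) (b t)) * w') = \<rho> (b t) * cos_in (a t) (b t) * b' - \<rho> (a t) * cos_out (a t) (b t) * a'"
    unfolding w'_def cos_in_def cos_out_def by (simp add: algebra_simps)
  with has_real_derivative_norm_curve[OF w nz]
  show "((\<lambda>t. chord (a t) (b t)) has_real_derivative
     \<rho> (b t) * cos_in (a t) (b t) * b' - \<rho> (a t) * cos_out (a t) (b t) * a') (at t)"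
    by (simp add: d chord_def w_def)
  have I: "Im (cnj (dir (a t) (b t)) * w') = \<rho> (b t) * sin_in (a t) (b t) * b' + \<rho> (a t) * sin_out (a t) (b t) * a'"
    unfolding w'_def sin_in_def sin_out_def by (simp add: algebra_simps)
  have "isCont a t" "isCont b t" using assms DERIV_isCont by blast+
  then have "((\<lambda>t. b t - a t) \<longlongrightarrow> b t - a t) (at t)"
    unfolding isCont_def by (intro tendsto_intros)
  then have "eventually (\<lambda>s. b s - a s > 0) (at t)"
    by (rule order_tendstoD) (use assms in simp)
  \<comment> \<open>\<open>dir\<close> is defined through \<open>avg\<close> and agrees with the
    normalised chord only when the second angle is the larger one; continuity keeps that order near
    \<open>t\<close>.\<close>
  then have ev: "eventually (\<lambda>s. s \<in> UNIV \<longrightarrow> sgn (w s) = dir (a s) (b s)) (nhds t)"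
    unfolding eventually_at_filter
    by (rule eventually_mono) (use d in \<open>auto simp: dir_eq w_def\<close>)
  show "((\<lambda>t. dir (a t) (b t)) has_vector_derivative
     \<i> * dir (a t) (b t) * of_real ((\<rho> (b t) * sin_in (a t) (b t) * b' + \<rho> (a t) * sin_out (a t) (b t) * a')
        / chord (a t) (b t))) (at t)"
    using has_vector_derivative_sgn_curve[OF w nz]
    unfolding d[symmetric] I
    using has_vector_derivative_cong_ev[OF ev] by (simp add: chord_def w_def d)
qed

text \<open>\<open>K\<close> is the angular velocity of the chord. Its angle with the tangent at an
  endpoint changes at that rate less the rate at which the tangent turns, which is \<open>a'\<close>
  or \<open>b'\<close> since the parameter is the tangent angle.\<close>

lemma cos_deriv:
  assumes "(a has_real_derivative a') (at t)" "(b has_real_derivative b') (at t)"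
    and "a t < b t" "b t < a t + 2 * pi"
  defines "K \<equiv> (\<rho> (b t) * sin_in (a t) (b t) * b' + \<rho> (a t) * sin_out (a t) (b t) * a') / chord (a t) (b t)"
  shows "((\<lambda>t. cos_out (a t) (b t)) has_real_derivative - sin_out (a t) (b t) * (K - a')) (at t)"
    and "((\<lambda>t. cos_in (a t) (b t)) has_real_derivative sin_in (a t) (b t) * (K - b')) (at t)"
proof -
  have cis': "((\<lambda>t. cis (- f t)) has_vector_derivative - \<i> * of_real f' * cis (- f t)) (at t)"
    if "(f has_real_derivative f') (at t)" for f f'
    using has_vector_derivative_cis[OF DERIV_minus[OF that]] by simp
  have D: "((\<lambda>t. dir (a t) (b t)) has_vector_derivative \<i> * dir (a t) (b t) * of_real K) (at t)"
    unfolding K_def by (rule chord_deriv(2)[OF assms(1-4)])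
  note out = has_real_derivative_Re_Im(1)[OF has_vector_derivative_mult[OF cis'[OF assms(1)] D]]
  note inn = has_real_derivative_Re_Im(1)[OF has_vector_derivative_mult[OF cis'[OF assms(2)] D]]
  have "(- \<i> * of_real f' * e) * d + e * (\<i> * d * of_real K) = \<i> * (e * d) * of_real (K - f')" for e d f'
    by (simp add: algebra_simps)
  with out show "((\<lambda>t. cos_out (a t) (b t)) has_real_derivative - sin_out (a t) (b t) * (K - a')) (at t)"
    unfolding cos_out_def sin_out_def
    by (simp add: algebra_simps)
  show "((\<lambda>t. cos_in (a t) (b t)) has_real_derivative sin_in (a t) (b t) * (K - b')) (at t)"
    using inn
    unfolding cos_in_def sin_in_def
    by (simp add: algebra_simps)
qed

text \<open>The diagonal is included because \<open>avg\<close> is nonzero there; at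
  \<open>y = \<theta> + 2 * pi\<close> the average velocity is zero and no direction
  remains.\<close>

definition wedge :: "(real \<times> real) set" where
  "wedge = {z. fst z \<le> snd z \<and> snd z < fst z + 2 * pi}"

lemma avg_cont_on: "continuous_on A (\<lambda>z. avg (fst z) (snd z))"
  using avg_cont continuous_on_subset by blast

lemma dir_cont: "continuous_on wedge (\<lambda>z. dir (fst z) (snd z))"
  unfolding dir_def by (intro continuous_on_sgn avg_cont_on) (auto simp: wedge_def avg_nonzero)

lemma \<Gamma>_compose_cont: "continuous_on A f \<Longrightarrow> continuous_on A (\<lambda>x. \<Gamma> (f x))"
  by (rule continuous_on_compose2[OF \<Gamma>_cont[of UNIV]]) auto

lemma \<rho>_compose_cont: "continuous_on A f \<Longrightarrow> continuous_on A (\<lambda>x. \<rho> (f x))"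
  by (rule continuous_on_compose2[OF \<rho>_cont[of UNIV]]) auto

lemma \<rho>'_compose_cont: "continuous_on A f \<Longrightarrow> continuous_on A (\<lambda>x. \<rho>' (f x))"
  by (rule continuous_on_compose2[OF \<rho>'_cont]) auto

lemma chord_cont: "continuous_on A (\<lambda>z. chord (fst z) (snd z))"
  unfolding chord_def by (intro continuous_intros \<Gamma>_compose_cont)

lemma angle_cont:
  "continuous_on wedge (\<lambda>z. cos_out (fst z) (snd z))" "continuous_on wedge (\<lambda>z. cos_in (fst z) (snd z))"
  "continuous_on wedge (\<lambda>z. sin_out (fst z) (snd z))" "continuous_on wedge (\<lambda>z. sin_in (fst z) (snd z))"
  unfolding cos_out_def cos_in_def sin_out_def sin_in_def
  by (intro continuous_intros dir_cont)+

text \<open>Only the diagonal is delicate. The height over the tangent line is quadratic in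
  \<open>y - \<theta>\<close>, so \<open>sin_out / chord\<close> stays bounded and
  \<open>dens\<close> is dominated by a continuous function with the factor \<open>sin_in\<close>,
  which vanishes there.\<close>

lemma dens_cont: "continuous_on wedge (\<lambda>z. dens (fst z) (snd z))"
proof -
  obtain R where R: "R > 0" "\<And>t. \<bar>\<rho> t\<bar> \<le> R"
    using periodic_bounded[OF \<rho>_cont \<rho>_periodic] by blast
  define bnd where "bnd z = \<rho> (fst z) * \<rho> (snd z) * R * sin_in (fst z) (snd z) / (norm (avg (fst z) (snd z)))\<^sup>2" for z
  have bc: "continuous_on wedge bnd" unfolding bnd_def
    by (intro continuous_intros \<rho>_compose_cont angle_cont avg_cont_on) (auto simp: wedge_def avg_nonzero)
  have le: "\<bar>dens (fst z) (snd z)\<bar> \<le> bnd z" if z: "z \<in> wedge" for z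
  proof -
    define \<theta> y where "\<theta> = fst z" "y = snd z"
    have zz: "\<theta> \<le> y" "y < \<theta> + 2 * pi" using z by (auto simp: wedge_def \<theta>_y_def)
    show ?thesis
    proof (cases "\<theta> = y")
      case True then show ?thesis by (simp add: bnd_def \<theta>_y_def[symmetric])
    next
      case False
      then have lt: "\<theta> < y" using zz by simp
      obtain \<xi> where \<xi>: "\<theta> < \<xi>" "\<xi> < y"
        "Im (cis (- \<theta>) * (\<Gamma> y - \<Gamma> \<theta>)) - Im (cis (- \<theta>) * (\<Gamma> \<theta> - \<Gamma> \<theta>)) = (y - \<theta>) * (\<rho> \<xi> * sin (\<xi> - \<theta>))"
        using MVT2[OF lt Im_chord_deriv] by blast
      have "sin (\<xi> - \<theta>) \<le> \<xi> - \<theta>" using \<xi> by (intro sin_x_le_x) auto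
      then have "\<rho> \<xi> * sin (\<xi> - \<theta>) \<le> R * (y - \<theta>)"
        using \<xi> R(2)[of \<xi>] \<rho>_pos[of \<xi>] R(1)
        by (smt (verit, best) mult_left_mono mult_right_mono)
      then have "sin_out \<theta> y * chord \<theta> y \<le> (y - \<theta>) * (R * (y - \<theta>))"
        using \<xi>(3) zz(1) lt by (simp add: sin_out_chord del: mult.commute)
      moreover have ch: "chord \<theta> y = (y - \<theta>) * norm (avg \<theta> y)"
        unfolding chord_def chord_avg norm_mult norm_of_real using lt by simp
      ultimately have "sin_out \<theta> y * norm (avg \<theta> y) \<le> R * (y - \<theta>)"
        using lt by (simp add: mult.assoc mult.left_commute)
      moreover have n: "norm (avg \<theta> y) > 0" using avg_nonzero[OF zz] by simp
      ultimately have "(sin_out \<theta> y * norm (avg \<theta> y)) * norm (avg \<theta> y) \<le> (R * (y - \<theta>)) * norm (avg \<theta> y)"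
        by (intro mult_right_mono) auto
      then have "sin_out \<theta> y / chord \<theta> y \<le> R / (norm (avg \<theta> y))\<^sup>2"
        unfolding ch using lt n by (simp add: divide_simps power2_eq_square mult_ac)
      then have "\<rho> \<theta> * \<rho> y * sin_in \<theta> y * (sin_out \<theta> y / chord \<theta> y)
          \<le> \<rho> \<theta> * \<rho> y * sin_in \<theta> y * (R / (norm (avg \<theta> y))\<^sup>2)"
        using \<rho>_pos[of \<theta>] \<rho>_pos[of y] sin_nonneg[OF zz] by (intro mult_left_mono) auto
      then have "dens \<theta> y \<le> bnd z"
        by (simp add: dens_def bnd_def \<theta>_y_def[symmetric] algebra_simps)
      then show ?thesis using dens_nonneg[OF zz] by (simp add: \<theta>_y_def)
    qed
  qed
  show ?thesis unfolding continuous_on_def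
  proof
    fix z assume z: "z \<in> wedge"
    show "((\<lambda>z. dens (fst z) (snd z)) \<longlongrightarrow> dens (fst z) (snd z)) (at z within wedge)"
    proof (cases "fst z = snd z")
      case True
      have "(bnd \<longlongrightarrow> bnd z) (at z within wedge)" using bc z by (auto simp: continuous_on_def)
      then have "(bnd \<longlongrightarrow> 0) (at z within wedge)" using True by (simp add: bnd_def)
      then have "((\<lambda>z. dens (fst z) (snd z)) \<longlongrightarrow> 0) (at z within wedge)"
        by (rule Lim_null_comparison[rotated]) (auto simp: eventually_at_filter le)
      then show ?thesis using True by simp
    next
      case False
      then have "chord (fst z) (snd z) \<noteq> 0" using z chord_pos[of "fst z" "snd z"] by (auto simp: wedge_def)
      moreover have "continuous_on wedge (\<lambda>z. (\<rho> (fst z) * sin_out (fst z) (snd z)) * (\<rho> (snd z) * sin_in (fst z) (snd z)))"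
        by (intro continuous_intros \<rho>_compose_cont angle_cont)
      ultimately show ?thesis using z chord_cont[of wedge] unfolding dens_def continuous_on_def
        by (intro tendsto_divide) auto
    qed
  qed
qed

section \<open>The twist condition\<close>

text \<open>Moving only the far endpoint forward turns the chord counterclockwise at the positive
  rate \<open>\<rho> * sin_in / chord\<close>, while the tangent at the near endpoint stays
  fixed.\<close>

lemma cos_out_strict:
  assumes "\<theta> \<le> y1" "y1 < y2" "y2 < \<theta> + 2 * pi"
  shows "cos_out \<theta> y2 < cos_out \<theta> y1"
proof (rule DERIV_neg_imp_decreasing_open[OF assms(2)])
  fix x assume x: "y1 < x" "x < y2"
  have x': "\<theta> < x" "x < \<theta> + 2 * pi" using x assms by auto
  have "((\<lambda>y. cos_out \<theta> y) has_real_derivative - sin_out \<theta> x * (\<rho> x * sin_in \<theta> x / chord \<theta> x)) (at x)"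
    using cos_deriv(1)[OF DERIV_const DERIV_ident, of \<theta> x] x' by simp
  moreover have "- sin_out \<theta> x * (\<rho> x * sin_in \<theta> x / chord \<theta> x) < 0"
    using sin_pos[OF x'] chord_pos[OF x'] \<rho>_pos[of x] by simp
  ultimately show "\<exists>l. (cos_out \<theta> has_real_derivative l) (at x) \<and> l < 0" by blast
next
  show "continuous_on {y1..y2} (cos_out \<theta>)"
    by (rule compose_cont[OF angle_cont(1)]) (use assms in \<open>auto simp: wedge_def\<close>)
qed

lemma cos_in_strict:
  assumes "\<theta>1 < \<theta>2" "\<theta>2 \<le> y" "y < \<theta>1 + 2 * pi"
  shows "cos_in \<theta>1 y < cos_in \<theta>2 y"
proof (rule DERIV_pos_imp_increasing_open[OF assms(1)])
  fix x assume x: "\<theta>1 < x" "x < \<theta>2"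
  have x': "x < y" "y < x + 2 * pi" using x assms by auto
  have "((\<lambda>\<theta>. cos_in \<theta> y) has_real_derivative sin_in x y * (\<rho> x * sin_out x y / chord x y)) (at x)"
    using cos_deriv(2)[OF DERIV_ident DERIV_const, of x y] x' by simp
  moreover have "sin_in x y * (\<rho> x * sin_out x y / chord x y) > 0"
    using sin_pos[OF x'] chord_pos[OF x'] \<rho>_pos[of x] by simp
  ultimately show "\<exists>l. ((\<lambda>\<theta>. cos_in \<theta> y) has_real_derivative l) (at x) \<and> l > 0" by blast
next
  show "continuous_on {\<theta>1..\<theta>2} (\<lambda>\<theta>. cos_in \<theta> y)"
    by (rule compose_cont[OF angle_cont(2)]) (use assms in \<open>auto simp: wedge_def\<close>)
qed

lemma cos_out_less_iff:
  assumes "\<theta> \<le> y1" "\<theta> \<le> y2" "y1 < \<theta> + 2 * pi" "y2 < \<theta> + 2 * pi"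
  shows "cos_out \<theta> y2 < cos_out \<theta> y1 \<longleftrightarrow> y1 < y2"
  using cos_out_strict[of \<theta> y1 y2] cos_out_strict[of \<theta> y2 y1] assms
  by (metis linorder_less_linear order_less_asym)

lemma cos_in_less_iff:
  assumes "\<theta>1 \<le> y" "\<theta>2 \<le> y" "y < \<theta>1 + 2 * pi" "y < \<theta>2 + 2 * pi"
  shows "cos_in \<theta>1 y < cos_in \<theta>2 y \<longleftrightarrow> \<theta>1 < \<theta>2"
  using cos_in_strict[of \<theta>1 \<theta>2 y] cos_in_strict[of \<theta>2 \<theta>1 y] assms
  by (metis linorder_less_linear order_less_asym)

lemma cos_le_1:
  assumes "\<theta> \<le> y" "y < \<theta> + 2 * pi"
  shows "\<bar>cos_out \<theta> y\<bar> \<le> 1" "\<bar>cos_in \<theta> y\<bar> \<le> 1"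
  using cos_sin_out[OF assms] cos_sin_in[OF assms]
  by (metis abs_square_le_1 le_add_same_cancel1 zero_le_power2)+

text \<open>As \<open>y\<close> increases from \<open>\<theta>\<close> to \<open>\<theta> + 2\<pi>\<close> the chord direction turns from \<open>cis \<theta>\<close> to \<open>- cis \<theta>\<close>.\<close>

lemma hit_exists:
  assumes a: "0 < \<alpha>" "\<alpha> < pi"
  obtains z where "\<theta> < z" "z < \<theta> + 2 * pi" "cos_out \<theta> z = cos \<alpha>"
proof -
  have c1: "cos \<alpha> < 1" "-1 < cos \<alpha>"
    using a cos_monotone_0_pi[of 0 \<alpha>] cos_monotone_0_pi[of \<alpha> pi] by auto
  \<comment> \<open>\<open>dir\<close> breaks down as \<open>y\<close> tends to
    \<open>\<theta> + 2 * pi\<close>. There the reversed chord, from \<open>y\<close> to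
    \<open>\<theta> + 2 * pi\<close>, supplies the direction with opposite sign and extends
    continuously, with value \<open>-1\<close> at the end.\<close>
  define f where "f y = - Re (cis (- \<theta>) * dir y (\<theta> + 2 * pi))" for y
  have eq: "f y = cos_out \<theta> y" if "\<theta> < y" "y < \<theta> + 2 * pi" for y
  proof -
    have "dir y (\<theta> + 2 * pi) = - dir \<theta> y"
      using that dir_eq[of y "\<theta> + 2 * pi"] dir_eq[of \<theta> y] \<Gamma>_periodic[of \<theta>]
      by (metis minus_diff_eq sgn_minus)
    then show ?thesis by (simp add: f_def cos_out_def)
  qed
  have fc: "continuous_on {\<theta> + pi..\<theta> + 2 * pi} f" unfolding f_def
    by (intro continuous_intros compose_cont[OF dir_cont])
      (auto simp: wedge_def intro: order_less_le_trans[of _ "\<theta> + pi"])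
  have fe: "f (\<theta> + 2 * pi) = -1" by (simp add: f_def dir_diag power2_eq_square[symmetric])
  have mid: "f (\<theta> + pi) = cos_out \<theta> (\<theta> + pi)" by (rule eq) auto
  show thesis
  proof (cases "f (\<theta> + pi) \<le> cos \<alpha>")
    case True
    have "continuous_on {\<theta>..\<theta> + pi} (cos_out \<theta>)"
      by (rule compose_cont[OF angle_cont(1)]) (auto simp: wedge_def intro: order_le_less_trans)
    then obtain z where z: "\<theta> \<le> z" "z \<le> \<theta> + pi" "cos_out \<theta> z = cos \<alpha>"
      using IVT2'[of "cos_out \<theta>" "\<theta> + pi" "cos \<alpha>" \<theta>] True mid c1 by auto
    then have "z \<noteq> \<theta>" using c1 by auto
    then show thesis using that[of z] z pi_gt_zero by linarith
  next
    case False
    then obtain z where z: "\<theta> + pi \<le> z" "z \<le> \<theta> + 2 * pi" "f z = cos \<alpha>"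
      using IVT2'[of f "\<theta> + 2 * pi" "cos \<alpha>" "\<theta> + pi"] fc fe c1 by auto
    then have "z \<noteq> \<theta> + 2 * pi" using c1 fe by auto
    then have "\<theta> < z" "z < \<theta> + 2 * pi" using z pi_gt_zero by linarith+
    then show thesis using that[of z] z(3) eq by simp
  qed
qed

lemma dir_of_cos_out:
  assumes "\<theta> < z" "z < \<theta> + 2 * pi" "cos_out \<theta> z = cos \<alpha>" "0 \<le> \<alpha>" "\<alpha> \<le> pi"
  shows "dir \<theta> z = cis \<theta> * cis \<alpha>"
proof -
  have "(sin_out \<theta> z)\<^sup>2 = (sin \<alpha>)\<^sup>2" using cos_sin_out[of \<theta> z] assms unfolding sin_squared_eq by simp
  then have "sin_out \<theta> z = sin \<alpha>"
    using sin_pos[OF assms(1,2)] sin_ge_zero[OF assms(4,5)] by (simp add: power2_eq_iff_nonneg)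
  then have "cis (- \<theta>) * dir \<theta> z = cis \<alpha>" unfolding cis_cos_out assms(3) by (simp add: complex_eq_iff)
  then have "cis \<theta> * (cis (- \<theta>) * dir \<theta> z) = cis \<theta> * cis \<alpha>" by simp
  then show ?thesis unfolding mult.assoc[symmetric] cis_mult by (simp add: cis_mult)
qed

lemma dir_of_cos_in:
  assumes "\<theta> < z" "z < \<theta> + 2 * pi" "cos_in \<theta> z = cos \<alpha>" "0 \<le> \<alpha>" "\<alpha> \<le> pi"
  shows "dir \<theta> z = cis z * cis (- \<alpha>)"
proof -
  have "(sin_in \<theta> z)\<^sup>2 = (sin \<alpha>)\<^sup>2" using cos_sin_in[of \<theta> z] assms unfolding sin_squared_eq by simp
  then have "sin_in \<theta> z = sin \<alpha>"
    using sin_pos[OF assms(1,2)] sin_ge_zero[OF assms(4,5)] by (simp add: power2_eq_iff_nonneg)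
  then have "cis (- z) * dir \<theta> z = cis (- \<alpha>)" unfolding cis_cos_in assms(3) by (simp add: complex_eq_iff)
  then have "cis z * (cis (- z) * dir \<theta> z) = cis z * cis (- \<alpha>)" by simp
  then show ?thesis unfolding mult.assoc[symmetric] cis_mult by (simp add: cis_mult)
qed

lemma \<Gamma>_representative:
  assumes "x \<in> range \<Gamma>" "x \<noteq> \<Gamma> \<theta>"
  obtains z where "\<theta> < z" "z < \<theta> + 2 * pi" "x = \<Gamma> z"
proof -
  interpret P: periodic_fun_simple \<Gamma> "2 * pi" by standard (simp add: \<Gamma>_periodic)
  obtain t where t: "x = \<Gamma> t" using assms by blast
  define k where "k = \<lfloor>(t - \<theta>) / (2 * pi)\<rfloor>"
  have "of_int k \<le> (t - \<theta>) / (2 * pi)" "(t - \<theta>) / (2 * pi) < of_int k + 1" unfolding k_def by linarith+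
  then have "\<theta> \<le> t - of_int k * (2 * pi)" "t - of_int k * (2 * pi) < \<theta> + 2 * pi" by (simp_all add: field_simps)
  moreover have "x = \<Gamma> (t - of_int k * (2 * pi))" unfolding t P.minus_of_int ..
  moreover from this have "t - of_int k * (2 * pi) \<noteq> \<theta>" using assms(2) by metis
  ultimately show thesis using that[of "t - of_int k * (2 * pi)"] by force
qed

subsection \<open>Areas of segments\<close>

definition vel :: "real \<Rightarrow> complex" where "vel t = of_real (\<rho> t) * cis t"
definition acc :: "real \<Rightarrow> complex" where "acc t = (of_real (\<rho>' t) + \<i> * of_real (\<rho> t)) * cis t"

lemma vel_deriv: "(vel has_vector_derivative acc t) (at t)"
proof -
  have "((\<lambda>t. complex_of_real (\<rho> t)) has_vector_derivative of_real (\<rho>' t)) (at t)"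
    by (rule has_vector_derivative_of_real[OF \<rho>_deriv])
  from has_vector_derivative_mult[OF this has_vector_derivative_cis[OF DERIV_ident]]
  show ?thesis unfolding vel_def[abs_def] acc_def by (simp add: algebra_simps)
qed

lemma \<Gamma>_vel: "(\<Gamma> has_vector_derivative vel t) (at t)"
  using \<Gamma>_deriv by (simp add: vel_def)

lemma vel_periodic: "vel (t + 2 * pi) = vel t"
  by (simp add: vel_def \<rho>_periodic)

lemma vel_cont: "continuous_on A f \<Longrightarrow> continuous_on A (\<lambda>x. vel (f x))"
  unfolding vel_def by (intro continuous_intros \<rho>_compose_cont)

lemma acc_cont: "continuous_on A f \<Longrightarrow> continuous_on A (\<lambda>x. acc (f x))"
  unfolding acc_def by (intro continuous_intros \<rho>_compose_cont \<rho>'_compose_cont)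

text \<open>Twice the enclosed area, by Green's theorem for a counterclockwise curve.\<close>

definition area2 :: real where
  "area2 = integral {0..2*pi} (\<lambda>t. Im (cnj (\<Gamma> t) * vel t))"

text \<open>\<open>seg\<close> is the area between the chord and the arc from \<open>s - v\<close> to \<open>s + v\<close>; \<open>rot_s\<close> and \<open>rot_v\<close> are the
  partial derivatives of the chord's direction angle.\<close>

definition seg_prim :: "real \<Rightarrow> real" where
  "seg_prim = (SOME a. \<forall>t. (a has_real_derivative Im (cnj (\<Gamma> t) * vel t) / 2) (at t))"

definition seg :: "real \<Rightarrow> real \<Rightarrow> real" where
  "seg v s = seg_prim (s + v) - seg_prim (s - v) - Im (cnj (\<Gamma> (s - v)) * \<Gamma> (s + v)) / 2"

definition ch :: "real \<Rightarrow> real \<Rightarrow> complex" where "ch v s = \<Gamma> (s + v) - \<Gamma> (s - v)"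
definition ch_s :: "real \<Rightarrow> real \<Rightarrow> complex" where "ch_s v s = vel (s + v) - vel (s - v)"
definition ch_v :: "real \<Rightarrow> real \<Rightarrow> complex" where "ch_v v s = vel (s + v) + vel (s - v)"
definition ch_sv :: "real \<Rightarrow> real \<Rightarrow> complex" where "ch_sv v s = acc (s + v) + acc (s - v)"

definition rot_s :: "real \<Rightarrow> real \<Rightarrow> real" where "rot_s v s = Im (ch_s v s / ch v s)"
definition rot_v :: "real \<Rightarrow> real \<Rightarrow> real" where "rot_v v s = Im (ch_v v s / ch v s)"
definition rot_sv :: "real \<Rightarrow> real \<Rightarrow> real" where
  "rot_sv v s = Im (ch_sv v s / ch v s - ch_s v s * ch_v v s / (ch v s)\<^sup>2)"

lemma seg_prim_deriv: "(seg_prim has_real_derivative Im (cnj (\<Gamma> t) * vel t) / 2) (at t)"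
proof -
  have "continuous_on UNIV (\<lambda>t. Im (cnj (\<Gamma> t) * vel t) / 2)"
    by (intro continuous_intros \<Gamma>_cont vel_cont) auto
  then obtain a where "\<forall>t. (a has_real_derivative Im (cnj (\<Gamma> t) * vel t) / 2) (at t)"
    by (rule continuous_has_antiderivative) auto
  from someI[of "\<lambda>a. \<forall>t. (a has_real_derivative Im (cnj (\<Gamma> t) * vel t) / 2) (at t)", OF this]
  show ?thesis unfolding seg_prim_def by blast
qed

lemma seg_prim_periodic: "seg_prim (t + 2 * pi) = seg_prim t + area2 / 2"
proof -
  have "((\<lambda>t. seg_prim (t + 2 * pi) - seg_prim t) has_real_derivative 0) (at t)" for t
  proof -
    have "((\<lambda>t. seg_prim (t + 2 * pi)) has_real_derivative Im (cnj (\<Gamma> (t + 2 * pi)) * vel (t + 2 * pi)) / 2) (at t)"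
      using shift_deriv(1)[OF seg_prim_deriv[unfolded has_real_derivative_iff_has_vector_derivative]]
      unfolding has_real_derivative_iff_has_vector_derivative .
    from DERIV_diff[OF this seg_prim_deriv] show ?thesis unfolding vel_periodic \<Gamma>_periodic by simp
  qed
  then have "seg_prim (t + 2 * pi) - seg_prim t = seg_prim (0 + 2 * pi) - seg_prim 0"
    using DERIV_isconst_all by blast
  moreover have "((\<lambda>t. Im (cnj (\<Gamma> t) * vel t) / 2) has_integral seg_prim (2 * pi) - seg_prim 0) {0..2*pi}"
    by (rule real_derivative_has_integral[OF _ seg_prim_deriv]) simp
  from integral_unique[OF this] have "area2 / 2 = seg_prim (2 * pi) - seg_prim 0"
    unfolding area2_def integral_divide .
  ultimately show ?thesis by (simp add: field_simps)
qed

lemma ch_deriv: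
  "((\<lambda>s. ch v s) has_vector_derivative ch_s v s) (at s)" "((\<lambda>v. ch v s) has_vector_derivative ch_v v s) (at v)"
  "((\<lambda>v. ch_s v s) has_vector_derivative ch_sv v s) (at v)" "((\<lambda>s. ch_v v s) has_vector_derivative ch_sv v s) (at s)"
  unfolding ch_def ch_s_def ch_v_def ch_sv_def
  using has_vector_derivative_diff[OF shift_deriv(1,2)[OF \<Gamma>_vel]]
    has_vector_derivative_diff[OF shift_deriv(3,4)[OF \<Gamma>_vel]]
    has_vector_derivative_diff[OF shift_deriv(3,4)[OF vel_deriv]]
    has_vector_derivative_add[OF shift_deriv(1,2)[OF vel_deriv]]
  by auto

text \<open>A moving chord sweeps area at the rate of the cross product of the chord with the
  velocity of its midpoint. That velocity is \<open>ch_v / 2\<close> when \<open>s\<close> moves and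
  \<open>ch_s / 2\<close> when \<open>v\<close> moves, whence the exchanged subscripts.\<close>

lemma seg_deriv:
  "((\<lambda>s. seg v s) has_real_derivative Im (cnj (ch v s) * ch_v v s) / 2) (at s)"
  "((\<lambda>v. seg v s) has_real_derivative Im (cnj (ch v s) * ch_s v s) / 2) (at v)"
proof -
  have cn: "((\<lambda>x. cnj (f x)) has_vector_derivative cnj f') F" if "(f has_vector_derivative f') F" for f f' F
    using bounded_linear.has_vector_derivative[OF bounded_linear_cnj that] .
  have d: "((\<lambda>x. seg_prim (f x) - seg_prim (g x) - Im (cnj (\<Gamma> (g x)) * \<Gamma> (f x)) / 2) has_real_derivative
      f' * Im (cnj (\<Gamma> (f x)) * vel (f x)) / 2 - g' * Im (cnj (\<Gamma> (g x)) * vel (g x)) / 2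
       - Im (cnj (\<Gamma> (g x)) * (f' *\<^sub>R vel (f x)) + cnj (g' *\<^sub>R vel (g x)) * \<Gamma> (f x)) / 2) (at x)"
    if f: "(f has_real_derivative f') (at x)" and g: "(g has_real_derivative g') (at x)" for f g f' g' x
  proof -
    have G: "((\<lambda>x. \<Gamma> (h x)) has_vector_derivative h' *\<^sub>R vel (h x)) (at x)"
      if "(h has_real_derivative h') (at x)" for h h'
      using vector_diff_chain_at[OF that[unfolded has_real_derivative_iff_has_vector_derivative] \<Gamma>_vel]
      by (simp add: o_def)
    have S: "((\<lambda>x. seg_prim (h x)) has_real_derivative h' * Im (cnj (\<Gamma> (h x)) * vel (h x)) / 2) (at x)"
      if "(h has_real_derivative h') (at x)" for h h'
      using DERIV_chain2[OF seg_prim_deriv that] by (simp add: mult.commute)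
    show ?thesis
      by (rule DERIV_diff[OF DERIV_diff[OF S[OF f] S[OF g]]
          DERIV_cdivide[OF has_real_derivative_Re_Im(2)[OF has_vector_derivative_mult[OF cn[OF G[OF g]] G[OF f]]]]])
  qed
  show "((\<lambda>s. seg v s) has_real_derivative Im (cnj (ch v s) * ch_v v s) / 2) (at s)"
    unfolding seg_def
    by (rule DERIV_cong, rule d[of "\<lambda>s. s + v" 1 _ "\<lambda>s. s - v" 1])
      (auto intro!: derivative_eq_intros simp: ch_def ch_v_def field_simps)
  show "((\<lambda>v. seg v s) has_real_derivative Im (cnj (ch v s) * ch_s v s) / 2) (at v)"
    unfolding seg_def
    by (rule DERIV_cong, rule d[of "\<lambda>v. s + v" 1 _ "\<lambda>v. s - v" "- 1"])
      (auto intro!: derivative_eq_intros simp: ch_def ch_s_def field_simps)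
qed

lemma ch_nonzero:
  assumes "0 < v" "v < pi"
  shows "ch v s \<noteq> 0"
  unfolding ch_def by (rule \<Gamma>_neq) (use assms in auto)

text \<open>Both functions are imaginary parts of logarithmic derivatives of \<open>ch\<close>, so
  no branch of the direction angle has to be chosen. Equality of the cross derivatives expresses
  that the differential of that angle is closed.\<close>

lemma rot_deriv:
  assumes "0 < v" "v < pi"
  shows "((\<lambda>v. rot_s v s) has_real_derivative rot_sv v s) (at v)"
    "((\<lambda>s. rot_v v s) has_real_derivative rot_sv v s) (at s)"
proof -
  have q: "((\<lambda>x. f x / g x) has_vector_derivative (f' / g x - f x * g' / (g x)\<^sup>2)) (at x)"
    if f: "(f has_vector_derivative f') (at x)" and g: "(g has_vector_derivative g') (at x)" and nz: "g x \<noteq> 0"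
    for f g :: "real \<Rightarrow> complex" and f' g' x
  proof -
    have "((\<lambda>z. inverse z) has_field_derivative - (inverse (g x))\<^sup>2) (at (g x))"
      using DERIV_inverse[OF nz] by (simp add: numeral_2_eq_2)
    from field_vector_diff_chain_at[OF g this]
    have "((\<lambda>x. inverse (g x)) has_vector_derivative g' * - (inverse (g x))\<^sup>2) (at x)" by (simp add: o_def)
    from has_vector_derivative_mult[OF f this] show ?thesis
      by (simp add: divide_inverse power_inverse algebra_simps)
  qed
  show "((\<lambda>v. rot_s v s) has_real_derivative rot_sv v s) (at v)"
    unfolding rot_s_def rot_sv_def
    by (rule has_real_derivative_Re_Im(2), rule q[OF ch_deriv(3,2) ch_nonzero[OF assms]])
  show "((\<lambda>s. rot_v v s) has_real_derivative rot_sv v s) (at s)"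
    unfolding rot_v_def rot_sv_def
    using has_real_derivative_Re_Im(2)[OF q[OF ch_deriv(4,1) ch_nonzero[OF assms]]] by (simp add: mult.commute)
qed

lemma ch_cont:
  assumes "continuous_on A f" "continuous_on A g"
  shows "continuous_on A (\<lambda>x. ch (f x) (g x))" "continuous_on A (\<lambda>x. ch_s (f x) (g x))"
    "continuous_on A (\<lambda>x. ch_v (f x) (g x))" "continuous_on A (\<lambda>x. ch_sv (f x) (g x))"
    "continuous_on A (\<lambda>x. seg (f x) (g x))"
proof -
  have "continuous_on UNIV seg_prim"
    using seg_prim_deriv DERIV_isCont continuous_at_imp_continuous_on by blast
  then have sp: "continuous_on A (\<lambda>x. seg_prim (h x))" if "continuous_on A h" for h
    by (rule continuous_on_compose2[OF _ that]) auto
  show "continuous_on A (\<lambda>x. ch (f x) (g x))" unfolding ch_def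
    by (intro continuous_intros \<Gamma>_compose_cont assms)
  show "continuous_on A (\<lambda>x. ch_s (f x) (g x))" "continuous_on A (\<lambda>x. ch_v (f x) (g x))"
    unfolding ch_s_def ch_v_def by (intro continuous_intros vel_cont assms)+
  show "continuous_on A (\<lambda>x. ch_sv (f x) (g x))" unfolding ch_sv_def
    by (intro continuous_intros acc_cont assms)
  show "continuous_on A (\<lambda>x. seg (f x) (g x))" unfolding seg_def divide_inverse
    by (intro continuous_intros \<Gamma>_compose_cont sp assms)
qed

lemma rot_cont:
  assumes "continuous_on A f" "continuous_on A g" "\<And>x. x \<in> A \<Longrightarrow> 0 < f x \<and> f x < pi"
  shows "continuous_on A (\<lambda>x. rot_s (f x) (g x))" "continuous_on A (\<lambda>x. rot_v (f x) (g x))"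
    "continuous_on A (\<lambda>x. rot_sv (f x) (g x))"
  unfolding rot_s_def rot_v_def rot_sv_def
  by (intro continuous_intros ch_cont assms; use assms ch_nonzero in auto)+

lemma ch_periodic:
  "ch v (s + 2 * pi) = ch v s" "ch_s v (s + 2 * pi) = ch_s v s" "ch_v v (s + 2 * pi) = ch_v v s"
  "seg v (s + 2 * pi) = seg v s"
proof -
  have e: "s + 2 * pi + v = (s + v) + 2 * pi" "s + 2 * pi - v = (s - v) + 2 * pi" by auto
  show "ch v (s + 2 * pi) = ch v s" "ch_s v (s + 2 * pi) = ch_s v s" "ch_v v (s + 2 * pi) = ch_v v s"
    "seg v (s + 2 * pi) = seg v s"
    unfolding ch_def ch_s_def ch_v_def seg_def e by (simp_all only: \<Gamma>_periodic vel_periodic seg_prim_periodic)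
qed

text \<open>Chord length times the invariant measure is the exterior product of the differentials of
  the segment area and the direction angle. With normal endpoint velocities \<open>u\<close> and
  \<open>u1\<close>, their partial derivatives are multiples of \<open>u1 + u\<close> and
  \<open>u1 - u\<close>, and the difference of the squares is \<open>4 * u * u1\<close>.\<close>

lemma chord_dens_rot:
  assumes "0 < v" "v < pi"
  shows "2 * chord (s - v) (s + v) * dens (s - v) (s + v)
     = Im (cnj (ch v s) * ch_s v s) / 2 * rot_s v s - Im (cnj (ch v s) * ch_v v s) / 2 * rot_v v s"
proof -
  have lt: "s - v < s + v" "s + v < s - v + 2 * pi" using assms by auto
  define H where "H = chord (s - v) (s + v)"
  have H: "H > 0" unfolding H_def by (rule chord_pos[OF lt])
  define u u1 where "u = \<rho> (s - v) * sin_out (s - v) (s + v)" and "u1 = \<rho> (s + v) * sin_in (s - v) (s + v)"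
  have nH: "norm (ch v s) = H" by (simp add: ch_def H_def chord_def)
  have so: "sin_out (s - v) (s + v) * H = Im (cis (- (s - v)) * ch v s)"
    and si: "sin_in (s - v) (s + v) * H = - Im (cis (- (s + v)) * ch v s)"
    unfolding H_def ch_def using sin_out_chord[of "s - v" "s + v"] sin_in_chord[of "s - v" "s + v"] lt
    by (simp_all only: less_imp_le)
  have uH: "u * H = \<rho> (s - v) * Im (cis (- (s - v)) * ch v s)"
    unfolding u_def so[symmetric] by simp
  have u1H: "u1 * H = - \<rho> (s + v) * Im (cis (- (s + v)) * ch v s)"
    using si unfolding u1_def by (metis mult.assoc mult_minus_left mult_minus_right)
  have i1: "Im (cnj w * (of_real r * cis t)) = - r * Im (cis (- t) * w)" for w r t
    by (simp add: algebra_simps)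
  have a: "Im (cnj (ch v s) * vel (s + v)) = u1 * H" "Im (cnj (ch v s) * vel (s - v)) = - (u * H)"
    unfolding vel_def i1 uH u1H by simp_all
  have s: "Im (cnj (ch v s) * ch_s v s) = (u1 + u) * H" "Im (cnj (ch v s) * ch_v v s) = (u1 - u) * H"
    unfolding ch_s_def ch_v_def ring_distribs minus_complex.sel plus_complex.sel a by (simp_all add: algebra_simps)
  have "2 * H * dens (s - v) (s + v) = 2 * u * u1"
    using H by (simp add: dens_def H_def[symmetric] u_def u1_def)
  also have "\<dots> = (u1 + u) * H / 2 * ((u1 + u) * H / H\<^sup>2) - (u1 - u) * H / 2 * ((u1 - u) * H / H\<^sup>2)"
    using H by (simp add: field_simps power2_eq_square)
  finally show ?thesis unfolding rot_s_def rot_v_def Im_divide_eq s nH H_def .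
qed

text \<open>This serves the edge \<open>\<delta>1 = 0\<close>. The area \<open>seg\<close> is
  quadratic in \<open>v\<close> by the mean value theorem, while \<open>rot_s\<close> is at most of
  order \<open>1 / v\<close> because the chord is at least \<open>2 * c * v\<close> long; the
  boundary term therefore tends to zero with \<open>v\<close>.\<close>

lemma seg_bound:
  obtains C where "\<And>v s. 0 < v \<Longrightarrow> v \<le> pi / 2 \<Longrightarrow> s \<in> {0..2*pi} \<Longrightarrow> \<bar>seg v s * rot_s v s\<bar> \<le> C * v"
proof -
  obtain R where R: "R > 0" "\<And>t. \<bar>\<rho> t\<bar> \<le> R"
    using periodic_bounded[OF \<rho>_cont \<rho>_periodic] by blast
  define D where "D = (\<lambda>(v, s). (s - v, s + v)) ` ({0..pi/2} \<times> {0..2 * pi})"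
  have "compact D" unfolding D_def split_beta
    by (intro compact_continuous_image continuous_intros compact_Times compact_Icc)
  have Dw: "D \<subseteq> wedge" unfolding D_def wedge_def using pi_gt_zero by (auto simp del: pi_gt_zero)
  have "compact ((\<lambda>z. norm (avg (fst z) (snd z))) ` D)"
    by (intro compact_continuous_image continuous_intros avg_cont_on \<open>compact D\<close>)
  moreover have "D \<noteq> {}" unfolding D_def by auto
  ultimately obtain z0 where z0: "z0 \<in> D" "\<And>z. z \<in> D \<Longrightarrow> norm (avg (fst z0) (snd z0)) \<le> norm (avg (fst z) (snd z))"
    using compact_attains_inf[of "(\<lambda>z. norm (avg (fst z) (snd z))) ` D"] by auto
  define c where "c = norm (avg (fst z0) (snd z0))"
  have c: "c > 0" unfolding c_def using avg_nonzero z0(1) Dw by (auto simp: wedge_def)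
  have nch: "norm (ch v s) \<le> R * (2 * v)" if "0 < v" for v s
  proof -
    have "norm (\<Gamma> (s + v) - \<Gamma> (s - v)) \<le> R * norm ((s + v) - (s - v))"
    proof (rule differentiable_bound[OF convex_UNIV])
      fix x show "(\<Gamma> has_derivative (\<lambda>h. h *\<^sub>R vel x)) (at x within UNIV)"
        using \<Gamma>_vel by (simp add: has_vector_derivative_def)
      have "norm (vel x) \<le> R" using R(2)[of x] by (simp add: vel_def norm_mult)
      then show "onorm (\<lambda>h. h *\<^sub>R vel x) \<le> R" by (simp add: onorm_scaleR_left_lemma onorm_scaleR_left bounded_linear_ident onorm_id)
    qed auto
    then show ?thesis using that by (simp add: ch_def)
  qed
  have nchs: "norm (ch_s v s) \<le> 2 * R" for v s
    unfolding ch_s_def using norm_triangle_ineq4[of "vel (s + v)" "vel (s - v)"] R(2)[of "s + v"] R(2)[of "s - v"]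
    by (simp add: vel_def norm_mult)
  have sg: "\<bar>seg v s\<bar> \<le> v * (2 * R\<^sup>2 * v)" if v: "0 < v" for v s
  proof -
    obtain x where x: "0 < x" "x < v" "seg v s - seg 0 s = (v - 0) * (Im (cnj (ch x s) * ch_s x s) / 2)"
      using MVT2[OF v seg_deriv(2)] by blast
    have "\<bar>Im (cnj (ch x s) * ch_s x s)\<bar> \<le> norm (ch x s) * norm (ch_s x s)"
      by (metis abs_Im_le_cmod complex_mod_cnj norm_mult)
    also have "\<dots> \<le> (R * (2 * x)) * (2 * R)" using nch[OF x(1)] nchs R x by (intro mult_mono) auto
    also have "\<dots> \<le> (R * (2 * v)) * (2 * R)" using x R by (intro mult_mono) auto
    finally have "\<bar>Im (cnj (ch x s) * ch_s x s) / 2\<bar> \<le> 2 * R\<^sup>2 * v"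
      by (simp add: power2_eq_square mult_ac)
    moreover have "seg 0 s = 0" by (simp add: seg_def)
    ultimately show ?thesis using x(3) v by (simp add: abs_mult del: times_divide_eq_right)
  qed
  have "\<bar>seg v s * rot_s v s\<bar> \<le> (2 * R\<^sup>2 * R / c) * v" if v: "0 < v" "v \<le> pi / 2" and s: "s \<in> {0..2*pi}" for v s
  proof -
    have "(s - v, s + v) \<in> D" unfolding D_def using v s by (auto intro!: image_eqI[of _ _ "(v, s)"])
    then have "c \<le> norm (avg (s - v) (s + v))" using z0(2) unfolding c_def by force
    moreover have "norm (ch v s) = 2 * v * norm (avg (s - v) (s + v))"
      unfolding ch_def chord_avg norm_mult norm_of_real using v by simp
    ultimately have lo: "norm (ch v s) \<ge> 2 * v * c" using v by simp
    have "\<bar>rot_s v s\<bar> \<le> norm (ch_s v s / ch v s)" unfolding rot_s_def by (rule abs_Im_le_cmod)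
    also have "\<dots> = norm (ch_s v s) / norm (ch v s)" by (simp add: norm_divide)
    also have "\<dots> \<le> (2 * R) / (2 * v * c)" using nchs lo v c R by (intro frac_le) auto
    finally have "\<bar>rot_s v s\<bar> \<le> (2 * R) / (2 * v * c)" .
    then have "\<bar>seg v s\<bar> * \<bar>rot_s v s\<bar> \<le> (v * (2 * R\<^sup>2 * v)) * ((2 * R) / (2 * v * c))"
      using sg[OF v(1)] v by (intro mult_mono) auto
    also have "\<dots> = (2 * R\<^sup>2 * R / c) * v" using v c by (simp add: field_simps)
    finally show ?thesis by (simp add: abs_mult)
  qed
  then show thesis by (rule that)
qed

text \<open>Green's theorem on the cylinder for the form \<open>seg \<cdot> d\<psi>\<close>, where \<open>\<psi>\<close> is the chord's direction angle.\<close>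

lemma green_rect:
  assumes "0 < a" "a \<le> b" "b < pi"
  shows "integral {a..b} (\<lambda>v. integral {0..2*pi} (\<lambda>s. 2 * chord (s - v) (s + v) * dens (s - v) (s + v)))
     = integral {0..2*pi} (\<lambda>s. seg b s * rot_s b s) - integral {0..2*pi} (\<lambda>s. seg a s * rot_s a s)"
proof -
  \<comment> \<open>\<open>A\<close> is the \<open>v\<close>-derivative of
    \<open>seg * rot_s\<close> and \<open>B\<close> the \<open>s\<close>-derivative of
    \<open>seg * rot_v\<close>. The terms with \<open>rot_sv\<close> cancel in \<open>A - B\<close>,
    and \<open>B\<close> integrates to zero over a period.\<close>
  define A where "A v s = Im (cnj (ch v s) * ch_s v s) / 2 * rot_s v s + seg v s * rot_sv v s" for v s
  define B where "B v s = Im (cnj (ch v s) * ch_v v s) / 2 * rot_v v s + seg v s * rot_sv v s" for v s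
  have v: "0 < v \<and> v < pi" if "v \<in> {a..b}" for v using that assms by auto
  have cA: "continuous_on X (\<lambda>x. A (f x) (g x))" and cB: "continuous_on X (\<lambda>x. B (f x) (g x))"
    and cS: "continuous_on X (\<lambda>x. seg (f x) (g x) * rot_s (f x) (g x))"
    if "continuous_on X f" "continuous_on X g" "\<And>x. x \<in> X \<Longrightarrow> f x \<in> {a..b}" for f g and X :: "'x::topological_space set"
    unfolding A_def B_def using v that by (auto intro!: continuous_intros ch_cont rot_cont)
  have AB: "2 * chord (s - v) (s + v) * dens (s - v) (s + v) = A v s - B v s" if "v \<in> {a..b}" for v s
    using chord_dens_rot[of v s] v[OF that] by (simp add: A_def B_def)
  have dA: "((\<lambda>v. seg v s * rot_s v s) has_real_derivative A v s) (at v)" if "v \<in> {a..b}" for v s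
    using DERIV_mult[OF seg_deriv(2) rot_deriv(1)] v[OF that] by (simp add: A_def mult.commute)
  have dB: "((\<lambda>s. seg v s * rot_v v s) has_real_derivative B v s) (at s)" if "v \<in> {a..b}" for v s
    using DERIV_mult[OF seg_deriv(1) rot_deriv(2)] v[OF that] by (simp add: B_def mult.commute)
  have B0: "integral {0..2*pi} (B v) = 0" if "v \<in> {a..b}" for v
    by (rule integral_periodic_deriv[OF dB[OF that]])
      (use ch_periodic[of v 0] in \<open>auto simp: rot_v_def\<close>)
  have "integral {a..b} (\<lambda>v. integral {0..2*pi} (\<lambda>s. 2 * chord (s - v) (s + v) * dens (s - v) (s + v)))
     = integral {a..b} (\<lambda>v. integral {0..2*pi} (A v))"
  proof (rule integral_cong)
    fix v assume v: "v \<in> {a..b}"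
    have "integral {0..2*pi} (\<lambda>s. A v s - B v s) = integral {0..2*pi} (A v) - integral {0..2*pi} (B v)"
      by (intro integral_diff integrable_continuous_real cA cB) (use v in auto)
    then show "integral {0..2*pi} (\<lambda>s. 2 * chord (s - v) (s + v) * dens (s - v) (s + v)) = integral {0..2*pi} (A v)"
      using AB[OF v] B0[OF v] by simp
  qed
  also have "\<dots> = integral {0..2*pi} (\<lambda>s. integral {a..b} (\<lambda>v. A v s))"
    using integral_swap_continuous[of a 0 b "2*pi" A] cA[of "cbox (a, 0) (b, 2*pi)" fst snd]
    by (auto simp: split_beta cbox_Pair_eq continuous_intros)
  also have "\<dots> = integral {0..2*pi} (\<lambda>s. seg b s * rot_s b s - seg a s * rot_s a s)"
  proof (rule integral_cong)
    fix s
    have "((\<lambda>v. A v s) has_integral (seg b s * rot_s b s - seg a s * rot_s a s)) {a..b}"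
      by (rule real_derivative_has_integral[OF assms(2) dA])
    then show "integral {a..b} (\<lambda>v. A v s) = seg b s * rot_s b s - seg a s * rot_s a s" by (rule integral_unique)
  qed
  also have "\<dots> = integral {0..2*pi} (\<lambda>s. seg b s * rot_s b s) - integral {0..2*pi} (\<lambda>s. seg a s * rot_s a s)"
    by (intro integral_diff integrable_continuous_real cS) (use assms in auto)
  finally show ?thesis .
qed

section \<open>Support function and isoperimetric inequality\<close>

text \<open>The support function for the outward normal \<open>- \<i> * cis t\<close>. Its
  derivative \<open>supp'\<close> is the tangential coordinate, and a second differentiation gives
  \<open>supp + supp'' = \<rho>\<close>.\<close>

definition supp :: "real \<Rightarrow> real" where "supp t = - Im (cis (- t) * \<Gamma> t)"
definition supp' :: "real \<Rightarrow> real" where "supp' t = Re (cis (- t) * \<Gamma> t)"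

lemma \<Gamma>_supp: "\<Gamma> t = cis t * Complex (supp' t) (- supp t)"
proof -
  have "Complex (supp' t) (- supp t) = cis (- t) * \<Gamma> t"
    by (simp add: supp_def supp'_def complex_eq_iff)
  then show ?thesis by (simp add: mult.assoc[symmetric] cis_mult)
qed

lemma supp_deriv:
  "(supp has_real_derivative supp' t) (at t)" "(supp' has_real_derivative \<rho> t - supp t) (at t)"
proof -
  have "((\<lambda>t. cis (- t) * \<Gamma> t) has_vector_derivative
      cis (- t) * (of_real (\<rho> t) * cis t) + \<i> * of_real (- 1) * cis (- t) * \<Gamma> t) (at t)"
    by (rule has_vector_derivative_mult[OF has_vector_derivative_cis \<Gamma>_deriv]) (auto intro!: derivative_eq_intros)
  moreover have "cis (- t) * (of_real (\<rho> t) * cis t) = of_real (\<rho> t)"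
    using cis_mult[of "- t" t] by (simp add: mult.left_commute)
  ultimately have d: "((\<lambda>t. cis (- t) * \<Gamma> t) has_vector_derivative
      of_real (\<rho> t) - \<i> * (cis (- t) * \<Gamma> t)) (at t)" by (simp add: mult.assoc)
  show "(supp has_real_derivative supp' t) (at t)"
    using DERIV_minus[OF has_real_derivative_Re_Im(2)[OF d]] by (simp add: supp_def[abs_def] supp'_def add.commute)
  show "(supp' has_real_derivative \<rho> t - supp t) (at t)"
    using has_real_derivative_Re_Im(1)[OF d] by (simp add: supp_def supp'_def[abs_def])
qed

lemma supp_periodic: "supp (t + 2 * pi) = supp t" "supp' (t + 2 * pi) = supp' t"
  by (simp_all add: supp_def supp'_def \<Gamma>_periodic)

lemma supp_cont:
  assumes "continuous_on A f"
  shows "continuous_on A (\<lambda>x. supp (f x))" "continuous_on A (\<lambda>x. supp' (f x))"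
  unfolding supp_def supp'_def by (intro continuous_intros \<Gamma>_compose_cont assms)+

lemma supp_orthogonal: "integral {0..2*pi} (\<lambda>t. supp t * supp' t) = 0"
proof -
  have "((\<lambda>t. (supp t)\<^sup>2 / 2) has_real_derivative supp t * supp' t) (at t)" for t
    by (auto intro!: derivative_eq_intros supp_deriv)
  then show ?thesis by (rule integral_periodic_deriv) (use supp_periodic[of 0] in auto)
qed

text \<open>The area form is \<open>supp * \<rho>\<close>; substitute
  \<open>\<rho> = supp + supp''\<close> and integrate by parts.\<close>

lemma area2_supp:
  "area2 = integral {0..2*pi} (\<lambda>t. (supp t)\<^sup>2) - integral {0..2*pi} (\<lambda>t. (supp' t)\<^sup>2)"
proof -
  have "Im (cnj (\<Gamma> t) * vel t) = supp t * \<rho> t" for t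
  proof -
    have "cnj (\<Gamma> t) * vel t = (cnj (cis t) * cis t) * (cnj (Complex (supp' t) (- supp t)) * of_real (\<rho> t))"
      unfolding \<Gamma>_supp[of t] vel_def by (simp add: mult_ac)
    also have "cnj (cis t) * cis t = 1" by (simp add: cis_cnj cis_mult)
    finally show ?thesis by simp
  qed
  moreover have "((\<lambda>t. supp t * supp' t) has_real_derivative (supp' t)\<^sup>2 + supp t * (\<rho> t - supp t)) (at t)" for t
    using DERIV_mult[OF supp_deriv] by (simp add: power2_eq_square algebra_simps)
  from integral_periodic_deriv[OF this] have "integral {0..2*pi} (\<lambda>t. (supp' t)\<^sup>2 + supp t * (\<rho> t - supp t)) = 0"
    using supp_periodic[of 0] by simp
  then have "integral {0..2*pi} (\<lambda>t. (supp' t)\<^sup>2 + (supp t * \<rho> t - (supp t)\<^sup>2)) = 0"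
    by (simp add: power2_eq_square algebra_simps)
  moreover have "integral {0..2*pi} (\<lambda>t. (supp' t)\<^sup>2 + (supp t * \<rho> t - (supp t)\<^sup>2))
     = integral {0..2*pi} (\<lambda>t. (supp' t)\<^sup>2) + (integral {0..2*pi} (\<lambda>t. supp t * \<rho> t) - integral {0..2*pi} (\<lambda>t. (supp t)\<^sup>2))"
    by (subst integral_add integral_diff; (intro integrable_continuous_real continuous_intros supp_cont \<rho>_cont)?)+ simp
  ultimately show ?thesis unfolding area2_def by simp
qed

text \<open>The isoperimetric inequality, the integral of \<open>\<rho>\<close> being the perimeter.
  As \<open>\<rho> - supp\<close> is a derivative, \<open>supp\<close> has the same mean
  \<open>r\<close> as \<open>\<rho>\<close>, and Wirtinger's inequality applies to
  \<open>supp - r\<close>.\<close>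

lemma area2_le: "area2 \<le> (integral {0..2*pi} \<rho>)\<^sup>2 / (2 * pi)"
proof -
  define r where "r = integral {0..2*pi} \<rho> / (2 * pi)"
  have "integral {0..2*pi} (\<lambda>t. \<rho> t - supp t) = 0"
    by (rule integral_periodic_deriv[OF supp_deriv(2)]) (use supp_periodic[of 0] in auto)
  moreover have "integral {0..2*pi} (\<lambda>t. \<rho> t - supp t) = integral {0..2*pi} \<rho> - integral {0..2*pi} supp"
    by (intro integral_diff integrable_continuous_real \<rho>_cont supp_cont continuous_intros)
  ultimately have m: "integral {0..2*pi} supp = 2 * pi * r" by (simp add: r_def)
  have c: "supp integrable_on {0..2*pi}" "(\<lambda>t. (supp t)\<^sup>2) integrable_on {0..2*pi}"
    by (intro integrable_continuous_real continuous_intros supp_cont)+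
  have "integral {0..2*pi} (\<lambda>t. (supp t - r)\<^sup>2) \<le> integral {0..2*pi} (\<lambda>t. (supp' t)\<^sup>2)"
  proof (rule wirtinger_periodic)
    show "((\<lambda>t. supp t - r) has_real_derivative supp' t) (at t)" for t
      by (auto intro!: derivative_eq_intros supp_deriv)
    show "integral {0..2*pi} (\<lambda>t. supp t - r) = 0"
      using m by (subst integral_diff[OF c(1)]) auto
  qed (auto simp: supp_periodic intro!: supp_cont continuous_intros)
  moreover have "integral {0..2*pi} (\<lambda>t. (supp t - r)\<^sup>2) = integral {0..2*pi} (\<lambda>t. (supp t)\<^sup>2 - (2 * r) * supp t + r\<^sup>2)"
    by (simp add: power2_diff algebra_simps)
  moreover have "\<dots> = integral {0..2*pi} (\<lambda>t. (supp t)\<^sup>2) - (2 * r) * integral {0..2*pi} supp + 2 * pi * r\<^sup>2"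
    by (subst integral_add integral_diff integral_mult_right;
        (intro integrable_continuous_real continuous_intros supp_cont)?)+ auto
  ultimately have "area2 \<le> 2 * pi * r\<^sup>2" unfolding area2_supp m by (simp add: power2_eq_square algebra_simps)
  also have "\<dots> = (integral {0..2*pi} \<rho>)\<^sup>2 / (2 * pi)" by (simp add: r_def power2_eq_square field_simps)
  finally show ?thesis .
qed

text \<open>The integral of \<open>(\<rho> - r)^2\<close>, with \<open>r\<close> the mean of
  \<open>\<rho>\<close>, equals the integral of \<open>\<rho>^2\<close> less
  \<open>perimeter^2 / (2 * pi)\<close>. The hypothesis and the isoperimetric inequality make it
  nonpositive, so \<open>\<rho>\<close> is constant.\<close>

lemma circle_if_integral_le:
  assumes "integral {0..2*pi} (\<lambda>t. (\<rho> t)\<^sup>2) \<le> area2"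
  shows "\<exists>c r. r > 0 \<and> \<Gamma> ` UNIV = sphere c r"
proof -
  define r where "r = integral {0..2*pi} \<rho> / (2 * pi)"
  have m: "integral {0..2*pi} \<rho> = 2 * pi * r" by (simp add: r_def)
  have "integral {0..2*pi} (\<lambda>t. (\<rho> t - r)\<^sup>2) = integral {0..2*pi} (\<lambda>t. (\<rho> t)\<^sup>2 - (2 * r) * \<rho> t + r\<^sup>2)"
    by (simp add: power2_diff algebra_simps)
  also have "\<dots> = integral {0..2*pi} (\<lambda>t. (\<rho> t)\<^sup>2) - (2 * r) * integral {0..2*pi} \<rho> + 2 * pi * r\<^sup>2"
    by (subst integral_add integral_diff integral_mult_right;
        (intro integrable_continuous_real continuous_intros \<rho>_cont)?)+ auto
  also have "\<dots> \<le> 0" using assms area2_le unfolding m by (simp add: power2_eq_square field_simps)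
  finally have "integral {0..2*pi} (\<lambda>t. (\<rho> t - r)\<^sup>2) \<le> 0" .
  moreover have "integral {0..2*pi} (\<lambda>t. (\<rho> t - r)\<^sup>2) \<ge> 0"
    by (intro integral_nonneg integrable_continuous_real continuous_intros \<rho>_cont) auto
  ultimately have "integral {0..2*pi} (\<lambda>t. (\<rho> t - r)\<^sup>2) = 0" by simp
  then have r0: "\<rho> t = r" if "t \<in> {0..2*pi}" for t
  proof -
    have "continuous_on {0..2*pi} (\<lambda>t. (\<rho> t - r)\<^sup>2)" by (intro continuous_intros \<rho>_cont)
    from integral_eq_0_iff[OF this] \<open>integral {0..2*pi} (\<lambda>t. (\<rho> t - r)\<^sup>2) = 0\<close> that
    show ?thesis by auto
  qed
  have r: "r > 0" using r0[of 0] \<rho>_pos[of 0] by simp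
  interpret P: periodic_fun_simple \<Gamma> "2 * pi" by standard (simp add: \<Gamma>_periodic)
  \<comment> \<open>The centre of curvature at parameter 0: the inward normal there is
    \<open>\<i>\<close>. Constant radius makes the centre of curvature stationary.\<close>
  define c where "c = \<Gamma> 0 + \<i> * of_real r"
  have eq: "\<Gamma> t = c - \<i> * of_real r * cis t" if t: "t \<in> {0..2*pi}" for t
  proof -
    have d: "((\<lambda>t. \<Gamma> t + \<i> * of_real r * cis t) has_vector_derivative 0) (at x within {0..2*pi})" if "x \<in> {0..2*pi}" for x
    proof -
      have "((\<lambda>t. \<Gamma> t + \<i> * of_real r * cis t) has_vector_derivative
          of_real (\<rho> x) * cis x + \<i> * of_real r * (\<i> * of_real 1 * cis x)) (at x)"
        by (intro has_vector_derivative_add \<Gamma>_deriv has_vector_derivative_mult_right has_vector_derivative_cis DERIV_ident)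
      moreover have "of_real (\<rho> x) * cis x + \<i> * of_real r * (\<i> * of_real 1 * cis x) = 0"
        unfolding r0[OF that] by (simp add: complex_eq_iff)
      ultimately show ?thesis using has_vector_derivative_at_within by metis
    qed
    obtain k where k: "\<And>x. x \<in> {0..2*pi} \<Longrightarrow> \<Gamma> x + \<i> * of_real r * cis x = k"
      using has_vector_derivative_zero_constant[OF convex_real_interval(5) d] by blast
    show ?thesis using k[OF t] k[of 0] by (simp add: c_def algebra_simps)
  qed
  have red: "\<exists>t\<in>{0..2*pi}. \<Gamma> t = \<Gamma> x" for x
  proof -
    define k where "k = \<lfloor>x / (2 * pi)\<rfloor>"
    have "of_int k \<le> x / (2 * pi)" "x / (2 * pi) < of_int k + 1" unfolding k_def by linarith+
    then have "x - of_int k * (2 * pi) \<in> {0..2*pi}" by (simp add: field_simps)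
    then show ?thesis using P.minus_of_int[of x k] by blast
  qed
  have "\<Gamma> ` UNIV = sphere c r"
  proof
    show "\<Gamma> ` UNIV \<subseteq> sphere c r"
    proof
      fix w assume "w \<in> \<Gamma> ` UNIV"
      then obtain t where "t \<in> {0..2*pi}" "\<Gamma> t = w" using red by blast
      then show "w \<in> sphere c r" using eq[of t] r by (auto simp: dist_norm norm_mult)
    qed
    show "sphere c r \<subseteq> \<Gamma> ` UNIV"
    proof
      fix w assume w: "w \<in> sphere c r"
      define u where "u = \<i> * (w - c) / of_real r"
      have "norm u = 1" using w r by (simp add: u_def norm_mult norm_divide dist_norm norm_minus_commute)
      then have "(Re u)\<^sup>2 + (Im u)\<^sup>2 = 1" by (simp add: cmod_power2[symmetric])
      then obtain t where t': "0 \<le> t" "t < 2 * pi" "Re u = cos t" "Im u = sin t"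
        using sincos_total_2pi by metis
      then have t: "0 \<le> t" "t < 2 * pi" "u = cis t" by (auto simp: complex_eq_iff)
      have "w = c - \<i> * of_real r * cis t" unfolding t(3)[symmetric] u_def using r by simp
      also have "\<dots> = \<Gamma> t" using eq[of t] t by simp
      finally show "w \<in> \<Gamma> ` UNIV" by simp
    qed
  qed
  then show ?thesis using r by blast
qed

section \<open>Areas cut off by constant-angle chords\<close>

text \<open>On a constant-angle curve the chord points in the direction \<open>cis s\<close>. The area of the segments then
  follows by pairing the relation \<open>sin \<delta> (k\<^sub>+ + k\<^sub>-) = cos \<delta> (h\<^sub>+ - h\<^sub>-)\<close> for the support function \<open>h\<close>
  and \<open>k = h'\<close> with \<open>h\<^sub>-\<close> and \<open>k\<^sub>-\<close>.\<close>

lemma level_dir: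
  assumes d: "0 \<le> d" "d \<le> pi / 2"
    and l: "\<And>\<theta>. cos_out \<theta> (\<theta> + 2 * d) = cos d"
  shows "ch d s = of_real (chord (s - d) (s + d)) * cis s"
proof -
  have b: "s - d \<le> s + d" "s + d < s - d + 2 * pi" using d pi_gt_zero by linarith+
  have c: "cos_out (s - d) (s + d) = cos d" using l[of "s - d"] by (simp add: add.commute)
  have "(sin_out (s - d) (s + d))\<^sup>2 = (sin d)\<^sup>2"
    using cos_sin_out[OF b] unfolding c sin_squared_eq by simp
  then have "sin_out (s - d) (s + d) = sin d"
    using sin_nonneg(1)[OF b] sin_ge_zero[of d] d by (simp add: power2_eq_iff_nonneg)
  then have "cis (- (s - d)) * dir (s - d) (s + d) = cis d"
    unfolding cis_cos_out c by (simp add: complex_eq_iff)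
  then have "cis (s - d) * (cis (- (s - d)) * dir (s - d) (s + d)) = cis s" by (simp add: cis_mult)
  then have "dir (s - d) (s + d) = cis s" by (simp only: mult.assoc[symmetric] cis_mult) simp
  then show ?thesis unfolding ch_def using \<Gamma>_diff[OF b(1)] by simp
qed

text \<open>The direction angle is \<open>s\<close> itself. Formally,
  \<open>cis (- s) * ch d s\<close> is real for every \<open>s\<close>, so the imaginary part of its
  derivative vanishes. This reduces the boundary term of Green's theorem to the integral of
  \<open>seg\<close>.\<close>

lemma level_rot:
  assumes d: "0 < d" "d \<le> pi / 2"
    and l: "\<And>\<theta>. cos_out \<theta> (\<theta> + 2 * d) = cos d"
  shows "rot_s d s = 1"
proof -
  define H where "H s = chord (s - d) (s + d)" for s
  have W: "ch d s = of_real (H s) * cis s" for s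
    unfolding H_def by (rule level_dir[OF _ d(2) l]) (use d in auto)
  have W': "cis (- s) * ch d s = of_real (H s)" for s
    unfolding W using cis_mult[of "- s" s] by (simp add: mult.left_commute)
  have H: "H s \<noteq> 0" using chord_pos[of "s - d" "s + d"] d unfolding H_def by force
  have "((\<lambda>s. cis (- s) * ch d s) has_vector_derivative
      cis (- s) * ch_s d s + \<i> * of_real (- 1) * cis (- s) * ch d s) (at s)"
    by (rule has_vector_derivative_mult[OF has_vector_derivative_cis ch_deriv(1)]) (auto intro!: derivative_eq_intros)
  from has_real_derivative_Re_Im(2)[OF this]
  have "((\<lambda>s. 0) has_real_derivative Im (cis (- s) * ch_s d s) - H s) (at s)"
    unfolding W' by (simp add: mult.assoc W' del: times_complex.sel)
  then have "Im (cis (- s) * ch_s d s) = H s"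
    using DERIV_unique[OF DERIV_const] by force
  moreover have "ch_s d s / ch d s = cis (- s) * ch_s d s / of_real (H s)"
    unfolding W using H by (simp add: field_simps cis_mult flip: mult.assoc)
  ultimately show ?thesis unfolding rot_s_def using H by (simp del: times_complex.sel)
qed

lemma level_area:
  assumes d: "0 \<le> d" "d \<le> pi / 2"
    and l: "\<And>\<theta>. cos_out \<theta> (\<theta> + 2 * d) = cos d"
  shows "integral {0..2*pi} (seg d) = area2 * (d - sin d * cos d)"
proof -
  let ?I = "\<lambda>f. integral {0..2*pi} (f :: real \<Rightarrow> real)"
  define h1 h2 k1 k2 where "h1 s = supp (s - d)" and "h2 s = supp (s + d)"
    and "k1 s = supp' (s - d)" and "k2 s = supp' (s + d)" for s
  have c: "continuous_on A h1" "continuous_on A h2" "continuous_on A k1" "continuous_on A k2" for A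
    unfolding h1_def h2_def k1_def k2_def by (intro supp_cont continuous_intros)+
  note int = integrable_continuous_real continuous_intros c
  \<comment> \<open>The component of the chord normal to \<open>cis s\<close> is zero; this is that
    equation written with the support function.\<close>
  have rel: "sin d * (k2 s + k1 s) = cos d * (h2 s - h1 s)" for s
  proof -
    have "Im (cis (- s) * ch d s) = 0"
      unfolding level_dir[OF d l] mult.left_commute[of "cis (- s)"] cis_mult by simp
    moreover have "cis (- s) * ch d s = cis d * Complex (k2 s) (- h2 s) - cis (- d) * Complex (k1 s) (- h1 s)"
      unfolding ch_def \<Gamma>_supp[of "s + d"] \<Gamma>_supp[of "s - d"] k1_def k2_def h1_def h2_def
      by (simp only: right_diff_distrib mult.assoc[symmetric] cis_mult) simp
    ultimately show ?thesis by (simp add: algebra_simps)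
  qed
  have cross: "Im (cnj (\<Gamma> (s - d)) * \<Gamma> (s + d)) =
      sin (2 * d) * (h1 s * h2 s + k1 s * k2 s) + cos (2 * d) * (h1 s * k2 s - k1 s * h2 s)" for s
  proof -
    have "cnj (\<Gamma> (s - d)) * \<Gamma> (s + d) = (cis (- (s - d)) * cis (s + d)) * (Complex (k1 s) (h1 s) * Complex (k2 s) (- h2 s))"
      unfolding \<Gamma>_supp[of "s + d"] \<Gamma>_supp[of "s - d"] k1_def k2_def h1_def h2_def
      by (simp add: cis_cnj complex_cnj mult_ac)
    also have "cis (- (s - d)) * cis (s + d) = cis (2 * d)" unfolding cis_mult by simp
    finally show ?thesis by (simp add: algebra_simps)
  qed
  have sh: "?I (\<lambda>s. f (s + a)) = ?I f" if "continuous_on UNIV f" "\<And>s. f (s + 2 * pi) = f s" for f a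
    by (rule integral_periodic_shift[OF that]) auto
  have sh': "?I (\<lambda>s. f (s - d)) = ?I f" if "continuous_on UNIV f" "\<And>s. f (s + 2 * pi) = f s" for f
    using sh[OF that, of "- d"] by simp
  define H K P Q X Y where "H = ?I (\<lambda>t. (supp t)\<^sup>2)" and "K = ?I (\<lambda>t. (supp' t)\<^sup>2)"
    and "P = ?I (\<lambda>s. h1 s * h2 s)" and "Q = ?I (\<lambda>s. k1 s * k2 s)" and "X = ?I (\<lambda>s. h1 s * k2 s)" and "Y = ?I (\<lambda>s. k1 s * h2 s)"
  have H1: "?I (\<lambda>s. (h1 s)\<^sup>2) = H" "?I (\<lambda>s. (k1 s)\<^sup>2) = K" "?I (\<lambda>s. h1 s * k1 s) = 0"
    unfolding H_def K_def h1_def k1_def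
    using sh'[of "\<lambda>t. (supp t)\<^sup>2"] sh'[of "\<lambda>t. (supp' t)\<^sup>2"] sh'[of "\<lambda>t. supp t * supp' t"] supp_orthogonal
    by (simp_all add: supp_periodic supp_cont continuous_intros)
  have XY: "X + Y = 0"
  proof -
    have d1: "(h1 has_real_derivative k1 s) (at s)" "(h2 has_real_derivative k2 s) (at s)" for s
      using shift_deriv(2,1)[OF supp_deriv(1)[unfolded has_real_derivative_iff_has_vector_derivative], of d s]
      unfolding h1_def[abs_def] h2_def[abs_def] k1_def k2_def has_real_derivative_iff_has_vector_derivative by auto
    have "((\<lambda>s. h1 s * h2 s) has_real_derivative h1 s * k2 s + k1 s * h2 s) (at s)" for s
      by (rule DERIV_mult'[OF d1])
    from integral_periodic_deriv[OF this, of "2*pi"] have "?I (\<lambda>s. h1 s * k2 s + k1 s * h2 s) = 0"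
      using supp_periodic[of d] supp_periodic[of "- d"] by (simp add: h1_def h2_def algebra_simps)
    then show ?thesis unfolding X_def Y_def by (subst (asm) integral_add; (intro int)?) simp
  qed
  have E1: "sin d * X = cos d * (P - H)"
  proof -
    have "sin d * (h1 s * k2 s) + sin d * (h1 s * k1 s) = cos d * (h1 s * h2 s) - cos d * (h1 s)\<^sup>2" for s
      using arg_cong[OF rel[of s], of "\<lambda>x. h1 s * x"] by (simp add: algebra_simps power2_eq_square)
    then have "?I (\<lambda>s. sin d * (h1 s * k2 s) + sin d * (h1 s * k1 s)) = ?I (\<lambda>s. cos d * (h1 s * h2 s) - cos d * (h1 s)\<^sup>2)"
      by simp
    moreover have "?I (\<lambda>s. sin d * (h1 s * k2 s) + sin d * (h1 s * k1 s)) = sin d * X"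
      unfolding X_def using H1(3) by (subst integral_add; (intro int)?) simp
    moreover have "?I (\<lambda>s. cos d * (h1 s * h2 s) - cos d * (h1 s)\<^sup>2) = cos d * P - cos d * H"
      unfolding P_def using H1(1) by (subst integral_diff; (intro int)?) simp
    ultimately show ?thesis by (simp add: algebra_simps)
  qed
  have E2: "sin d * (Q + K) = cos d * Y"
  proof -
    have "sin d * (k1 s * k2 s) + sin d * (k1 s)\<^sup>2 = cos d * (k1 s * h2 s) - cos d * (h1 s * k1 s)" for s
      using arg_cong[OF rel[of s], of "\<lambda>x. k1 s * x"] by (simp add: algebra_simps power2_eq_square)
    then have "?I (\<lambda>s. sin d * (k1 s * k2 s) + sin d * (k1 s)\<^sup>2) = ?I (\<lambda>s. cos d * (k1 s * h2 s) - cos d * (h1 s * k1 s))"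
      by simp
    moreover have "?I (\<lambda>s. sin d * (k1 s * k2 s) + sin d * (k1 s)\<^sup>2) = sin d * Q + sin d * K"
      unfolding Q_def using H1(2) by (subst integral_add; (intro int)?) simp
    moreover have "?I (\<lambda>s. cos d * (k1 s * h2 s) - cos d * (h1 s * k1 s)) = cos d * Y"
      unfolding Y_def using H1(3) by (subst integral_diff; (intro int)?) simp
    ultimately show ?thesis by (simp add: algebra_simps)
  qed
  have "?I (\<lambda>s. Im (cnj (\<Gamma> (s - d)) * \<Gamma> (s + d))) = sin (2 * d) * (P + Q) + cos (2 * d) * (X - Y)"
    unfolding cross P_def Q_def X_def Y_def
    by (subst integral_add integral_diff integral_mult_right; (intro int)?)+ simp
  also have "\<dots> = area2 * sin (2 * d)"
  proof -
    have Y: "Y = - X" using XY by simp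
    have "sin d * X - cos d * (P - H) = 0" "sin d * (Q + K) + cos d * X = 0" using E1 E2 Y by auto
    \<comment> \<open>This is \<open>2 * cos d\<close> times the second relation minus
      \<open>2 * sin d\<close> times the first.\<close>
    then have "2 * sin d * cos d * (P + Q) + (cos d * cos d - sin d * sin d) * (2 * X) - 2 * sin d * cos d * (H - K) = 0"
      by algebra
    then show ?thesis
      unfolding area2_supp sin_double cos_double Y H_def K_def by (simp add: algebra_simps power2_eq_square)
  qed
  finally have cr: "?I (\<lambda>s. Im (cnj (\<Gamma> (s - d)) * \<Gamma> (s + d))) = area2 * sin (2 * d)" .
  \<comment> \<open>By Fubini: the increment of \<open>seg_prim\<close> integrates the area form
    over a window of length \<open>2 * d\<close>, and each translate of that form has integral
    \<open>area2 / 2\<close> over a period.\<close>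
  have "?I (\<lambda>s. seg_prim (s + d) - seg_prim (s - d)) = area2 * d"
  proof -
    define f where "f t = Im (cnj (\<Gamma> t) * vel t) / 2" for t
    have fc: "continuous_on A (\<lambda>x. f (g x))" if "continuous_on A g" for A and g :: "'x::topological_space \<Rightarrow> real"
      unfolding f_def by (intro continuous_intros \<Gamma>_compose_cont vel_cont that) auto
    have "((\<lambda>t. f (s + t)) has_integral seg_prim (s + d) - seg_prim (s + - d)) {- d..d}" for s
    proof (rule fundamental_theorem_of_calculus)
      show "((\<lambda>t. seg_prim (s + t)) has_vector_derivative f (s + t)) (at t within {- d..d})" for t
        using shift_deriv(3)[OF seg_prim_deriv[unfolded has_real_derivative_iff_has_vector_derivative]]
        unfolding f_def by (rule has_vector_derivative_at_within)
    qed (use d in auto)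
    from integral_unique[OF this]
    have "?I (\<lambda>s. seg_prim (s + d) - seg_prim (s - d)) = ?I (\<lambda>s. integral {- d..d} (\<lambda>t. f (s + t)))"
      by simp
    also have "\<dots> = integral {- d..d} (\<lambda>t. ?I (\<lambda>s. f (s + t)))"
    proof -
      have "continuous_on (cbox (0, - d) (2 * pi, d)) (\<lambda>(s, t). f (s + t))"
        unfolding split_beta by (intro fc continuous_intros)
      from integral_swap_continuous[OF this] show ?thesis by simp
    qed
    also have "\<dots> = integral {- d..d} (\<lambda>t. area2 / 2)"
    proof (rule integral_cong)
      fix t
      have "?I (\<lambda>s. f (s + t)) = ?I f"
        by (rule sh[OF fc]) (auto simp: f_def \<Gamma>_periodic vel_periodic)
      then show "?I (\<lambda>s. f (s + t)) = area2 / 2" by (simp add: f_def[abs_def] area2_def)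
    qed
    also have "\<dots> = area2 * d" using d by simp
    finally show ?thesis .
  qed
  moreover have "?I (seg d) = ?I (\<lambda>s. seg_prim (s + d) - seg_prim (s - d)) - ?I (\<lambda>s. Im (cnj (\<Gamma> (s - d)) * \<Gamma> (s + d)) / 2)"
  proof -
    have "continuous_on UNIV seg_prim"
      using seg_prim_deriv DERIV_isCont continuous_at_imp_continuous_on by blast
    then have sp: "continuous_on A (\<lambda>x. seg_prim (h x))" if "continuous_on A h" for A and h :: "real \<Rightarrow> real"
      by (rule continuous_on_compose2[OF _ that]) auto
    show ?thesis unfolding seg_def[abs_def]
      by (intro integral_diff integrable_continuous_real continuous_intros sp \<Gamma>_compose_cont) auto
  qed
  ultimately have "?I (seg d) = area2 * d - area2 * sin (2 * d) / 2" unfolding integral_divide cr by simp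
  then show ?thesis by (simp only: sin_double) (simp add: algebra_simps)
qed

end

section \<open>Strips foliated by invariant curves\<close>

text \<open>The strip between two invariant constant-angle curves: a chord making the same angle \<open>\<delta>\<close> with
  the tangents at both ends joins tangent angles that differ by exactly \<open>2\<delta>\<close>.\<close>

locale oval_strip = oval +
  fixes \<delta>1 \<delta>2 :: real
  assumes \<delta>: "0 \<le> \<delta>1" "\<delta>1 < \<delta>2" "\<delta>2 \<le> pi / 2"
    and level1: "cos_out \<theta> (\<theta> + 2 * \<delta>1) = cos \<delta>1" "cos_in \<theta> (\<theta> + 2 * \<delta>1) = cos \<delta>1"
    and level2: "cos_out \<theta> (\<theta> + 2 * \<delta>2) = cos \<delta>2" "cos_in \<theta> (\<theta> + 2 * \<delta>2) = cos \<delta>2"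
begin

definition str :: "(real \<times> real) set" where
  "str = {z. fst z + 2 * \<delta>1 \<le> snd z \<and> snd z \<le> fst z + 2 * \<delta>2}"

text \<open>The second coordinate is the cosine of the angle rather than the angle: in it the
  invariant measure has density \<open>\<rho>\<close> alone.\<close>

definition phase :: "(real \<times> real) set" where
  "phase = UNIV \<times> {cos \<delta>2..cos \<delta>1}"

lemma str_wedge: "str \<subseteq> wedge"
  using \<delta> by (auto simp: str_def wedge_def)

lemma cos_less: "cos \<delta>2 < cos \<delta>1"
  using \<delta> by (intro cos_monotone_0_pi) auto

lemma cos_out_range:
  assumes "(\<theta>, y) \<in> str"
  shows "cos_out \<theta> y \<in> {cos \<delta>2..cos \<delta>1}"
  using cos_out_less_iff[of \<theta> y "\<theta> + 2 * \<delta>1"] cos_out_less_iff[of \<theta> "\<theta> + 2 * \<delta>2" y] assms \<delta>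
  unfolding level1 level2 str_def by (auto simp: not_less[symmetric])

lemma cos_in_range:
  assumes "(\<theta>, y) \<in> str"
  shows "cos_in \<theta> y \<in> {cos \<delta>2..cos \<delta>1}"
  using cos_in_less_iff[of \<theta> y "y - 2 * \<delta>2"] cos_in_less_iff[of "y - 2 * \<delta>1" y \<theta>] assms \<delta>
    level1(2)[of "y - 2 * \<delta>1"] level2(2)[of "y - 2 * \<delta>2"]
  unfolding str_def by (auto simp: not_less[symmetric])

section \<open>The next bounce as a function of position and angle\<close>

definition nxt :: "real \<Rightarrow> real \<Rightarrow> real" where
  "nxt \<theta> p = (THE y. (\<theta>, y) \<in> str \<and> cos_out \<theta> y = p)"

lemma nxt_ex1:
  assumes "p \<in> {cos \<delta>2..cos \<delta>1}"
  shows "\<exists>!y. (\<theta>, y) \<in> str \<and> cos_out \<theta> y = p"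
proof (rule ex_ex1I)
  have "continuous_on {\<theta> + 2 * \<delta>1..\<theta> + 2 * \<delta>2} (cos_out \<theta>)"
    by (rule compose_cont[OF angle_cont(1)]) (use \<delta> in \<open>auto simp: wedge_def\<close>)
  then show "\<exists>y. (\<theta>, y) \<in> str \<and> cos_out \<theta> y = p"
    using IVT2'[of "cos_out \<theta>" "\<theta> + 2 * \<delta>2" p "\<theta> + 2 * \<delta>1"] assms \<delta> level1 level2
    by (auto simp: str_def)
next
  fix y1 y2 assume "(\<theta>, y1) \<in> str \<and> cos_out \<theta> y1 = p" "(\<theta>, y2) \<in> str \<and> cos_out \<theta> y2 = p"
  then show "y1 = y2"
    using cos_out_less_iff[of \<theta> y1 y2] cos_out_less_iff[of \<theta> y2 y1] \<delta> by (auto simp: str_def)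
qed

lemma nxt:
  assumes "p \<in> {cos \<delta>2..cos \<delta>1}"
  shows "(\<theta>, nxt \<theta> p) \<in> str" "cos_out \<theta> (nxt \<theta> p) = p"
  using theI'[OF nxt_ex1[OF assms, of \<theta>]] unfolding nxt_def by auto

lemma nxt_eq:
  assumes "(\<theta>, y) \<in> str"
  shows "nxt \<theta> (cos_out \<theta> y) = y"
  unfolding nxt_def by (rule the1_equality[OF nxt_ex1[OF cos_out_range[OF assms]]]) (use assms in auto)

lemma str_shift: "(\<theta> + a, y + a) \<in> str \<longleftrightarrow> (\<theta>, y) \<in> str"
  by (auto simp: str_def)

lemma nxt_periodic:
  assumes "p \<in> {cos \<delta>2..cos \<delta>1}"
  shows "nxt (\<theta> + 2 * pi) p = nxt \<theta> p + 2 * pi"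
  using nxt_eq[of "\<theta> + 2 * pi" "nxt \<theta> p + 2 * pi"] nxt[OF assms, of \<theta>]
  by (simp add: angle_periodic str_shift)

text \<open>A barrier \<open>b\<close> placed just beside the value of \<open>nxt\<close> satisfies
  a strict inequality between \<open>cos_out\<close> and \<open>p\<close>. The inequality persists
  for nearby \<open>(\<theta>, p)\<close>, and the twist condition turns it back into a bound for
  \<open>nxt\<close>.\<close>

lemma nxt_cont: "continuous_on phase (\<lambda>z. nxt (fst z) (snd z))"
  unfolding continuous_on_def
proof
  fix z assume z: "z \<in> phase"
  obtain \<theta> p where zp: "z = (\<theta>, p)" by (cases z)
  then have p: "p \<in> {cos \<delta>2..cos \<delta>1}" using z by (auto simp: phase_def)
  define y where "y = nxt \<theta> p"
  have y: "(\<theta>, y) \<in> str" "cos_out \<theta> y = p" using nxt[OF p] by (auto simp: y_def)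
  have yb: "\<theta> \<le> y" "y < \<theta> + 2 * pi" using y(1) \<delta> by (auto simp: str_def)
  have in_ph: "eventually (\<lambda>w. w \<in> phase) (at z within phase)" by (auto simp: eventually_at_filter)
  have tf: "(fst \<longlongrightarrow> \<theta>) (at z within phase)" "(snd \<longlongrightarrow> p) (at z within phase)"
    using tendsto_fst[OF tendsto_ident_at, of z phase] tendsto_snd[OF tendsto_ident_at, of z phase]
    by (simp_all add: zp)
  have cc: "((\<lambda>w. cos_out (fst w) a) \<longlongrightarrow> cos_out \<theta> a) (at z within phase)"
    if a: "\<theta> < a" "a < \<theta> + 2 * pi" for a
  proof -
    have "isCont (\<lambda>\<theta>. cos_out \<theta> a) \<theta>"
      using cos_deriv(1)[OF DERIV_ident DERIV_const, of \<theta> a] a DERIV_isCont by fastforce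
    from isCont_tendsto_compose[OF this tf(1)] show ?thesis .
  qed
  have nw: "(fst w, nxt (fst w) (snd w)) \<in> str" "cos_out (fst w) (nxt (fst w) (snd w)) = snd w"
    if "w \<in> phase" for w using nxt[of "snd w" "fst w"] that by (auto simp: phase_def)
  show "((\<lambda>z. nxt (fst z) (snd z)) \<longlongrightarrow> nxt (fst z) (snd z)) (at z within phase)"
  proof (rule order_tendstoI)
    fix a assume "a < nxt (fst z) (snd z)"
    then have a: "a < y" by (simp add: zp y_def)
    show "eventually (\<lambda>x. a < nxt (fst x) (snd x)) (at z within phase)"
    \<comment> \<open>Below \<open>\<theta>\<close> there is no barrier, since
      \<open>cos_out\<close> is controlled only on the wedge; it suffices that \<open>nxt\<close> is
      at least its first argument.\<close>
    proof (cases "a < \<theta>")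
      case True
      have "eventually (\<lambda>w. a < fst w) (at z within phase)"
        using order_tendstoD(1)[OF tf(1) True] .
      with in_ph show ?thesis
        by eventually_elim (use nw \<delta> in \<open>force simp: str_def\<close>)
    next
      case False
      define b where "b = (a + y) / 2"
      have b: "a < b" "b < y" "\<theta> < b" "b < \<theta> + 2 * pi" using a False yb by (auto simp: b_def)
      have "cos_out \<theta> b - p > 0" using cos_out_strict[of \<theta> b y] b yb y(2) by auto
      moreover have "((\<lambda>w. cos_out (fst w) b - snd w) \<longlongrightarrow> cos_out \<theta> b - p) (at z within phase)"
        by (intro tendsto_intros cc b tf)
      ultimately have "eventually (\<lambda>w. cos_out (fst w) b - snd w > 0) (at z within phase)"
        using order_tendstoD(1) by blast
      moreover have "eventually (\<lambda>w. fst w < b) (at z within phase)" using order_tendstoD(2)[OF tf(1)] b by blast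
      moreover have "eventually (\<lambda>w. fst w > b - 2 * pi) (at z within phase)"
        using order_tendstoD(1)[OF tf(1)] b by force
      ultimately show ?thesis using in_ph
      proof eventually_elim
        case (elim w)
        then have "b < nxt (fst w) (snd w)"
          using cos_out_less_iff[of "fst w" b "nxt (fst w) (snd w)"] nw[of w] \<delta> by (auto simp: str_def)
        then show ?case using b by simp
      qed
    qed
  next
    fix a assume "a > nxt (fst z) (snd z)"
    then have a: "a > y" by (simp add: zp y_def)
    define b where "b = min ((a + y) / 2) ((y + \<theta> + 2 * pi) / 2)"
    have b: "b < a" "y < b" "\<theta> < b" "b < \<theta> + 2 * pi" using a yb by (auto simp: b_def min_def field_simps)
    have "cos_out \<theta> b - p < 0" using cos_out_strict[of \<theta> y b] b yb y(2) by auto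
    moreover have "((\<lambda>w. cos_out (fst w) b - snd w) \<longlongrightarrow> cos_out \<theta> b - p) (at z within phase)"
      by (intro tendsto_intros cc b tf)
    ultimately have "eventually (\<lambda>w. cos_out (fst w) b - snd w < 0) (at z within phase)"
      using order_tendstoD(2) by blast
    moreover have "eventually (\<lambda>w. fst w < b) (at z within phase)" using order_tendstoD(2)[OF tf(1)] b by blast
    moreover have "eventually (\<lambda>w. fst w > b - 2 * pi) (at z within phase)"
      using order_tendstoD(1)[OF tf(1)] b by force
    ultimately show "eventually (\<lambda>x. nxt (fst x) (snd x) < a) (at z within phase)" using in_ph
    proof eventually_elim
      case (elim w)
      then have "nxt (fst w) (snd w) < b"
        using cos_out_less_iff[of "fst w" "nxt (fst w) (snd w)" b] nw[of w] \<delta> by (auto simp: str_def)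
      then show ?case using b by simp
    qed
  qed
qed

section \<open>Invariant graphs and their calibration\<close>

text \<open>A continuous invariant graph lifted to the line of tangent angles, recorded by the
  cosine of its angle. The last clause is the law of reflection: the arrival cosine at the next
  point is the departure cosine there. It says only that the image lies in the graph; surjectivity
  is recovered in \<open>leaf_rotation\<close>.\<close>

definition leaf :: "(real \<Rightarrow> real) \<Rightarrow> bool" where
  "leaf F \<longleftrightarrow> continuous_on UNIV F \<and> (\<forall>\<theta>. F (\<theta> + 2 * pi) = F \<theta>) \<and> (\<forall>\<theta>. F \<theta> \<in> {cos \<delta>2..cos \<delta>1}) \<and>
     (\<forall>\<theta>. F (nxt \<theta> (F \<theta>)) = cos_in \<theta> (nxt \<theta> (F \<theta>)))"

text \<open>Two points with a common image \<open>y\<close> arrive there with the same cosine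
  \<open>F y\<close>, so the twist condition identifies them. A continuous injection of the line is
  monotone, and commuting with the shift by \<open>2 * pi\<close> makes it increasing; surjectivity
  follows from \<open>\<theta> \<le> \<phi> \<theta> \<le> \<theta> + pi\<close>.\<close>

lemma leaf_rotation:
  assumes L: "leaf F"
  defines "\<phi> \<equiv> \<lambda>\<theta>. nxt \<theta> (F \<theta>)"
  shows "continuous_on UNIV \<phi>" "strict_mono \<phi>" "surj \<phi>"
proof -
  have Fc: "continuous_on UNIV F" and Fp: "\<And>\<theta>. F (\<theta> + 2 * pi) = F \<theta>"
    and Fr: "\<And>\<theta>. F \<theta> \<in> {cos \<delta>2..cos \<delta>1}" and Fi: "\<And>\<theta>. F (\<phi> \<theta>) = cos_in \<theta> (\<phi> \<theta>)"
    using L by (auto simp: leaf_def \<phi>_def)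
  show c: "continuous_on UNIV \<phi>" unfolding \<phi>_def
    by (rule compose_cont[OF nxt_cont]) (use Fc Fr in \<open>auto simp: phase_def\<close>)
  have s: "(\<theta>, \<phi> \<theta>) \<in> str" for \<theta> unfolding \<phi>_def by (rule nxt(1)[OF Fr])
  have p: "\<phi> (\<theta> + 2 * pi) = \<phi> \<theta> + 2 * pi" for \<theta>
    unfolding \<phi>_def Fp by (rule nxt_periodic[OF Fr])
  have "inj \<phi>"
  proof (rule injI)
    fix a b assume ab: "\<phi> a = \<phi> b"
    have "cos_in a (\<phi> a) = cos_in b (\<phi> b)" using Fi[of a] Fi[of b] ab by metis
    moreover have bd: "a \<le> \<phi> b" "b \<le> \<phi> b" "\<phi> b < a + 2 * pi" "\<phi> b < b + 2 * pi"
      using s[of a] s[of b] \<delta> unfolding ab by (auto simp: str_def)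
    ultimately have "\<not> a < b" "\<not> b < a"
      using cos_in_less_iff[OF bd] cos_in_less_iff[OF bd(2,1,4,3)] unfolding ab by auto
    then show "a = b" by simp
  qed
  then consider "strict_mono \<phi>" | "strict_antimono_on UNIV \<phi>"
    using injective_eq_monotone_map[OF is_interval_univ c] by blast
  then show sm: "strict_mono \<phi>"
  proof cases
    case 2
    have "(0::real) < 0 + 2 * pi" by simp
    then have "\<phi> 0 > \<phi> (0 + 2 * pi)" using 2 unfolding monotone_on_def by blast
    then show ?thesis unfolding p by simp
  qed
  show "surj \<phi>"
  proof -
    have "\<exists>x. \<phi> x = y" for y
    proof -
      have "\<phi> (y - pi) \<le> y" using s[of "y - pi"] \<delta> by (auto simp: str_def)
      moreover have "y \<le> \<phi> y" using s[of y] \<delta> by (auto simp: str_def)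
      ultimately show ?thesis using IVT'[of \<phi> "y - pi" y y] continuous_on_subset[OF c] by auto
    qed
    then show ?thesis by (metis surjI)
  qed
qed

text \<open>The calibration \<open>U\<close> with \<open>U' = \<rho> F\<close> turns the leaf into the maximum set of
  \<open>G(\<theta>, y) = chord \<theta> y + U \<theta> - U y\<close>: by the twist condition \<open>G(\<theta>, \<cdot>)\<close> peaks on the leaf, and \<open>G\<close> is
  critical, hence constant, along it. At fixed points of the rotation (leaf touching the boundary)
  \<open>G\<close> vanishes, which replaces the derivative argument there.\<close>

lemma leaf_calibrated:
  assumes L: "leaf F" and U: "\<And>x. (U has_real_derivative \<rho> x * F x) (at x)"
    and y: "\<theta> \<le> y" "y < \<theta> + 2 * pi"
  defines "\<phi> \<equiv> \<lambda>\<theta>. nxt \<theta> (F \<theta>)"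
  shows "chord \<theta> y + U \<theta> - U y \<le> chord \<theta>' (\<phi> \<theta>') + U \<theta>' - U (\<phi> \<theta>')"
proof -
  have Fc: "continuous_on UNIV F" and Fp: "\<And>\<theta>. F (\<theta> + 2 * pi) = F \<theta>"
    and Fr: "\<And>\<theta>. F \<theta> \<in> {cos \<delta>2..cos \<delta>1}" and Fi: "\<And>\<theta>. F (\<phi> \<theta>) = cos_in \<theta> (\<phi> \<theta>)"
    using L by (auto simp: leaf_def \<phi>_def)
  have \<phi>c: "continuous_on UNIV \<phi>" and \<phi>m: "strict_mono \<phi>" and \<phi>s: "surj \<phi>"
    using leaf_rotation[OF L] by (auto simp: \<phi>_def)
  have s: "(\<theta>, \<phi> \<theta>) \<in> str" and co: "cos_out \<theta> (\<phi> \<theta>) = F \<theta>" for \<theta>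
    unfolding \<phi>_def using nxt[OF Fr] by auto
  have sb: "\<theta> \<le> \<phi> \<theta>" "\<phi> \<theta> \<le> \<theta> + pi" for \<theta> using s[of \<theta>] \<delta> by (auto simp: str_def)
  have Uc: "continuous_on A U" for A using U DERIV_isCont continuous_at_imp_continuous_on by blast
  define G where "G \<theta> y = chord \<theta> y + U \<theta> - U y" for \<theta> y
  have Gy: "(G \<theta> has_real_derivative \<rho> y * (cos_in \<theta> y - F y)) (at y)" if "\<theta> < y" "y < \<theta> + 2 * pi" for \<theta> y
    unfolding G_def using chord_deriv(1)[OF DERIV_const DERIV_ident, of \<theta> y] that
    by (auto intro!: derivative_eq_intros U simp: algebra_simps)
  have Gx: "((\<lambda>\<theta>. G \<theta> y) has_real_derivative \<rho> \<theta> * (F \<theta> - cos_out \<theta> y)) (at \<theta>)" if "\<theta> < y" "y < \<theta> + 2 * pi" for \<theta> y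
    unfolding G_def using chord_deriv(1)[OF DERIV_ident DERIV_const, of \<theta> y] that
    by (auto intro!: derivative_eq_intros U simp: algebra_simps)
  have Gc: "continuous_on A (G \<theta>)" for A \<theta> unfolding G_def
    by (intro continuous_intros Uc compose_cont[OF chord_cont[of UNIV]]) auto
  have peak: "G \<theta> y \<le> G \<theta> (\<phi> \<theta>)" if y: "\<theta> \<le> y" "y < \<theta> + 2 * pi" for \<theta> y
  proof -
    consider "y = \<phi> \<theta>" | "y < \<phi> \<theta>" | "y > \<phi> \<theta>" by linarith
    then show ?thesis
    proof cases
      case 2
      have "G \<theta> y < G \<theta> (\<phi> \<theta>)"
      proof (rule DERIV_pos_imp_increasing_open[OF 2 _ Gc])
        fix x assume x: "y < x" "x < \<phi> \<theta>"
        \<comment> \<open>Since \<open>F x = cos_in w x\<close>, the sign of the derivative of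
          \<open>G \<theta>\<close> at \<open>x\<close> is decided by comparing
          \<open>\<theta>\<close> with \<open>w\<close>.\<close>
        obtain w where w: "x = \<phi> w" using \<phi>s by (metis surjD)
        then have "w < \<theta>" using x \<phi>m by (simp add: strict_mono_less)
        then have "cos_in \<theta> x > F x" unfolding w Fi
          using cos_in_less_iff[of w "\<phi> w" \<theta>] sb[of w] sb[of \<theta>] x y pi_gt_zero unfolding w by linarith
        moreover have "\<theta> < x" "x < \<theta> + 2 * pi" using x y sb[of \<theta>] pi_gt_zero by linarith+
        ultimately show "\<exists>l. (G \<theta> has_real_derivative l) (at x) \<and> 0 < l"
          using Gy[of \<theta> x] \<rho>_pos[of x] by (intro exI[of _ "\<rho> x * (cos_in \<theta> x - F x)"]) simp
      qed
      then show ?thesis by simp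
    next
      case 3
      have "G \<theta> y < G \<theta> (\<phi> \<theta>)"
      proof (rule DERIV_neg_imp_decreasing_open[OF 3 _ Gc])
        fix x assume x: "\<phi> \<theta> < x" "x < y"
        obtain w where w: "x = \<phi> w" using \<phi>s by (metis surjD)
        then have "\<theta> < w" using x \<phi>m by (simp add: strict_mono_less)
        then have "cos_in \<theta> x < F x" unfolding w Fi
          using cos_in_less_iff[of \<theta> "\<phi> w" w] sb[of w] sb[of \<theta>] x y pi_gt_zero unfolding w by linarith
        moreover have "\<theta> < x" "x < \<theta> + 2 * pi" using x y sb[of \<theta>] by linarith+
        ultimately show "\<exists>l. (G \<theta> has_real_derivative l) (at x) \<and> l < 0"
          using Gy[of \<theta> x] \<rho>_pos[of x]
          by (intro exI[of _ "\<rho> x * (cos_in \<theta> x - F x)"]) (simp add: mult_pos_neg)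
      qed
      then show ?thesis by simp
    qed simp
  qed
  define m where "m \<theta> = G \<theta> (\<phi> \<theta>)" for \<theta>
  have mc: "continuous_on A m" for A unfolding m_def G_def
    by (intro continuous_intros Uc compose_cont[OF chord_cont[of UNIV]]
        continuous_on_compose2[OF Uc[of UNIV]] continuous_on_subset[OF \<phi>c]) auto
  have touch: "\<phi> x = x" if "F x = 1" for x
    using co[of x] that cos_out_less_iff[of x "\<phi> x" x] cos_out_less_iff[of x x "\<phi> x"] sb[of x] pi_gt_zero
    by force
  have gap: "x < \<phi> x" if "F x \<noteq> 1" for x
    using co[of x] that sb[of x] by (cases "x = \<phi> x") auto
  \<comment> \<open>An envelope argument, because \<open>\<phi>\<close> need not be differentiable.
    By \<open>peak\<close>, the increment of \<open>m\<close> is squeezed between increments of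
    \<open>G\<close> in its first argument with the second held fixed, and that partial derivative
    \<open>E\<close> vanishes on the leaf.\<close>
  have dm: "(m has_real_derivative 0) (at x)" if x: "F x \<noteq> 1" for x
    unfolding has_field_derivative_def has_derivative_at_alt
  proof (intro conjI allI impI)
    fix e :: real assume e: "e > 0"
    define E where "E z = \<rho> (fst z) * (F (fst z) - cos_out (fst z) (snd z))" for z
    define D where "D = {z::real \<times> real. fst z < snd z \<and> snd z < fst z + 2 * pi}"
    have "open D" unfolding D_def
      by (intro open_Collect_conj open_Collect_less continuous_intros)
    have xD: "(x, \<phi> x) \<in> D" using gap[OF x] sb[of x] pi_gt_zero by (auto simp: D_def)
    have "continuous_on D E" unfolding E_def
      by (intro continuous_intros \<rho>_compose_cont continuous_on_compose2[OF Fc]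
          continuous_on_subset[OF angle_cont(1)]) (auto simp: D_def wedge_def)
    then have "isCont E (x, \<phi> x)" using \<open>open D\<close> xD by (simp add: continuous_on_eq_continuous_at)
    moreover have "E (x, \<phi> x) = 0" by (simp add: E_def co)
    ultimately have "(E \<longlongrightarrow> 0) (nhds (x, \<phi> x))"
      using tendsto_at_iff_tendsto_nhds[of E "(x, \<phi> x)"] unfolding isCont_def by simp
    from tendstoD[OF this e] have "eventually (\<lambda>z. \<bar>E z\<bar> < e) (nhds (x, \<phi> x))" by simp
    then have "eventually (\<lambda>z. \<bar>E z\<bar> < e \<and> z \<in> D) (nhds (x, \<phi> x))"
      using eventually_nhds_in_open[OF \<open>open D\<close> xD] by eventually_elim auto
    then have "eventually (\<lambda>z. \<bar>E z\<bar> < e \<and> z \<in> D) (nhds x \<times>\<^sub>F nhds (\<phi> x))"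
      by (simp add: nhds_prod)
    then obtain P Q where P: "eventually P (nhds x)" and Q: "eventually Q (nhds (\<phi> x))"
      and PQ: "\<And>a b. P a \<Longrightarrow> Q b \<Longrightarrow> \<bar>E (a, b)\<bar> < e \<and> (a, b) \<in> D"
      unfolding eventually_prod_filter by blast
    have "isCont \<phi> x" using \<phi>c by (simp add: continuous_on_eq_continuous_at)
    then have "filterlim \<phi> (nhds (\<phi> x)) (nhds x)"
      unfolding isCont_def tendsto_at_iff_tendsto_nhds .
    from eventually_compose_filterlim[OF Q this] have "eventually (\<lambda>a. Q (\<phi> a)) (nhds x)" .
    with P have "eventually (\<lambda>a. P a \<and> Q (\<phi> a)) (nhds x)" by eventually_elim auto
    then obtain d where d: "d > 0" "\<And>a. dist a x < d \<Longrightarrow> P a \<and> Q (\<phi> a)"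
      unfolding eventually_nhds_metric by blast
    have bnd: "\<bar>G a (\<phi> w) - G b (\<phi> w)\<bar> \<le> e * \<bar>a - b\<bar>"
      if "a \<in> ball x d" "b \<in> ball x d" "w \<in> ball x d" for a b w
    proof -
      have "norm (G a (\<phi> w) - G b (\<phi> w)) \<le> e * norm (a - b)"
      proof (rule field_differentiable_bound[OF convex_ball])
        fix z assume z: "z \<in> ball x d"
        have *: "\<bar>E (z, \<phi> w)\<bar> < e" "(z, \<phi> w) \<in> D"
          using PQ[of z "\<phi> w"] d(2)[of z] d(2)[of w] z that by (auto simp: dist_commute)
        then show "((\<lambda>z. G z (\<phi> w)) has_field_derivative E (z, \<phi> w)) (at z within ball x d)"
          using Gx[of z "\<phi> w"] by (auto simp: E_def D_def intro: has_field_derivative_at_within)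
        show "norm (E (z, \<phi> w)) \<le> e" using * by simp
      qed (use that in auto)
      then show ?thesis by simp
    qed
    show "\<exists>d>0. \<forall>y. norm (y - x) < d \<longrightarrow> norm (m y - m x - 0 * (y - x)) \<le> e * norm (y - x)"
    proof (intro exI[of _ d] conjI allI impI)
      fix x' assume "norm (x' - x) < d"
      then have x': "x' \<in> ball x d" "x \<in> ball x d" using d by (auto simp: dist_norm norm_minus_commute)
      have D: "(x', \<phi> x) \<in> D" "(x, \<phi> x') \<in> D"
        using PQ d(2) x' by (auto simp: dist_commute)
      have "G x' (\<phi> x) \<le> m x'" unfolding m_def by (rule peak) (use D in \<open>auto simp: D_def\<close>)
      moreover have "G x (\<phi> x') \<le> m x" unfolding m_def by (rule peak) (use D in \<open>auto simp: D_def\<close>)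
      moreover note bnd[OF x'(1) x'(2) x'(2)] bnd[OF x'(1) x'(2) x'(1)]
      ultimately show "norm (m x' - m x - 0 * (x' - x)) \<le> e * norm (x' - x)"
        unfolding m_def by simp
    qed (use d in auto)
  qed (rule bounded_linear_mult_right)
  have m0: "m x = 0" if "F x = 1" for x
    unfolding m_def touch[OF that] by (simp add: G_def)
  have const: "m x = m x'" for x x'
  proof (cases "\<exists>a. F a = 1")
    case False
    then show ?thesis using DERIV_isconst_all[of m] dm by blast
  next
    case True
    then obtain a0 where a0: "F a0 = 1" by blast
    have "m x = 0" for x
    proof (cases "F x = 1")
      case False
      interpret periodic_fun_simple F "2 * pi" by standard (use Fp in simp)
      \<comment> \<open>The supremum of \<open>S\<close> is the last touching point before
        \<open>x\<close>; periodicity makes \<open>S\<close> nonempty. Between that point and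
        \<open>x\<close> the derivative of \<open>m\<close> is zero, so \<open>m x\<close> inherits
        the value zero.\<close>
      define S where "S = {t. F t = 1} \<inter> {..x}"
      have Scl: "closed S" unfolding S_def
        by (intro closed_Int closed_Collect_eq Fc continuous_intros closed_atMost)
      obtain n :: nat where n: "a0 - x < of_nat n * (2 * pi)"
        using ex_less_of_nat_mult[of "2 * pi" "a0 - x"] by auto
      then have "a0 - of_nat n * (2 * pi) \<in> S" using a0 by (auto simp: S_def minus_of_nat)
      then have ne: "S \<noteq> {}" by auto
      have bd: "bdd_above S" unfolding S_def by auto
      define a where "a = Sup S"
      have aS: "a \<in> S" unfolding a_def by (rule closed_contains_Sup[OF ne bd Scl])
      then have a: "F a = 1" "a < x" using False by (auto simp: S_def order_le_less)
      have "m x = m a"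
      proof (rule DERIV_isconst_end[OF a(2) mc])
        fix t assume t: "a < t" "t < x"
        then have "t \<notin> S" using cSup_upper[OF _ bd, of t] by (auto simp: a_def)
        then have "F t \<noteq> 1" using t by (auto simp: S_def)
        then show "(m has_real_derivative 0) (at t)" by (rule dm)
      qed
      then show ?thesis using m0[OF a(1)] by simp
    qed (rule m0)
    then show ?thesis by simp
  qed
  have "G \<theta> y \<le> m \<theta>" unfolding m_def by (rule peak[OF y])
  also have "m \<theta> = m \<theta>'" by (rule const)
  finally show ?thesis by (simp add: m_def G_def)
qed

section \<open>The billiard map on pairs of consecutive tangent angles, and the gain of
  length\<close>

definition step :: "real \<times> real \<Rightarrow> real \<times> real" where
  "step z = (snd z, nxt (snd z) (cos_in (fst z) (snd z)))"

definition gain :: "real \<Rightarrow> real \<times> real \<Rightarrow> real" where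
  "gain \<epsilon> z = chord (fst z + \<epsilon>) (snd z + \<epsilon>) - chord (fst z) (snd z)"

text \<open>A rotated chord cannot exceed the calibrated maximum attained on the leaf, so each gain
  is at most the increment of \<open>B\<close> between consecutive bounces. The sum telescopes, and
  \<open>B\<close> is bounded because \<open>U\<close> has slope at most \<open>R\<close>.\<close>

lemma leaf_gain_bounded:
  assumes R: "\<And>t. \<rho> t \<le> R" and \<epsilon>: "\<epsilon> > 0"
    and L: "leaf F" and z: "(\<theta>, y) \<in> str" "F \<theta> = cos_out \<theta> y"
  shows "(\<Sum>n<N. gain \<epsilon> ((step ^^ n) (\<theta>, y))) \<le> 2 * (R * \<epsilon>)"
proof -
  define \<phi> where "\<phi> \<theta> = nxt \<theta> (F \<theta>)" for \<theta>
  have Fc: "continuous_on UNIV F" 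
    and Fr: "\<And>\<theta>. F \<theta> \<in> {cos \<delta>2..cos \<delta>1}" and Fi: "\<And>\<theta>. F (\<phi> \<theta>) = cos_in \<theta> (\<phi> \<theta>)"
    using L by (auto simp: leaf_def \<phi>_def)
  have s: "(\<theta>, \<phi> \<theta>) \<in> str" for \<theta> unfolding \<phi>_def using nxt[OF Fr] by auto
  have "\<exists>U. \<forall>x. (U has_real_derivative \<rho> x * F x) (at x)"
    by (rule continuous_has_antiderivative[OF continuous_on_mult[OF \<rho>_cont Fc]]) blast
  then obtain U where U: "\<And>x. (U has_real_derivative \<rho> x * F x) (at x)" by blast
  define B where "B \<theta> = U (\<theta> + \<epsilon>) - U \<theta>" for \<theta>
  have B: "\<bar>B \<theta>\<bar> \<le> R * \<epsilon>" for \<theta>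
  proof -
    obtain \<xi> where "U (\<theta> + \<epsilon>) - U \<theta> = \<epsilon> * (\<rho> \<xi> * F \<xi>)"
      using MVT2[of \<theta> "\<theta> + \<epsilon>" U "\<lambda>x. \<rho> x * F x"] U \<epsilon> by auto
    moreover have "\<bar>F \<xi>\<bar> \<le> 1"
      using Fr[of \<xi>] \<delta> cos_ge_minus_one[of \<delta>2] cos_le_one[of \<delta>1] by (auto simp: abs_le_iff simp del: cos_ge_minus_one cos_le_one)
    then have "\<rho> \<xi> * \<bar>F \<xi>\<bar> \<le> R * 1"
      using R[of \<xi>] \<rho>_pos[of \<xi>] by (intro mult_mono) auto
    ultimately show ?thesis unfolding B_def using \<epsilon> \<rho>_pos[of \<xi>] by (simp add: abs_mult mult.commute)
  qed
  have G: "gain \<epsilon> (\<theta>, \<phi> \<theta>) \<le> B (\<phi> \<theta>) - B \<theta>" for \<theta>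
    using leaf_calibrated[OF L U, of "\<theta> + \<epsilon>" "\<phi> \<theta> + \<epsilon>" \<theta>] s[of \<theta>] \<delta>
    by (auto simp: gain_def B_def str_def \<phi>_def[symmetric])
  have it: "(step ^^ n) (\<theta>, \<phi> \<theta>) = ((\<phi> ^^ n) \<theta>, \<phi> ((\<phi> ^^ n) \<theta>))" for n
    by (induction n) (auto simp: step_def Fi[symmetric] \<phi>_def[symmetric])
  have "y = \<phi> \<theta>" using nxt_eq[OF z(1)] z(2) by (simp add: \<phi>_def)
  then have "(\<Sum>n<N. gain \<epsilon> ((step ^^ n) (\<theta>, y))) \<le> (\<Sum>n<N. B ((\<phi> ^^ Suc n) \<theta>) - B ((\<phi> ^^ n) \<theta>))"
    using it G by (auto intro!: sum_mono)
  also have "\<dots> = B ((\<phi> ^^ N) \<theta>) - B ((\<phi> ^^ 0) \<theta>)" by (rule sum_lessThan_telescope)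
  also have "\<dots> \<le> 2 * (R * \<epsilon>)" using B[of "(\<phi> ^^ N) \<theta>"] B[of \<theta>] by simp
  finally show ?thesis .
qed

subsection \<open>The invariant measure\<close>

text \<open>Continuous observables on the quotient of the strip by the translation
  \<open>(2 * pi, 2 * pi)\<close>; values off \<open>str\<close> are left free.\<close>

definition adm :: "(real \<times> real \<Rightarrow> real) \<Rightarrow> bool" where
  "adm \<Phi> \<longleftrightarrow> continuous_on str \<Phi> \<and> (\<forall>\<theta> y. (\<theta>, y) \<in> str \<longrightarrow> \<Phi> (\<theta> + 2 * pi, y + 2 * pi) = \<Phi> (\<theta>, y))"

definition rect :: "(real \<times> real) set" where
  "rect = cbox (\<delta>1, 0) (\<delta>2, 2 * pi)"

text \<open>Integration against the invariant measure in the coordinates \<open>s = (\<theta> + y)/2\<close>, \<open>v = (y - \<theta>)/2\<close>,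
  whence the Jacobian factor 2.\<close>

definition J :: "(real \<times> real \<Rightarrow> real) \<Rightarrow> real" where
  "J \<Phi> = integral rect (\<lambda>(v, s). 2 * \<Phi> (s - v, s + v) * dens (s - v) (s + v))"

lemma strip_point: "v \<in> {\<delta>1..\<delta>2} \<Longrightarrow> (s - v, s + v) \<in> str"
  by (auto simp: str_def)

lemma J_integrand_cont:
  assumes "adm \<Phi>"
  shows "continuous_on ({\<delta>1..\<delta>2} \<times> UNIV) (\<lambda>(v, s). 2 * \<Phi> (s - v, s + v) * dens (s - v) (s + v))"
proof -
  have "continuous_on ({\<delta>1..\<delta>2} \<times> UNIV) (\<lambda>z. \<Phi> (snd z - fst z, snd z + fst z))"
    by (rule continuous_on_compose2[of str \<Phi>])
      (use assms strip_point in \<open>auto simp: adm_def intro!: continuous_intros\<close>)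
  moreover have "continuous_on ({\<delta>1..\<delta>2} \<times> UNIV) (\<lambda>z. dens (snd z - fst z) (snd z + fst z))"
    by (rule compose_cont[OF continuous_on_subset[OF dens_cont str_wedge]])
      (auto intro!: continuous_intros simp: strip_point)
  ultimately show ?thesis
    unfolding split_beta by (intro continuous_intros)
qed

lemma rect_eq: "rect = {\<delta>1..\<delta>2} \<times> {0..2 * pi}"
  by (simp add: rect_def cbox_Pair_eq)

lemma J_integrand_integrable:
  assumes "adm \<Phi>"
  shows "(\<lambda>(v, s). 2 * \<Phi> (s - v, s + v) * dens (s - v) (s + v)) integrable_on rect"
  unfolding rect_def
  by (rule integrable_continuous, rule continuous_on_subset[OF J_integrand_cont[OF assms]])
    (auto simp: cbox_Pair_eq)

lemma adm_lincomb:
  assumes "adm \<Phi>" "adm \<Psi>"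
  shows "adm (\<lambda>z. a * \<Phi> z + b * \<Psi> z)"
  using assms by (auto simp: adm_def intro!: continuous_intros)

lemma J_lincomb:
  assumes "adm \<Phi>" "adm \<Psi>"
  shows "J (\<lambda>z. a * \<Phi> z + b * \<Psi> z) = a * J \<Phi> + b * J \<Psi>"
proof -
  let ?f = "\<lambda>\<Phi>. (\<lambda>(v, s). 2 * \<Phi> (s - v, s + v) * dens (s - v) (s + v))"
  have "((\<lambda>x. a * ?f \<Phi> x + b * ?f \<Psi> x) has_integral a * J \<Phi> + b * J \<Psi>) rect"
    unfolding J_def
    by (intro has_integral_add has_integral_mult_right integrable_integral J_integrand_integrable assms)
  moreover have "(\<lambda>x. a * ?f \<Phi> x + b * ?f \<Psi> x) = ?f (\<lambda>z. a * \<Phi> z + b * \<Psi> z)"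
    by (auto simp: fun_eq_iff algebra_simps)
  ultimately show ?thesis unfolding J_def[of "\<lambda>z. a * \<Phi> z + b * \<Psi> z"] by (simp add: integral_unique)
qed

lemma J_mono_rect:
  assumes "adm \<Phi>" "adm \<Psi>"
    "\<And>v s. v \<in> {\<delta>1..\<delta>2} \<Longrightarrow> s \<in> {0..2*pi} \<Longrightarrow> \<Phi> (s - v, s + v) \<le> \<Psi> (s - v, s + v)"
  shows "J \<Phi> \<le> J \<Psi>"
  unfolding J_def
proof (rule integral_le[OF J_integrand_integrable[OF assms(1)] J_integrand_integrable[OF assms(2)]])
  fix x assume x: "x \<in> rect"
  obtain v s where vs: "x = (v, s)" by (cases x)
  then have "(s - v, s + v) \<in> str" "\<Phi> (s - v, s + v) \<le> \<Psi> (s - v, s + v)"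
    using x strip_point assms(3) by (auto simp: rect_eq)
  then show "(case x of (v, s) \<Rightarrow> 2 * \<Phi> (s - v, s + v) * dens (s - v) (s + v))
        \<le> (case x of (v, s) \<Rightarrow> 2 * \<Psi> (s - v, s + v) * dens (s - v) (s + v))"
    using dens_nonneg[of "s - v" "s + v"] str_wedge
    unfolding vs by (auto simp: wedge_def intro!: mult_right_mono)
qed

lemma J_mono:
  assumes "adm \<Phi>" "adm \<Psi>" "\<And>z. z \<in> str \<Longrightarrow> \<Phi> z \<le> \<Psi> z"
  shows "J \<Phi> \<le> J \<Psi>"
  using assms strip_point by (intro J_mono_rect) auto

text \<open>A shear of the cylinder. With \<open>k = 1\<close> the outer variable is the departure
  angle \<open>s - v\<close>, with \<open>k = -1\<close> the arrival angle \<open>s + v\<close>, so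
  the inner integral runs over chords sharing one endpoint.\<close>

lemma J_shift:
  assumes "adm \<Phi>"
  shows "J \<Phi> = integral {0..2*pi} (\<lambda>x. integral {\<delta>1..\<delta>2} (\<lambda>v. 2 * \<Phi> (x + k * v - v, x + k * v + v) *
            dens (x + k * v - v) (x + k * v + v)))"
proof -
  define f where "f v s = 2 * \<Phi> (s - v, s + v) * dens (s - v) (s + v)" for v s
  have fc: "continuous_on ({\<delta>1..\<delta>2} \<times> UNIV) (\<lambda>z. f (fst z) (snd z))"
    using J_integrand_cont[OF assms] by (simp add: f_def split_beta)
  have "J \<Phi> = integral (cbox \<delta>1 \<delta>2) (\<lambda>v. integral (cbox 0 (2*pi)) (f v))"
    unfolding J_def rect_def
    by (subst integral_prod_continuous)
      (auto simp: f_def[abs_def] cbox_Pair_eq intro!: continuous_on_subset[OF J_integrand_cont[OF assms]])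
  also have "\<dots> = integral (cbox \<delta>1 \<delta>2) (\<lambda>v. integral (cbox 0 (2*pi)) (\<lambda>s. f v (s + k * v)))"
  proof (rule integral_cong)
    fix v assume v: "v \<in> cbox \<delta>1 \<delta>2"
    have "integral {0..2*pi} (\<lambda>s. f v (s + k * v)) = integral {0..2*pi} (f v)"
    proof (rule integral_periodic_shift)
      show "continuous_on UNIV (f v)"
        by (rule compose_cont[OF fc, of UNIV "\<lambda>_. v" "\<lambda>s. s"]) (use v in auto)
      show "f v (s + 2 * pi) = f v s" for s
      proof -
        have "\<Phi> ((s - v) + 2 * pi, (s + v) + 2 * pi) = \<Phi> (s - v, s + v)"
          using assms strip_point[of v s] v by (auto simp: adm_def)
        then show ?thesis using dens_periodic[of "s - v" "s + v"]
          by (simp add: f_def algebra_simps)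
      qed
    qed simp
    then show "integral (cbox 0 (2*pi)) (f v) = integral (cbox 0 (2*pi)) (\<lambda>s. f v (s + k * v))" by simp
  qed
  also have "\<dots> = integral (cbox 0 (2*pi)) (\<lambda>s. integral (cbox \<delta>1 \<delta>2) (\<lambda>v. f v (s + k * v)))"
    by (rule integral_swap_continuous[where f = "\<lambda>v s. f v (s + k * v)"], unfold split_beta,
        rule compose_cont[OF fc]) (auto simp: cbox_Pair_eq intro!: continuous_intros)
  finally show ?thesis by (simp add: f_def)
qed

text \<open>The classical billiard measure: arc length \<open>\<rho> d\<theta>\<close> times the
  differential of the cosine.\<close>

definition I :: "(real \<times> real \<Rightarrow> real) \<Rightarrow> real" where
  "I g = integral {0..2*pi} (\<lambda>\<theta>. \<rho> \<theta> * integral {cos \<delta>2..cos \<delta>1} (\<lambda>p. g (\<theta>, p)))"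

definition adm_phase :: "(real \<times> real \<Rightarrow> real) \<Rightarrow> bool" where
  "adm_phase g \<longleftrightarrow> continuous_on phase g \<and> (\<forall>\<theta> p. p \<in> {cos \<delta>2..cos \<delta>1} \<longrightarrow> g (\<theta> + 2 * pi, p) = g (\<theta>, p))"

lemma str_cont:
  "continuous_on str (\<lambda>z. cos_out (fst z) (snd z))" "continuous_on str (\<lambda>z. cos_in (fst z) (snd z))"
  "continuous_on str (\<lambda>z. sin_out (fst z) (snd z))" "continuous_on str (\<lambda>z. sin_in (fst z) (snd z))"
  by (intro angle_cont[THEN continuous_on_subset] str_wedge)+

lemma adm_out:
  assumes "adm_phase g"
  shows "adm (\<lambda>z. g (fst z, cos_out (fst z) (snd z)))"
proof -
  have "continuous_on str (\<lambda>z. g (fst z, cos_out (fst z) (snd z)))"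
    by (rule continuous_on_compose2[of phase g])
      (use assms cos_out_range in \<open>auto simp: adm_phase_def phase_def intro!: continuous_intros str_cont\<close>)
  then show ?thesis using assms cos_out_range by (auto simp: adm_def adm_phase_def angle_periodic)
qed

lemma adm_in:
  assumes "adm_phase g"
  shows "adm (\<lambda>z. g (snd z, cos_in (fst z) (snd z)))"
proof -
  have "continuous_on str (\<lambda>z. g (snd z, cos_in (fst z) (snd z)))"
    by (rule continuous_on_compose2[of phase g])
      (use assms cos_in_range in \<open>auto simp: adm_phase_def phase_def intro!: continuous_intros str_cont\<close>)
  then show ?thesis using assms cos_in_range by (auto simp: adm_def adm_phase_def angle_periodic)
qed

lemma phase_section_cont:
  assumes "adm_phase g"
  shows "continuous_on {cos \<delta>2..cos \<delta>1} (\<lambda>p. g (\<theta>, p))"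
  by (rule continuous_on_compose2[of phase g])
    (use assms in \<open>auto simp: adm_phase_def phase_def intro!: continuous_intros\<close>)

lemma cos_substitution:
  assumes g: "adm_phase g" and r: "r > 0" and c: "continuous_on {\<delta>1..\<delta>2} c" "c \<delta>1 = cos \<delta>1" "c \<delta>2 = cos \<delta>2"
    and c': "\<And>v. v \<in> {\<delta>1..\<delta>2} \<Longrightarrow> c v \<in> {cos \<delta>2..cos \<delta>1}"
      "\<And>v. v \<in> {\<delta>1..\<delta>2} \<Longrightarrow> v \<noteq> 0 \<Longrightarrow> (c has_real_derivative - (2 * w v / r)) (at v)"
  shows "integral {\<delta>1..\<delta>2} (\<lambda>v. 2 * g (t, c v) * w v) = r * integral {cos \<delta>2..cos \<delta>1} (\<lambda>p. g (t, p))"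
proof -
  have "((\<lambda>v. - (2 * w v / r) *\<^sub>R g (t, c v)) has_integral
      (integral {c \<delta>1..c \<delta>2} (\<lambda>p. g (t, p)) - integral {c \<delta>2..c \<delta>1} (\<lambda>p. g (t, p)))) {\<delta>1..\<delta>2}"
  proof (rule has_integral_substitution_general)
    \<comment> \<open>At \<open>v = 0\<close> the chord has length zero and the formula for the
      derivative of the cosine does not apply, so this point is exceptional.\<close>
    show "finite {0::real}" by simp
    show "\<delta>1 \<le> \<delta>2" using \<delta> by simp
    show "c ` {\<delta>1..\<delta>2} \<subseteq> {cos \<delta>2..cos \<delta>1}" using c'(1) by blast
    show "continuous_on {cos \<delta>2..cos \<delta>1} (\<lambda>p. g (t, p))" by (rule phase_section_cont[OF g])
    show "continuous_on {\<delta>1..\<delta>2} c" by (rule c(1))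
    fix v assume v: "v \<in> {\<delta>1..\<delta>2} - {0}"
    show "(c has_real_derivative - (2 * w v / r)) (at v within {\<delta>1..\<delta>2})"
      by (rule has_field_derivative_at_within, rule c'(2)) (use v in auto)
  qed
  then have "((\<lambda>v. - (2 * w v / r) * g (t, c v)) has_integral - integral {cos \<delta>2..cos \<delta>1} (\<lambda>p. g (t, p))) {\<delta>1..\<delta>2}"
    unfolding c using cos_less by simp
  from has_integral_mult_right[OF this, of "- r"]
  have "((\<lambda>v. 2 * g (t, c v) * w v) has_integral r * integral {cos \<delta>2..cos \<delta>1} (\<lambda>p. g (t, p))) {\<delta>1..\<delta>2}"
    using r by (simp add: mult_ac)
  then show ?thesis by (rule integral_unique)
qed

text \<open>With the departure point fixed, the outgoing cosine has derivative
  \<open>- 2 * dens / \<rho>\<close> in \<open>v\<close>; the density is exactly the Jacobian that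
  turns \<open>J\<close> into \<open>I\<close>.\<close>

lemma J_out:
  assumes "adm_phase g"
  shows "J (\<lambda>z. g (fst z, cos_out (fst z) (snd z))) = I g"
proof -
  have "integral {\<delta>1..\<delta>2} (\<lambda>v. 2 * g (\<theta>, cos_out \<theta> (\<theta> + 2 * v)) * dens \<theta> (\<theta> + 2 * v))
     = \<rho> \<theta> * integral {cos \<delta>2..cos \<delta>1} (\<lambda>p. g (\<theta>, p))" for \<theta>
  proof (rule cos_substitution[OF assms \<rho>_pos])
    have st: "(\<theta>, \<theta> + 2 * v) \<in> str" if "v \<in> {\<delta>1..\<delta>2}" for v using that by (auto simp: str_def)
    show "continuous_on {\<delta>1..\<delta>2} (\<lambda>v. cos_out \<theta> (\<theta> + 2 * v))"
      by (rule compose_cont[OF str_cont(1)]) (auto intro!: continuous_intros st)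
    fix v assume v: "v \<in> {\<delta>1..\<delta>2}"
    show "cos_out \<theta> (\<theta> + 2 * v) \<in> {cos \<delta>2..cos \<delta>1}" by (rule cos_out_range[OF st[OF v]])
    assume "v \<noteq> 0"
    then have "\<theta> < \<theta> + 2 * v" "\<theta> + 2 * v < \<theta> + 2 * pi" using v \<delta> by auto
    moreover have "((\<lambda>v. \<theta> + 2 * v) has_real_derivative 2) (at v)"
      by (auto intro!: derivative_eq_intros)
    ultimately show "((\<lambda>v. cos_out \<theta> (\<theta> + 2 * v)) has_real_derivative - (2 * dens \<theta> (\<theta> + 2 * v) / \<rho> \<theta>)) (at v)"
      using cos_deriv(1)[of "\<lambda>_. \<theta>" 0 v "\<lambda>v. \<theta> + 2 * v" 2] \<rho>_pos[of \<theta>] by (simp add: dens_def mult_ac)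
  qed (use level1 level2 in auto)
  then show ?thesis
    unfolding J_shift[OF adm_out[OF assms], of 1] I_def by (simp add: add.assoc)
qed

lemma J_in:
  assumes "adm_phase g"
  shows "J (\<lambda>z. g (snd z, cos_in (fst z) (snd z))) = I g"
proof -
  have "integral {\<delta>1..\<delta>2} (\<lambda>v. 2 * g (y, cos_in (y - 2 * v) y) * dens (y - 2 * v) y)
     = \<rho> y * integral {cos \<delta>2..cos \<delta>1} (\<lambda>p. g (y, p))" for y
  proof (rule cos_substitution[OF assms \<rho>_pos])
    have st: "(y - 2 * v, y) \<in> str" if "v \<in> {\<delta>1..\<delta>2}" for v using that by (auto simp: str_def)
    show "continuous_on {\<delta>1..\<delta>2} (\<lambda>v. cos_in (y - 2 * v) y)"
      by (rule compose_cont[OF str_cont(2)]) (auto intro!: continuous_intros st)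
    fix v assume v: "v \<in> {\<delta>1..\<delta>2}"
    show "cos_in (y - 2 * v) y \<in> {cos \<delta>2..cos \<delta>1}" by (rule cos_in_range[OF st[OF v]])
    assume "v \<noteq> 0"
    then have "y - 2 * v < y" "y < y - 2 * v + 2 * pi" using v \<delta> by auto
    moreover have "((\<lambda>v. y - 2 * v) has_real_derivative - 2) (at v)"
      by (auto intro!: derivative_eq_intros)
    ultimately show "((\<lambda>v. cos_in (y - 2 * v) y) has_real_derivative - (2 * dens (y - 2 * v) y / \<rho> y)) (at v)"
      using cos_deriv(2)[of "\<lambda>v. y - 2 * v" "- 2" v "\<lambda>_. y" 0] \<rho>_pos[of y] by (simp add: dens_def mult_ac)
  qed (use level1(2)[of "y - 2 * \<delta>1"] level2(2)[of "y - 2 * \<delta>2"] in auto)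
  then show ?thesis
    unfolding J_shift[OF adm_in[OF assms], of "-1"] I_def by simp
qed

lemma step_str: "z \<in> str \<Longrightarrow> step z \<in> str"
  unfolding step_def using nxt(1)[OF cos_in_range[of "fst z" "snd z"]] by simp

lemma step_cont: "continuous_on str step"
  unfolding step_def
  by (intro continuous_intros compose_cont[OF nxt_cont] str_cont)
    (use cos_in_range in \<open>auto simp: phase_def\<close>)

lemma step_periodic:
  "z \<in> str \<Longrightarrow> step (fst z + 2 * pi, snd z + 2 * pi) = (fst (step z) + 2 * pi, snd (step z) + 2 * pi)"
  using nxt_periodic[OF cos_in_range[of "fst z" "snd z"]] by (simp add: step_def angle_periodic)

lemma adm_step:
  assumes "adm \<Phi>"
  shows "adm (\<lambda>z. \<Phi> (step z))"
  unfolding adm_def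
proof (intro conjI allI impI)
  show "continuous_on str (\<lambda>z. \<Phi> (step z))"
    by (rule continuous_on_compose2[OF _ step_cont, of str \<Phi>]) (use assms step_str in \<open>auto simp: adm_def\<close>)
  fix \<theta> y assume z: "(\<theta>, y) \<in> str"
  then show "\<Phi> (step (\<theta> + 2 * pi, y + 2 * pi)) = \<Phi> (step (\<theta>, y))"
    using step_periodic[OF z] step_str[OF z] assms by (auto simp: adm_def)
qed

text \<open>Invariance of the measure. \<open>\<Phi>\<close> after \<open>step\<close> is the same
  function \<open>g\<close> of the arrival data as \<open>\<Phi>\<close> itself is of the departure
  data, and both integrals equal \<open>I g\<close>.\<close>

lemma J_step:
  assumes "adm \<Phi>"
  shows "J (\<lambda>z. \<Phi> (step z)) = J \<Phi>"
proof -
  define g where "g w = \<Phi> (fst w, nxt (fst w) (snd w))" for w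
  have g: "adm_phase g"
    unfolding adm_phase_def
  proof (intro conjI allI impI)
    show "continuous_on phase g" unfolding g_def
      by (rule continuous_on_compose2[of str \<Phi>])
        (use assms nxt in \<open>auto simp: adm_def phase_def intro!: continuous_intros nxt_cont[unfolded phase_def]\<close>)
    fix \<theta> p assume p: "p \<in> {cos \<delta>2..cos \<delta>1}"
    then show "g (\<theta> + 2 * pi, p) = g (\<theta>, p)"
      using nxt(1)[OF p] nxt_periodic[OF p] assms by (auto simp: g_def adm_def)
  qed
  have cong: "J \<Phi> = J \<Psi>" if "adm \<Phi>" "adm \<Psi>" "\<And>z. z \<in> str \<Longrightarrow> \<Phi> z = \<Psi> z" for \<Phi> \<Psi>
    using J_mono[of \<Phi> \<Psi>] J_mono[of \<Psi> \<Phi>] that by force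
  have "J (\<lambda>z. \<Phi> (step z)) = J (\<lambda>z. g (snd z, cos_in (fst z) (snd z)))"
    by (rule cong[OF adm_step[OF assms] adm_in[OF g]]) (simp add: g_def step_def)
  also have "\<dots> = J (\<lambda>z. g (fst z, cos_out (fst z) (snd z)))" using J_in[OF g] J_out[OF g] by simp
  also have "\<dots> = J \<Phi>"
    by (rule cong[OF adm_out[OF g] assms]) (auto simp: g_def nxt_eq)
  finally show ?thesis .
qed

lemma adm_const: "adm (\<lambda>z. c)"
  by (simp add: adm_def)

lemma J_cmult: "adm \<Phi> \<Longrightarrow> J (\<lambda>z. a * \<Phi> z) = a * J \<Phi>"
  using J_lincomb[OF _ adm_const, of \<Phi> a 0 0] by simp

lemma adm_add: "adm \<Phi> \<Longrightarrow> adm \<Psi> \<Longrightarrow> adm (\<lambda>z. \<Phi> z + \<Psi> z)"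
  using adm_lincomb[of \<Phi> \<Psi> 1 1] by simp

lemma J_add: "adm \<Phi> \<Longrightarrow> adm \<Psi> \<Longrightarrow> J (\<lambda>z. \<Phi> z + \<Psi> z) = J \<Phi> + J \<Psi>"
  using J_lincomb[of \<Phi> \<Psi> 1 1] by simp

lemma birkhoff_sum:
  assumes "adm \<Phi>"
  shows "adm (\<lambda>z. \<Sum>n<N. \<Phi> ((step ^^ n) z)) \<and> J (\<lambda>z. \<Sum>n<N. \<Phi> ((step ^^ n) z)) = of_nat N * J \<Phi>"
proof (induction N)
  case 0
  then show ?case using J_cmult[OF adm_const, of 0 0] by (simp add: adm_const)
next
  case (Suc N)
  have "adm (\<lambda>z. \<Phi> ((step ^^ n) z)) \<and> J (\<lambda>z. \<Phi> ((step ^^ n) z)) = J \<Phi>" for n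
  proof (induction n)
    case (Suc n)
    then show ?case using adm_step[of "\<lambda>z. \<Phi> ((step ^^ n) z)"] J_step[of "\<lambda>z. \<Phi> ((step ^^ n) z)"]
      by (simp only: funpow_Suc_right o_apply)
  qed (use assms in simp)
  then show ?case using Suc adm_add J_add by (simp add: algebra_simps)
qed

lemma gain_adm: "adm (gain \<epsilon>)"
proof -
  have "continuous_on str (gain \<epsilon>)" unfolding gain_def
    by (intro continuous_intros compose_cont[OF chord_cont[of UNIV]]) auto
  moreover have "gain \<epsilon> (\<theta> + 2 * pi, y + 2 * pi) = gain \<epsilon> (\<theta>, y)" for \<theta> y
    using chord_periodic[of \<theta> y] chord_periodic[of "\<theta> + \<epsilon>" "y + \<epsilon>"]
    by (simp add: gain_def algebra_simps)
  ultimately show ?thesis by (simp add: adm_def)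
qed

text \<open>Invariance makes the integral of an \<open>N\<close>-step sum \<open>N\<close> times
  that of a single gain, while the pointwise bound does not depend on \<open>N\<close>.\<close>

lemma gain_integral_nonpos:
  assumes fol: "\<And>\<theta> y. (\<theta>, y) \<in> str \<Longrightarrow> \<exists>F. leaf F \<and> F \<theta> = cos_out \<theta> y" and \<epsilon>: "\<epsilon> > 0"
  shows "J (gain \<epsilon>) \<le> 0"
proof (rule ccontr)
  assume "\<not> J (gain \<epsilon>) \<le> 0"
  then have pos: "J (gain \<epsilon>) > 0" by simp
  obtain R where R: "R > 0" "\<And>t. \<bar>\<rho> t\<bar> \<le> R"
    using periodic_bounded[OF \<rho>_cont \<rho>_periodic] by blast
  then have R': "\<rho> t \<le> R" for t by (meson abs_le_D1)
  define C where "C = J (\<lambda>_. 2 * (R * \<epsilon>))"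
  have "of_nat N * J (gain \<epsilon>) \<le> C" for N
  proof -
    have "of_nat N * J (gain \<epsilon>) = J (\<lambda>z. \<Sum>n<N. gain \<epsilon> ((step ^^ n) z))"
      using birkhoff_sum[OF gain_adm] by simp
    also have "\<dots> \<le> C" unfolding C_def
    proof (rule J_mono[OF conjunct1[OF birkhoff_sum[OF gain_adm]] adm_const])
      fix z assume "z \<in> str"
      then show "(\<Sum>n<N. gain \<epsilon> ((step ^^ n) z)) \<le> 2 * (R * \<epsilon>)"
        using fol[of "fst z" "snd z"] leaf_gain_bounded[OF R' \<epsilon>, of _ "fst z" "snd z" N] by auto
    qed
    finally show ?thesis .
  qed
  moreover obtain N :: nat where "C < of_nat N * J (gain \<epsilon>)"
    using ex_less_of_nat_mult[OF pos] by blast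
  ultimately show False by (meson not_less)
qed

subsection \<open>The Hopf inequality\<close>

definition drift :: "real \<times> real \<Rightarrow> real" where
  "drift z = \<rho> (snd z) * cos_in (fst z) (snd z) - \<rho> (fst z) * cos_out (fst z) (snd z)"

text \<open>Divided by the chord length, this is the angular velocity of the chord when both tangent
  angles advance at unit speed.\<close>

definition width :: "real \<times> real \<Rightarrow> real" where
  "width z = \<rho> (snd z) * sin_in (fst z) (snd z) + \<rho> (fst z) * sin_out (fst z) (snd z)"

definition curv :: "real \<times> real \<Rightarrow> real" where
  "curv z = (\<rho>' (snd z) * cos_in (fst z) (snd z) - \<rho>' (fst z) * cos_out (fst z) (snd z))
     + (width z - chord (fst z) (snd z))"

lemma adm_chord: "adm (\<lambda>z. chord (fst z) (snd z))"
  by (auto simp: adm_def chord_cont chord_periodic)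

lemma adm_width: "adm width"
  unfolding adm_def width_def
  by (auto simp: angle_periodic \<rho>_periodic intro!: continuous_intros str_cont \<rho>_compose_cont)

lemma adm_phase_mult_cos:
  assumes "continuous_on UNIV f" "\<And>t. f (t + 2 * pi) = f t"
  shows "adm_phase (\<lambda>w. f (fst w) * snd w)"
  unfolding adm_phase_def
  by (auto simp: assms(2) intro!: continuous_intros continuous_on_compose2[OF assms(1)])

lemma adm_phase_mult_sin: "adm_phase (\<lambda>w. \<rho> (fst w) * sqrt (1 - (snd w)\<^sup>2))"
  unfolding adm_phase_def
  by (auto simp: \<rho>_periodic intro!: continuous_intros \<rho>_compose_cont)

text \<open>Both terms are the phase function \<open>f * p\<close>, read off at arrival and at
  departure; \<open>J_in\<close> and \<open>J_out\<close> give them the same integral.\<close>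

lemma coboundary:
  assumes "continuous_on UNIV f" "\<And>t. f (t + 2 * pi) = f t"
  shows "adm (\<lambda>z. f (snd z) * cos_in (fst z) (snd z) - f (fst z) * cos_out (fst z) (snd z))"
    and "J (\<lambda>z. f (snd z) * cos_in (fst z) (snd z) - f (fst z) * cos_out (fst z) (snd z)) = 0"
  using adm_lincomb[OF adm_in[OF adm_phase_mult_cos[OF assms]] adm_out[OF adm_phase_mult_cos[OF assms]], of 1 "-1"]
    J_lincomb[OF adm_in[OF adm_phase_mult_cos[OF assms]] adm_out[OF adm_phase_mult_cos[OF assms]], of 1 "-1"]
    J_in[OF adm_phase_mult_cos[OF assms]] J_out[OF adm_phase_mult_cos[OF assms]]
  by simp_all

lemma sin_sqrt:
  assumes "z \<in> str"
  shows "sin_out (fst z) (snd z) = sqrt (1 - (cos_out (fst z) (snd z))\<^sup>2)"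
    "sin_in (fst z) (snd z) = sqrt (1 - (cos_in (fst z) (snd z))\<^sup>2)"
proof -
  have z: "fst z \<le> snd z" "snd z < fst z + 2 * pi" using assms str_wedge by (auto simp: wedge_def)
  show "sin_out (fst z) (snd z) = sqrt (1 - (cos_out (fst z) (snd z))\<^sup>2)"
    using cos_sin_out[OF z] sin_nonneg[OF z] by (intro real_sqrt_unique[symmetric]) auto
  show "sin_in (fst z) (snd z) = sqrt (1 - (cos_in (fst z) (snd z))\<^sup>2)"
    using cos_sin_in[OF z] sin_nonneg[OF z] by (intro real_sqrt_unique[symmetric]) auto
qed

text \<open>On the strip each sine is the nonnegative root of one minus the squared cosine, hence a
  phase function. Departure and arrival contribute equally, whence the factor 2.\<close>

lemma J_width: "J width = 2 * I (\<lambda>w. \<rho> (fst w) * sqrt (1 - (snd w)\<^sup>2))"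
proof -
  define g where "g w = \<rho> (fst w) * sqrt (1 - (snd w)\<^sup>2)" for w
  have g: "adm_phase g" unfolding g_def by (rule adm_phase_mult_sin)
  have "J width = J (\<lambda>z. g (fst z, cos_out (fst z) (snd z)) + g (snd z, cos_in (fst z) (snd z)))"
    by (intro order.antisym J_mono adm_width adm_add adm_out adm_in g) (auto simp: width_def g_def sin_sqrt)
  also have "\<dots> = 2 * I g"
    unfolding J_add[OF adm_out[OF g] adm_in[OF g]] J_in[OF g] J_out[OF g] by simp
  finally show ?thesis by (simp add: g_def[abs_def])
qed

lemma curv_adm_J:
  "adm curv" "J curv = J width - J (\<lambda>z. chord (fst z) (snd z))"
proof -
  note w = adm_lincomb[OF adm_width adm_chord, of 1 "-1", simplified]
  note c = coboundary[OF \<rho>'_cont \<rho>'_periodic]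
  show "adm curv" unfolding curv_def using adm_add[OF c(1) w] by simp
  show "J curv = J width - J (\<lambda>z. chord (fst z) (snd z))"
    unfolding curv_def using J_add[OF c(1) w] c(2) J_lincomb[OF adm_width adm_chord, of 1 "-1"] by simp
qed

text \<open>Second-order expansion of the chord length under rotation of both tangent angles. The exact
  second derivative is \<open>curv + (width - chord)\<^sup>2 / chord\<close>.\<close>

lemma gain_lower:
  assumes z: "\<theta> < y" "y < \<theta> + 2 * pi" and \<epsilon>: "\<epsilon> > 0"
  obtains t where "0 < t" "t < \<epsilon>" "gain \<epsilon> (\<theta>, y) \<ge> \<epsilon> * drift (\<theta>, y) + \<epsilon>\<^sup>2 / 2 * curv (\<theta> + t, y + t)"
proof -
  define D where "D t = curv (\<theta> + t, y + t)
     + (width (\<theta> + t, y + t) - chord (\<theta> + t) (y + t))\<^sup>2 / chord (\<theta> + t) (y + t)" for t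
  define diff where "diff n = (if n = 0 then \<lambda>t. chord (\<theta> + t) (y + t) else
     if n = 1 then \<lambda>t. drift (\<theta> + t, y + t) else D)" for n :: nat
  have zt: "\<theta> + t < y + t" "y + t < \<theta> + t + 2 * pi" for t using z by auto
  have sh: "((\<lambda>t. a + t) has_real_derivative 1) (at t)" for a t :: real
    by (auto intro!: derivative_eq_intros)
  have d1: "((\<lambda>t. chord (\<theta> + t) (y + t)) has_real_derivative drift (\<theta> + t, y + t)) (at t)" for t
    using chord_deriv(1)[of "\<lambda>t. \<theta> + t" 1 t "\<lambda>t. y + t" 1] sh z by (simp add: drift_def)
  have d2: "((\<lambda>t. drift (\<theta> + t, y + t)) has_real_derivative D t) (at t)" for t
  proof -
    define H u where "H = chord (\<theta> + t) (y + t)" and "u = width (\<theta> + t, y + t)"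
    have H: "H > 0" unfolding H_def by (rule chord_pos[OF zt])
    have c: "((\<lambda>t. cos_out (\<theta> + t) (y + t)) has_real_derivative - sin_out (\<theta> + t) (y + t) * (u / H - 1)) (at t)"
      "((\<lambda>t. cos_in (\<theta> + t) (y + t)) has_real_derivative sin_in (\<theta> + t) (y + t) * (u / H - 1)) (at t)"
      using cos_deriv[of "\<lambda>t. \<theta> + t" 1 t "\<lambda>t. y + t" 1] sh z by (simp_all add: u_def H_def width_def)
    have r: "((\<lambda>t. \<rho> (a + t)) has_real_derivative \<rho>' (a + t)) (at t)" for a
      using DERIV_chain2[OF \<rho>_deriv sh] by simp
    have "((\<lambda>t. drift (\<theta> + t, y + t)) has_real_derivative
       \<rho>' (y + t) * cos_in (\<theta> + t) (y + t) + \<rho> (y + t) * (sin_in (\<theta> + t) (y + t) * (u / H - 1))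
       - (\<rho>' (\<theta> + t) * cos_out (\<theta> + t) (y + t) + \<rho> (\<theta> + t) * (- sin_out (\<theta> + t) (y + t) * (u / H - 1)))) (at t)"
      using DERIV_diff[OF DERIV_mult'[OF r[of y] c(2)] DERIV_mult'[OF r[of \<theta>] c(1)]]
      unfolding drift_def by (simp add: algebra_simps)
    moreover have "\<rho>' (y + t) * cos_in (\<theta> + t) (y + t) + \<rho> (y + t) * (sin_in (\<theta> + t) (y + t) * (u / H - 1))
       - (\<rho>' (\<theta> + t) * cos_out (\<theta> + t) (y + t) + \<rho> (\<theta> + t) * (- sin_out (\<theta> + t) (y + t) * (u / H - 1)))
      = (\<rho>' (y + t) * cos_in (\<theta> + t) (y + t) - \<rho>' (\<theta> + t) * cos_out (\<theta> + t) (y + t)) + u * (u / H - 1)"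
    proof -
      have "X + a * (b * k) - (Y + c * (- d * k)) = (X - Y) + (a * b + c * d) * k" for X Y a b c d k :: real
        by (simp add: algebra_simps)
      then show ?thesis by (simp add: u_def width_def)
    qed
    \<comment> \<open>This isolates a nonnegative square, the only term with \<open>H\<close> in the
      denominator, from a part that can be integrated.\<close>
    moreover have "u * (u / H - 1) = (u - H) + (u - H)\<^sup>2 / H"
      using H by (simp add: field_simps power2_eq_square)
    moreover have "D t = (\<rho>' (y + t) * cos_in (\<theta> + t) (y + t) - \<rho>' (\<theta> + t) * cos_out (\<theta> + t) (y + t))
        + ((u - H) + (u - H)\<^sup>2 / H)"
      by (simp add: D_def curv_def H_def u_def)
    ultimately show ?thesis by (simp only:)
  qed
  have "\<exists>t>0. t < \<epsilon> \<and> chord (\<theta> + \<epsilon>) (y + \<epsilon>) = (\<Sum>m<2. diff m 0 / fact m * \<epsilon> ^ m) + diff 2 t / fact 2 * \<epsilon> ^ 2"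
    by (rule Maclaurin[where f = "\<lambda>t. chord (\<theta> + t) (y + t)" and diff = diff and n = 2])
      (use \<epsilon> d1 d2 in \<open>auto simp: diff_def less_2_cases_iff\<close>)
  then obtain t where t: "0 < t" "t < \<epsilon>"
    "chord (\<theta> + \<epsilon>) (y + \<epsilon>) = chord \<theta> y + drift (\<theta>, y) * \<epsilon> + D t / 2 * \<epsilon>\<^sup>2"
    by (auto simp: diff_def numeral_2_eq_2)
  have "D t \<ge> curv (\<theta> + t, y + t)" unfolding D_def by simp
  then have "D t / 2 * \<epsilon>\<^sup>2 \<ge> \<epsilon>\<^sup>2 / 2 * curv (\<theta> + t, y + t)"
    using mult_right_mono[of "curv (\<theta> + t, y + t)" "D t" "\<epsilon>\<^sup>2 / 2"] by (simp add: mult.commute)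
  then show thesis using t that[of t] by (simp add: gain_def mult.commute)
qed

text \<open>Integrating the lower bound of the gain removes the drift; division by
  \<open>\<epsilon>^2 / 2\<close> leaves \<open>J curv\<close>, up to the error
  \<open>\<eta>\<close> made by evaluating \<open>curv\<close> at a displaced point. Uniform
  continuity makes \<open>\<eta>\<close> arbitrary.\<close>

lemma J_curv_nonpos:
  assumes fol: "\<And>\<theta> y. (\<theta>, y) \<in> str \<Longrightarrow> \<exists>F. leaf F \<and> F \<theta> = cos_out \<theta> y"
  shows "J curv \<le> 0"
proof -
  have J1: "J (\<lambda>_. 1) \<ge> 0" using J_mono[OF adm_const[of 0] adm_const[of 1]] J_cmult[OF adm_const, of 0 0] by simp
  have bound: "J curv \<le> \<eta> * J (\<lambda>_. 1)" if \<eta>: "\<eta> > 0" for \<eta>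
  proof -
    \<comment> \<open>The displaced point is advanced by some \<open>t < \<epsilon> \<le> 1\<close>,
      so one period is lengthened by 1.\<close>
    define C where "C = (\<lambda>(v, s). (s - v, s + v)) ` ({\<delta>1..\<delta>2} \<times> {0..2 * pi + 1})"
    have Cs: "C \<subseteq> str" unfolding C_def using strip_point by auto
    have "compact C" unfolding C_def split_beta
      by (intro compact_continuous_image continuous_intros compact_Times compact_Icc)
    then have "uniformly_continuous_on C curv"
      using curv_adm_J(1) Cs by (intro compact_uniformly_continuous) (auto simp: adm_def intro: continuous_on_subset)
    then obtain d where d: "d > 0" "\<And>x x'. x \<in> C \<Longrightarrow> x' \<in> C \<Longrightarrow> dist x' x < d \<Longrightarrow> dist (curv x') (curv x) < \<eta>"
      using \<eta> unfolding uniformly_continuous_on_def by metis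
    define \<epsilon> where "\<epsilon> = min 1 (d / 2)"
    have \<epsilon>: "\<epsilon> > 0" "\<epsilon> \<le> 1" "\<epsilon> \<le> d / 2" using d by (auto simp: \<epsilon>_def)
    define \<Psi> where "\<Psi> z = \<epsilon> * drift z + \<epsilon>\<^sup>2 / 2 * (1 * curv z + (- \<eta>) * 1)" for z
    have ad: "adm drift" "J drift = 0" unfolding drift_def by (rule coboundary[OF \<rho>_cont \<rho>_periodic])+
    have a\<Psi>: "adm \<Psi>" unfolding \<Psi>_def by (intro adm_lincomb ad curv_adm_J adm_const)
    have J\<Psi>: "J \<Psi> = \<epsilon>\<^sup>2 / 2 * (J curv - \<eta> * J (\<lambda>_. 1))"
      unfolding \<Psi>_def by (subst J_lincomb J_lincomb, (intro adm_lincomb ad curv_adm_J adm_const)+)+ (simp add: ad)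
    have "J \<Psi> \<le> J (gain \<epsilon>)"
    proof (rule J_mono_rect[OF a\<Psi> gain_adm])
      fix v s assume v: "v \<in> {\<delta>1..\<delta>2}" and s: "s \<in> {0..2 * pi}"
      show "\<Psi> (s - v, s + v) \<le> gain \<epsilon> (s - v, s + v)"
      \<comment> \<open>On the diagonal no second-order expansion is available, but
        \<open>gain\<close>, \<open>drift\<close> and \<open>curv\<close> all vanish there.\<close>
      proof (cases "v = 0")
        case True
        then show ?thesis using \<eta> by (simp add: \<Psi>_def drift_def curv_def width_def gain_def)
      next
        case False
        then have "s - v < s + v" "s + v < s - v + 2 * pi" using v \<delta> by auto
        then obtain t where t: "0 < t" "t < \<epsilon>"
          "gain \<epsilon> (s - v, s + v) \<ge> \<epsilon> * drift (s - v, s + v) + \<epsilon>\<^sup>2 / 2 * curv (s - v + t, s + v + t)"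
          using gain_lower \<epsilon>(1) by blast
        have "(s - v, s + v) \<in> C" unfolding C_def using v s by (auto intro!: image_eqI[of _ _ "(v, s)"])
        moreover have "(s - v + t, s + v + t) \<in> C"
          unfolding C_def using v s t \<epsilon> by (auto intro!: image_eqI[of _ _ "(v, s + t)"])
        moreover have "dist (s - v + t, s + v + t) (s - v, s + v) < d"
        proof -
          have "dist (s - v + t, s + v + t) (s - v, s + v) = sqrt 2 * t"
            using t by (simp add: dist_Pair_Pair dist_real_def real_sqrt_mult)
          also have "\<dots> < 2 * \<epsilon>" using t sqrt2_less_2 by (intro mult_strict_mono) auto
          finally show ?thesis using \<epsilon> by simp
        qed
        ultimately have "dist (curv (s - v + t, s + v + t)) (curv (s - v, s + v)) < \<eta>" by (rule d(2))
        then have "1 * curv (s - v, s + v) + (- \<eta>) * 1 \<le> curv (s - v + t, s + v + t)" by (simp add: dist_real_def)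
        then have "\<Psi> (s - v, s + v) \<le> \<epsilon> * drift (s - v, s + v) + \<epsilon>\<^sup>2 / 2 * curv (s - v + t, s + v + t)"
          unfolding \<Psi>_def by (intro add_left_mono mult_left_mono) auto
        then show ?thesis using t(3) by simp
      qed
    qed
    also have "\<dots> \<le> 0" by (rule gain_integral_nonpos[OF fol \<epsilon>(1)])
    finally show ?thesis using J\<Psi> \<epsilon>(1) by (simp add: mult_le_0_iff)
  qed
  show ?thesis
  proof (rule field_le_epsilon)
    fix e :: real assume e: "e > 0"
    have "J curv \<le> e / (J (\<lambda>_. 1) + 1) * J (\<lambda>_. 1)" using e J1 by (intro bound) auto
    also have "\<dots> \<le> e" using e J1 by (simp add: field_simps)
    finally show "J curv \<le> 0 + e" by simp
  qed
qed

text \<open>With \<open>p = cos \<alpha>\<close> this is the integral of the squared sine over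
  \<open>{\<delta>1..\<delta>2}\<close>. The antiderivative uses \<open>arccos\<close>, which is not
  differentiable at \<open>p = 1\<close>, so only interior derivatives are taken.\<close>

lemma sin_square_integral:
  "integral {cos \<delta>2..cos \<delta>1} (\<lambda>p. sqrt (1 - p\<^sup>2)) = ((\<delta>2 - sin \<delta>2 * cos \<delta>2) - (\<delta>1 - sin \<delta>1 * cos \<delta>1)) / 2"
proof -
  define P where "P p = - (arccos p - sqrt (1 - p\<^sup>2) * p) / 2" for p
  have le: "cos \<delta>2 \<ge> 0" using \<delta> by (intro cos_ge_zero) auto
  have "((\<lambda>p. sqrt (1 - p\<^sup>2)) has_integral P (cos \<delta>1) - P (cos \<delta>2)) {cos \<delta>2..cos \<delta>1}"
  proof (rule fundamental_theorem_of_calculus_interior)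
    show "cos \<delta>2 \<le> cos \<delta>1" using cos_less by simp
    show "continuous_on {cos \<delta>2..cos \<delta>1} P" unfolding P_def
      by (intro continuous_intros continuous_on_arccos) (use le in \<open>auto intro: order_trans[OF _ cos_le_one]\<close>)
    fix p assume p: "p \<in> {cos \<delta>2<..<cos \<delta>1}"
    have p1: "-1 < p" "p < 1" using p le cos_le_one[of \<delta>1] by (auto simp del: cos_le_one)
    then have p2: "1 - p\<^sup>2 > 0" by (simp add: abs_square_less_1)
    have r: "((\<lambda>p. sqrt (1 - p\<^sup>2)) has_real_derivative - p / sqrt (1 - p\<^sup>2)) (at p)"
      using p2 by (auto intro!: derivative_eq_intros simp: field_simps)
    have a: "(arccos has_real_derivative inverse (- sqrt (1 - p\<^sup>2))) (at p)"
      using p1 by (rule DERIV_arccos)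
    have "(P has_real_derivative - (inverse (- sqrt (1 - p\<^sup>2)) - (- p / sqrt (1 - p\<^sup>2) * p + sqrt (1 - p\<^sup>2))) / 2) (at p)"
      unfolding P_def by (rule derivative_eq_intros a r refl | simp)+
    moreover have "- (inverse (- sqrt (1 - p\<^sup>2)) - (- p / sqrt (1 - p\<^sup>2) * p + sqrt (1 - p\<^sup>2))) / 2 = sqrt (1 - p\<^sup>2)"
    proof -
      define q where "q = sqrt (1 - p\<^sup>2)"
      have q: "q > 0" "q * q = 1 - p * p" using p2 by (auto simp: q_def power2_eq_square)
      then show ?thesis unfolding q_def[symmetric] by (simp add: field_simps)
    qed
    ultimately show "(P has_vector_derivative sqrt (1 - p\<^sup>2)) (at p)"
      by (simp only: has_real_derivative_iff_has_vector_derivative)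
  qed
  moreover have "P (cos d) = - (d - sin d * cos d) / 2" if "0 \<le> d" "d \<le> pi / 2" for d
  proof -
    have "sqrt (1 - (cos d)\<^sup>2) = sin d" using that sin_ge_zero[of d] by (simp add: sin_squared_eq[symmetric])
    then show ?thesis unfolding P_def using that by (simp add: arccos_cos)
  qed
  ultimately show ?thesis using \<delta> by (simp add: integral_unique field_simps)
qed

text \<open>Nonpositivity of \<open>J curv\<close> compares \<open>J width\<close> with the integral
  of the chord, and \<open>J width\<close> factorises: one \<open>\<rho>\<close> comes from the
  width, the other from arc length, and the sine depends on \<open>p\<close> only.\<close>

lemma hopf_inequality:
  assumes "\<And>\<theta> y. (\<theta>, y) \<in> str \<Longrightarrow> \<exists>F. leaf F \<and> F \<theta> = cos_out \<theta> y"
  shows "integral {0..2*pi} (\<lambda>\<theta>. (\<rho> \<theta>)\<^sup>2) * ((\<delta>2 - sin \<delta>2 * cos \<delta>2) - (\<delta>1 - sin \<delta>1 * cos \<delta>1))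
     \<le> J (\<lambda>z. chord (fst z) (snd z))"
proof -
  have "I (\<lambda>w. \<rho> (fst w) * sqrt (1 - (snd w)\<^sup>2)) =
     integral {0..2*pi} (\<lambda>\<theta>. (\<rho> \<theta>)\<^sup>2) * integral {cos \<delta>2..cos \<delta>1} (\<lambda>p. sqrt (1 - p\<^sup>2))"
    unfolding I_def by (simp add: power2_eq_square mult.assoc[symmetric])
  then show ?thesis
    using J_curv_nonpos[OF assms] unfolding curv_adm_J(2) J_width sin_square_integral by simp
qed

text \<open>Green's theorem leaves one boundary term for each edge; on a constant-angle edge
  \<open>rot_s\<close> is 1 and the term is the integrated segment area.\<close>

lemma J_chord:
  "J (\<lambda>z. chord (fst z) (snd z)) = area2 * ((\<delta>2 - sin \<delta>2 * cos \<delta>2) - (\<delta>1 - sin \<delta>1 * cos \<delta>1))"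
proof -
  define f where "f v s = 2 * chord (s - v) (s + v) * dens (s - v) (s + v)" for v s
  define g where "g v = integral {0..2*pi} (f v)" for v
  have fc: "continuous_on ({\<delta>1..\<delta>2} \<times> UNIV) (\<lambda>(v, s). f v s)"
    using J_integrand_cont[OF adm_chord] by (simp add: f_def)
  have Jg: "J (\<lambda>z. chord (fst z) (snd z)) = integral {\<delta>1..\<delta>2} g"
    unfolding J_def rect_def g_def
    by (subst integral_prod_continuous)
      (use continuous_on_subset[OF fc, of "cbox (\<delta>1, 0) (\<delta>2, 2 * pi)"] in \<open>auto simp: f_def[abs_def] cbox_Pair_eq\<close>)
  have gc: "continuous_on {\<delta>1..\<delta>2} g"
    unfolding g_def using integral_continuous_on_param[OF continuous_on_subset[OF fc], of "{\<delta>1..\<delta>2}" 0 "2*pi"]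
    by auto
  define M where "M v = integral {0..2*pi} (\<lambda>s. seg v s * rot_s v s)" for v
  have Mlev: "M d = area2 * (d - sin d * cos d)"
    if "0 < d" "d \<le> pi / 2" "\<And>\<theta>. cos_out \<theta> (\<theta> + 2 * d) = cos d" for d
    unfolding M_def using level_rot[OF that] level_area[OF _ that(2,3)] that(1) by simp
  have M2: "M \<delta>2 = area2 * (\<delta>2 - sin \<delta>2 * cos \<delta>2)" using Mlev[OF _ _ level2(1)] \<delta> by auto
  have gr: "integral {a..\<delta>2} g = M \<delta>2 - M a" if "0 < a" "a \<le> \<delta>2" for a
    unfolding g_def f_def M_def by (rule green_rect) (use that \<delta> in auto)
  show ?thesis
  proof (cases "\<delta>1 = 0")
    case False
    then show ?thesis
      unfolding Jg using gr[of \<delta>1] M2 Mlev[OF _ _ level1(1)] \<delta> by (simp add: algebra_simps)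
  next
    case True
    obtain C where C: "\<And>v s. 0 < v \<Longrightarrow> v \<le> pi / 2 \<Longrightarrow> s \<in> {0..2*pi} \<Longrightarrow> \<bar>seg v s * rot_s v s\<bar> \<le> C * v"
      using seg_bound by blast
    have "compact (g ` {\<delta>1..\<delta>2})" by (intro compact_continuous_image gc compact_Icc)
    then obtain B where B: "B > 0" "\<And>v. v \<in> {\<delta>1..\<delta>2} \<Longrightarrow> \<bar>g v\<bar> \<le> B"
      using compact_imp_bounded[THEN bounded_pos[THEN iffD1]] by (metis imageI real_norm_def)
    \<comment> \<open>The edge \<open>v = 0\<close> is degenerate, so Green's theorem is applied
      above \<open>a > 0\<close>. The omitted strip and the boundary term at \<open>a\<close> are
      both of order \<open>a\<close>.\<close>
    have bd: "\<bar>integral {\<delta>1..\<delta>2} g - M \<delta>2\<bar> \<le> (B + 2 * pi * \<bar>C\<bar>) * a" if a: "0 < a" "a \<le> \<delta>2" for a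
    proof -
      have "integral {\<delta>1..a} g + integral {a..\<delta>2} g = integral {\<delta>1..\<delta>2} g"
        by (rule Henstock_Kurzweil_Integration.integral_combine) (use a True gc in \<open>auto intro: integrable_continuous_real\<close>)
      moreover have "norm (integral {\<delta>1..a} g) \<le> B * (a - \<delta>1)"
        by (rule integral_bound) (use a True B in \<open>auto intro!: continuous_on_subset[OF gc]\<close>)
      moreover have "norm (M a) \<le> (\<bar>C\<bar> * a) * (2 * pi - 0)"
        unfolding M_def
      proof (rule integral_bound)
        have "\<And>s. 0 < a \<and> a < pi" using a \<delta> by auto
        then show "continuous_on {0..2*pi} (\<lambda>s. seg a s * rot_s a s)"
          by (intro continuous_intros ch_cont rot_cont) auto
        fix s assume "s \<in> {0..2*pi}"
        then have "\<bar>seg a s * rot_s a s\<bar> \<le> C * a" using C a \<delta> by auto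
        also have "\<dots> \<le> \<bar>C\<bar> * a" using a by (intro mult_right_mono) auto
        finally show "norm (seg a s * rot_s a s) \<le> \<bar>C\<bar> * a" by simp
      qed simp
      ultimately show ?thesis using gr[OF a] True by (simp add: algebra_simps)
    qed
    have "\<bar>integral {\<delta>1..\<delta>2} g - M \<delta>2\<bar> \<le> 0"
    proof (rule field_le_epsilon)
      fix e :: real assume e: "e > 0"
      define K where "K = B + 2 * pi * \<bar>C\<bar>"
      have K: "K > 0" using B by (simp add: K_def add_pos_nonneg)
      define a where "a = min \<delta>2 (e / K)"
      have "0 < a" "a \<le> \<delta>2" using \<delta> e K by (auto simp: a_def)
      from bd[OF this] have "\<bar>integral {\<delta>1..\<delta>2} g - M \<delta>2\<bar> \<le> K * a" by (simp add: K_def)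
      also have "\<dots> \<le> K * (e / K)" using K by (intro mult_left_mono) (auto simp: a_def)
      finally show "\<bar>integral {\<delta>1..\<delta>2} g - M \<delta>2\<bar> \<le> 0 + e" using K by simp
    qed
    then show ?thesis unfolding Jg using M2 True by simp
  qed
qed

theorem foliated_strip_circle:
  assumes "\<And>\<theta> y. (\<theta>, y) \<in> str \<Longrightarrow> \<exists>F. leaf F \<and> F \<theta> = cos_out \<theta> y"
  shows "\<exists>c r. r > 0 \<and> \<Gamma> ` UNIV = sphere c r"
proof (rule circle_if_integral_le)
  \<comment> \<open>Twice \<open>\<delta> - sin \<delta> * cos \<delta>\<close> is
    \<open>2 * \<delta> - sin (2 * \<delta>)\<close>, strictly increasing; so the common factor of
    the Hopf inequality and of \<open>J_chord\<close> can be cancelled.\<close>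
  have "2 * \<delta>1 - sin (2 * \<delta>1) < 2 * \<delta>2 - sin (2 * \<delta>2)"
  proof (rule DERIV_pos_imp_increasing_open[of "2 * \<delta>1" "2 * \<delta>2" "\<lambda>x. x - sin x"])
    fix x assume x: "2 * \<delta>1 < x" "x < 2 * \<delta>2"
    have "cos x < cos 0" using x \<delta> by (intro cos_monotone_0_pi) auto
    then show "\<exists>y. ((\<lambda>x. x - sin x) has_real_derivative y) (at x) \<and> 0 < y"
      by (intro exI[of _ "1 - cos x"]) (auto intro!: derivative_eq_intros)
  qed (use \<delta> in \<open>auto intro!: continuous_intros\<close>)
  then have "(\<delta>2 - sin \<delta>2 * cos \<delta>2) - (\<delta>1 - sin \<delta>1 * cos \<delta>1) > 0" by (simp add: sin_double)
  then show "integral {0..2*pi} (\<lambda>t. (\<rho> t)\<^sup>2) \<le> area2"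
    using hopf_inequality[OF assms] unfolding J_chord by simp
qed

end

section \<open>Convex tables\<close>

locale table =
  fixes \<gamma> :: "real \<Rightarrow> complex" and L :: real
  assumes table: "convex_table \<gamma> L"
begin

abbreviation "\<gamma>1 \<equiv> vderiv \<gamma>"
abbreviation "\<gamma>2 \<equiv> vderiv \<gamma>1"
abbreviation "\<gamma>3 \<equiv> vderiv \<gamma>2"

lemma L: "L > 0" and \<gamma>_periodic: "\<gamma> (t + L) = \<gamma> t" and \<gamma>_inj: "inj_on \<gamma> {0..<L}"
  and \<gamma>1_nonzero: "\<gamma>1 t \<noteq> 0" and curvature_pos: "Im (cnj (\<gamma>1 t) * \<gamma>2 t) > 0"
  using table by (auto simp: convex_table_def)

text \<open>The radius of curvature contains two derivatives of the curve, so a continuous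
  \<open>\<rho>'\<close> calls for a continuous third one.\<close>

lemma \<gamma>_derivs:
  "(\<gamma> has_vector_derivative \<gamma>1 t) (at t)" "(\<gamma>1 has_vector_derivative \<gamma>2 t) (at t)"
  "(\<gamma>2 has_vector_derivative \<gamma>3 t) (at t)" "isCont \<gamma>3 t"
proof -
  have d: "((vderiv ^^ n) \<gamma>) differentiable (at t)" for n
    using table by (auto simp: convex_table_def smooth_param_def)
  show "(\<gamma> has_vector_derivative \<gamma>1 t) (at t)" "(\<gamma>1 has_vector_derivative \<gamma>2 t) (at t)"
    "(\<gamma>2 has_vector_derivative \<gamma>3 t) (at t)" "isCont \<gamma>3 t"
    using d[of 0] d[of 1] d[of 2] d[of 3] differentiable_imp_continuous_within[of \<gamma>3 t UNIV]
    by (auto simp: vderiv_def numeral_2_eq_2 numeral_3_eq_3 vector_derivative_works)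
qed

lemma \<gamma>_conts: "continuous_on A \<gamma>" "continuous_on A \<gamma>1" "continuous_on A \<gamma>2" "continuous_on A \<gamma>3"
  using \<gamma>_derivs has_vector_derivative_continuous by (blast intro: continuous_at_imp_continuous_on)+

lemma vderiv_periodic:
  assumes "\<And>t. (f has_vector_derivative vderiv f t) (at t)" "\<And>t. f (t + L) = f t"
  shows "vderiv f (t + L) = vderiv f t"
proof -
  have "((\<lambda>t. t + L) has_vector_derivative 1) (at t)"
    unfolding has_real_derivative_iff_has_vector_derivative[symmetric] by (auto intro!: derivative_eq_intros)
  from vector_diff_chain_at[OF this assms(1)] have "(f has_vector_derivative vderiv f (t + L)) (at t)"
    by (simp add: o_def assms(2))
  then show ?thesis using vector_derivative_unique_at[OF _ assms(1)] by blast
qed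

lemma derivs_periodic: "\<gamma>1 (t + L) = \<gamma>1 t" "\<gamma>2 (t + L) = \<gamma>2 t"
proof -
  have 1: "\<gamma>1 (t + L) = \<gamma>1 t" for t by (rule vderiv_periodic[OF \<gamma>_derivs(1) \<gamma>_periodic])
  then show "\<gamma>1 (t + L) = \<gamma>1 t" .
  show "\<gamma>2 (t + L) = \<gamma>2 t" by (rule vderiv_periodic[OF \<gamma>_derivs(2) 1])
qed

lemma reduce_period:
  obtains k :: int where "t - of_int k * L \<in> {0..<L}" "\<gamma> (t - of_int k * L) = \<gamma> t" "\<gamma>1 (t - of_int k * L) = \<gamma>1 t"
proof -
  interpret P: periodic_fun_simple \<gamma> L by standard (rule \<gamma>_periodic)
  interpret P1: periodic_fun_simple \<gamma>1 L by standard (rule derivs_periodic)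
  define k where "k = \<lfloor>t / L\<rfloor>"
  have "of_int k \<le> t / L" "t / L < of_int k + 1" unfolding k_def by linarith+
  then have "t - of_int k * L \<in> {0..<L}" using L by (simp add: field_simps)
  then show thesis using that P.minus_of_int P1.minus_of_int by blast
qed

lemma range_\<gamma>: "range \<gamma> = curve_set \<gamma> L"
proof -
  have "\<gamma> t \<in> \<gamma> ` {0..<L}" for t using reduce_period[of t] by (metis imageI)
  then show ?thesis by (auto simp: curve_set_def)
qed

text \<open>It makes the parameter chosen inside \<open>unit_tangent\<close> harmless.\<close>

lemma \<gamma>1_eq:
  assumes "\<gamma> s = \<gamma> t"
  shows "\<gamma>1 s = \<gamma>1 t"
proof -
  obtain k where k: "s - of_int k * L \<in> {0..<L}" "\<gamma> (s - of_int k * L) = \<gamma> s" "\<gamma>1 (s - of_int k * L) = \<gamma>1 s"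
    by (rule reduce_period)
  obtain m where m: "t - of_int m * L \<in> {0..<L}" "\<gamma> (t - of_int m * L) = \<gamma> t" "\<gamma>1 (t - of_int m * L) = \<gamma>1 t"
    by (rule reduce_period)
  have "s - of_int k * L = t - of_int m * L"
    by (rule inj_onD[OF \<gamma>_inj _ k(1) m(1)]) (simp add: k m assms)
  then show ?thesis using k(3) m(3) by simp
qed

section \<open>Tangent lines support the table strictly\<close>

text \<open>The signed distance to the left of the tangent line at \<open>t\<close>, scaled by the
  speed.\<close>

definition height :: "real \<Rightarrow> complex \<Rightarrow> real" where
  "height t x = Im (cnj (\<gamma>1 t) * (x - \<gamma> t))"

lemma height_deriv:
  "((\<lambda>s. height t (\<gamma> s)) has_real_derivative Im (cnj (\<gamma>1 t) * \<gamma>1 s)) (at s)"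
  "((\<lambda>s. Im (cnj (\<gamma>1 t) * \<gamma>1 s)) has_real_derivative Im (cnj (\<gamma>1 t) * \<gamma>2 s)) (at s)"
proof -
  have "((\<lambda>s. cnj (\<gamma>1 t) * (\<gamma> s - \<gamma> t)) has_vector_derivative cnj (\<gamma>1 t) * \<gamma>1 s) (at s)"
    by (rule has_vector_derivative_mult_right) (auto intro!: derivative_eq_intros \<gamma>_derivs)
  from has_real_derivative_Re_Im(2)[OF this]
  show "((\<lambda>s. height t (\<gamma> s)) has_real_derivative Im (cnj (\<gamma>1 t) * \<gamma>1 s)) (at s)"
    unfolding height_def .
  show "((\<lambda>s. Im (cnj (\<gamma>1 t) * \<gamma>1 s)) has_real_derivative Im (cnj (\<gamma>1 t) * \<gamma>2 s)) (at s)"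
    by (rule has_real_derivative_Re_Im(2)[OF has_vector_derivative_mult_right[OF \<gamma>_derivs(2)]])
qed

lemma height_local_pos:
  obtains d where "d > 0" "\<And>s. s \<noteq> t \<Longrightarrow> \<bar>s - t\<bar> < d \<Longrightarrow> height t (\<gamma> s) > 0"
proof -
  let ?f = "\<lambda>s. height t (\<gamma> s)" and ?f' = "\<lambda>s. Im (cnj (\<gamma>1 t) * \<gamma>1 s)"
  have f't: "?f' t = 0" by simp
  obtain d1 where d1: "d1 > 0" "\<And>h. 0 < h \<Longrightarrow> h < d1 \<Longrightarrow> ?f' t < ?f' (t + h)"
    using DERIV_pos_inc_right[OF height_deriv(2) curvature_pos] by blast
  obtain d2 where d2: "d2 > 0" "\<And>h. 0 < h \<Longrightarrow> h < d2 \<Longrightarrow> ?f' (t - h) < ?f' t"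
    using DERIV_pos_inc_left[OF height_deriv(2) curvature_pos] by blast
  have fc: "continuous_on A ?f" for A unfolding height_def by (intro continuous_intros \<gamma>_conts)
  have ft: "?f t = 0" by (simp add: height_def)
  have "?f s > 0" if s: "s \<noteq> t" "\<bar>s - t\<bar> < min d1 d2" for s
  proof (cases "s > t")
    case True
    have "?f t < ?f s"
    proof (rule DERIV_pos_imp_increasing_open[OF True _ fc])
      fix x assume "t < x" "x < s"
      then have "?f' x > 0" using d1(2)[of "x - t"] s f't by simp
      then show "\<exists>y. (?f has_real_derivative y) (at x) \<and> 0 < y" using height_deriv(1) by blast
    qed
    then show ?thesis unfolding ft .
  next
    case False
    then have "s < t" using s by simp
    have "?f s > ?f t"
    proof (rule DERIV_neg_imp_decreasing_open[OF \<open>s < t\<close> _ fc])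
      fix x assume "s < x" "x < t"
      then have "?f' x < 0" using d2(2)[of "t - x"] s f't by simp
      then show "\<exists>y. (?f has_real_derivative y) (at x) \<and> y < 0" using height_deriv(1) by blast
    qed
    then show ?thesis unfolding ft .
  qed
  then show thesis using that[of "min d1 d2"] d1 d2 by simp
qed

text \<open>A supporting line at \<open>\<gamma> t\<close> has its normal orthogonal to the tangent,
  since the curve stays on one side, so it is the tangent line. Which side contains the table is
  decided by the local positivity of the height.\<close>

lemma height_nonneg:
  assumes K: "compact K" "convex K" "interior K \<noteq> {}" "frontier K = \<gamma> ` {0..<L}" and x: "x \<in> K"
  shows "height t x \<ge> 0"
proof -
  have fr: "\<gamma> s \<in> frontier K" for s using range_\<gamma> K(4) by (auto simp: curve_set_def)
  have inK: "\<gamma> s \<in> K" for s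
    using fr[of s] compact_imp_closed[OF K(1)] frontier_subset_closed by blast
  have "\<gamma> t \<notin> rel_interior K"
    using fr[of t] rel_interior_nonempty_interior[OF K(3)] by (auto simp: frontier_def)
  then obtain a where a: "a \<noteq> 0" "\<And>y. y \<in> K \<Longrightarrow> a \<bullet> \<gamma> t \<le> a \<bullet> y"
    using supporting_hyperplane_rel_boundary[OF K(2) inK] by metis
  have da: "((\<lambda>s. a \<bullet> \<gamma> s) has_real_derivative a \<bullet> \<gamma>1 t) (at t)"
    using bounded_linear.has_vector_derivative[OF bounded_linear_inner_right \<gamma>_derivs(1)]
    by (simp add: has_real_derivative_iff_has_vector_derivative)
  have orth: "a \<bullet> \<gamma>1 t = 0"
    by (rule DERIV_local_min[OF da zero_less_one]) (use a(2) inK in auto)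
  define n where "n = (norm (\<gamma>1 t))\<^sup>2"
  have n: "n > 0" using \<gamma>1_nonzero[of t] by (simp add: n_def)
  define c where "c = Im (cnj (\<gamma>1 t) * a)"
  have ah: "n * (a \<bullet> (y - \<gamma> t)) = c * height t y" for y
  proof -
    define p q r s u v where "p = Re (\<gamma>1 t)" and "q = Im (\<gamma>1 t)" and "r = Re a" and "s = Im a"
      and "u = Re (y - \<gamma> t)" and "v = Im (y - \<gamma> t)"
    have "r * p + s * q = 0" using orth by (simp add: inner_complex_def p_def q_def r_def s_def)
    then have "(p\<^sup>2 + q\<^sup>2) * (r * u + s * v) = (p * s - q * r) * (p * v - q * u)" by algebra
    then show ?thesis unfolding n_def c_def height_def inner_complex_def cmod_power2
      by (simp add: p_def q_def r_def s_def u_def v_def)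
  qed
  obtain d where d: "d > 0" "\<And>s. s \<noteq> t \<Longrightarrow> \<bar>s - t\<bar> < d \<Longrightarrow> height t (\<gamma> s) > 0"
    using height_local_pos[of t] by blast
  have "height t (\<gamma> (t + d / 2)) > 0" using d by auto
  moreover have "c * height t (\<gamma> (t + d / 2)) \<ge> 0"
    unfolding ah[symmetric] using a(2)[OF inK] n by (simp add: inner_diff_right)
  moreover have "c \<noteq> 0"
  proof
    assume "c = 0"
    then have "n * (a \<bullet> ((\<gamma> t + a) - \<gamma> t)) = 0" unfolding ah by simp
    then show False using n a(1) by simp
  qed
  ultimately have "c > 0" by (auto simp: zero_le_mult_iff)
  moreover have "c * height t x \<ge> 0" unfolding ah[symmetric] using a(2)[OF x] n by (simp add: inner_diff_right)
  ultimately show ?thesis by (simp add: zero_le_mult_iff)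
qed

text \<open>If another boundary point lay on the tangent line, the segment joining it to the point of tangency
  would consist of boundary points on that line; but those are isolated, each being a strict
  local minimum of the height.\<close>

lemma height_pos:
  assumes "\<gamma> s \<noteq> \<gamma> t"
  shows "height t (\<gamma> s) > 0"
proof (rule ccontr)
  assume neg: "\<not> height t (\<gamma> s) > 0"
  obtain K where K: "compact K" "convex K" "interior K \<noteq> {}" "frontier K = \<gamma> ` {0..<L}"
    using table by (auto simp: convex_table_def)
  note nn = height_nonneg[OF K]
  have inK: "\<gamma> s \<in> K" for s
    using range_\<gamma> K(4) compact_imp_closed[OF K(1)] frontier_subset_closed[of K] by (auto simp: curve_set_def)
  have h0: "height t (\<gamma> s) = 0" using neg nn[OF inK, of t s] by simp
  define Z where "Z = {x. height t (\<gamma> x) = 0}"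
  have iso: "\<not> x islimpt Z" if x: "x \<in> {0..L}" for x
  proof (cases "x \<in> Z")
    case False
    have "continuous_on UNIV (\<lambda>x. height t (\<gamma> x))" unfolding height_def by (intro continuous_intros \<gamma>_conts)
    then have "closed Z" unfolding Z_def by (intro closed_Collect_eq continuous_intros)
    then show ?thesis using False closed_limpt by blast
  next
    case True
    \<comment> \<open>A zero of the nonnegative height is a minimum, so the tangent at
      \<open>x\<close> is parallel to that at \<open>t\<close>. Other zeros near \<open>x\<close>
      would then lie on the tangent line at \<open>x\<close>, contrary to strict local
      positivity.\<close>
    have min: "Im (cnj (\<gamma>1 t) * \<gamma>1 x) = 0"
      by (rule DERIV_local_min[OF height_deriv(1) zero_less_one]) (use True nn[OF inK] in \<open>auto simp: Z_def\<close>)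
    obtain d where d: "d > 0" "\<And>y. y \<noteq> x \<Longrightarrow> \<bar>y - x\<bar> < d \<Longrightarrow> height x (\<gamma> y) > 0"
      by (rule height_local_pos) blast
    have "y \<notin> Z" if y: "y \<noteq> x" "\<bar>y - x\<bar> < d" for y
    proof
      assume "y \<in> Z"
      then have 0: "Im (cnj (\<gamma>1 t) * (\<gamma> y - \<gamma> x)) = 0"
        using True by (simp add: Z_def height_def algebra_simps)
      define p q u v r w where "p = Re (\<gamma>1 t)" and "q = Im (\<gamma>1 t)" and "u = Re (\<gamma>1 x)" and "v = Im (\<gamma>1 x)"
        and "r = Re (\<gamma> y - \<gamma> x)" and "w = Im (\<gamma> y - \<gamma> x)"
      have pq: "p * v - q * u = 0" "p * w - q * r = 0"
        using min 0 by (simp_all add: p_def q_def u_def v_def r_def w_def)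
      have "p \<noteq> 0 \<or> q \<noteq> 0" using \<gamma>1_nonzero[of t] by (auto simp: p_def q_def complex_eq_iff)
      then have "u * w - v * r = 0"
      proof
        assume "p \<noteq> 0"
        moreover have "p * (u * w - v * r) = 0" using pq by algebra
        ultimately show ?thesis by simp
      next
        assume "q \<noteq> 0"
        moreover have "q * (u * w - v * r) = 0" using pq by algebra
        ultimately show ?thesis by simp
      qed
      then have "height x (\<gamma> y) = 0" by (simp add: height_def u_def v_def r_def w_def)
      then show False using d(2)[OF y] by simp
    qed
    then show ?thesis unfolding islimpt_approachable using d(1) by (metis dist_real_def)
  qed
  have "finite ({0..L} \<inter> Z)" by (rule finite_not_islimpt_in_compact[OF compact_Icc iso])
  moreover have "closed_segment (\<gamma> t) (\<gamma> s) \<subseteq> \<gamma> ` ({0..L} \<inter> Z)"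
  proof
    fix x assume x: "x \<in> closed_segment (\<gamma> t) (\<gamma> s)"
    then have xK: "x \<in> K" using closed_segment_subset[OF inK inK K(2)] by blast
    obtain u where u: "x = (1 - u) *\<^sub>R \<gamma> t + u *\<^sub>R \<gamma> s" using x by (auto simp: in_segment)
    have "x - \<gamma> t = of_real u * (\<gamma> s - \<gamma> t)" unfolding u by (simp add: scaleR_conv_of_real algebra_simps)
    then have "height t x = Im (of_real u * (cnj (\<gamma>1 t) * (\<gamma> s - \<gamma> t)))"
      unfolding height_def by (simp only: mult.left_commute)
    also have "\<dots> = u * height t (\<gamma> s)" unfolding height_def scaleR_conv_of_real[symmetric] by simp
    finally have "height t x = u * height t (\<gamma> s)" .
    then have hx: "height t x = 0" using h0 by simp
    have "x \<notin> interior K"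
    proof
      assume "x \<in> interior K"
      then obtain e where e: "e > 0" "ball x e \<subseteq> K" using mem_interior by blast
      \<comment> \<open>Pushing an interior point of height zero to the right of the tangent would
        give a point of the table with negative height.\<close>
      define y where "y = x - of_real (e / (2 * norm (\<gamma>1 t))) * (\<i> * \<gamma>1 t)"
      have "dist x y < e" using e(1) \<gamma>1_nonzero[of t] by (simp add: y_def dist_norm norm_mult norm_divide)
      then have "y \<in> K" using e(2) by auto
      then have "height t y \<ge> 0" by (rule nn)
      moreover have "height t y = height t x - e / (2 * norm (\<gamma>1 t)) * (norm (\<gamma>1 t))\<^sup>2"
      proof -
        have "Im (cnj g * (x - of_real k * (\<i> * g) - z)) = Im (cnj g * (x - z)) - k * ((Re g)\<^sup>2 + (Im g)\<^sup>2)" for g z k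
          by (simp add: power2_eq_square algebra_simps)
        then show ?thesis unfolding height_def y_def cmod_power2 .
      qed
      moreover have "e / (2 * norm (\<gamma>1 t)) * (norm (\<gamma>1 t))\<^sup>2 > 0" using e(1) \<gamma>1_nonzero[of t] by simp
      ultimately show False using hx by linarith
    qed
    then have "x \<in> frontier K" using xK compact_imp_closed[OF K(1)] by (simp add: frontier_def)
    then obtain y where "y \<in> {0..<L}" "x = \<gamma> y" unfolding K(4) by blast
    then show "x \<in> \<gamma> ` ({0..L} \<inter> Z)" using hx by (auto simp: Z_def)
  qed
  ultimately have "finite (closed_segment (\<gamma> t) (\<gamma> s))" using finite_surj by blast
  then show False using assms by simp
qed

section \<open>The tangent angle as a parameter\<close>

definition turn :: "real \<Rightarrow> real" where
  "turn t = Im (cnj (\<gamma>1 t) * \<gamma>2 t) / (norm (\<gamma>1 t))\<^sup>2"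

lemma turn_pos: "turn t > 0"
  using curvature_pos \<gamma>1_nonzero by (simp add: turn_def)

lemma turn_cont: "continuous_on A turn"
  unfolding turn_def by (intro continuous_intros \<gamma>_conts) (use \<gamma>1_nonzero in auto)

text \<open>Integrate the turning rate from the argument of the initial tangent; the unit tangent
  multiplied by \<open>cis (- \<tau> t)\<close> then has derivative zero.\<close>

lemma tangent_angle:
  obtains \<tau> where "\<And>t. (\<tau> has_real_derivative turn t) (at t)" "\<And>t. \<gamma>1 t = of_real (norm (\<gamma>1 t)) * cis (\<tau> t)"
proof -
  obtain F where F: "\<And>t. (F has_real_derivative turn t) (at t)"
    by (rule continuous_has_antiderivative[OF turn_cont]) blast
  define \<tau> where "\<tau> t = F t - F 0 + Arg (\<gamma>1 0)" for t
  have d: "(\<tau> has_real_derivative turn t) (at t)" for t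
    unfolding \<tau>_def by (auto intro!: derivative_eq_intros F)
  have z: "((\<lambda>t. sgn (\<gamma>1 t) * cis (- \<tau> t)) has_vector_derivative 0) (at t)" for t
  proof -
    have "Im (cnj (sgn (\<gamma>1 t)) * \<gamma>2 t) / norm (\<gamma>1 t) = turn t"
      using \<gamma>1_nonzero[of t] by (simp add: turn_def sgn_eq power2_eq_square diff_divide_distrib)
    then have "((\<lambda>t. sgn (\<gamma>1 t)) has_vector_derivative \<i> * sgn (\<gamma>1 t) * of_real (turn t)) (at t)"
      using has_vector_derivative_sgn_curve[OF \<gamma>_derivs(2) \<gamma>1_nonzero] by metis
    from has_vector_derivative_mult[OF this has_vector_derivative_cis[OF DERIV_minus[OF d]]]
    have "((\<lambda>t. sgn (\<gamma>1 t) * cis (- \<tau> t)) has_vector_derivative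
       sgn (\<gamma>1 t) * (\<i> * of_real (- turn t) * cis (- \<tau> t)) + \<i> * sgn (\<gamma>1 t) * of_real (turn t) * cis (- \<tau> t)) (at t)" .
    moreover have "sgn (\<gamma>1 t) * (\<i> * of_real (- turn t) * cis (- \<tau> t)) + \<i> * sgn (\<gamma>1 t) * of_real (turn t) * cis (- \<tau> t) = 0"
      by simp
    ultimately show ?thesis by (simp only:)
  qed
  have k: "sgn (\<gamma>1 t) * cis (- \<tau> t) = sgn (\<gamma>1 0) * cis (- \<tau> 0)" for t
  proof (rule has_vector_derivative_zero_constant[OF convex_UNIV z])
    fix c assume "\<And>t. t \<in> UNIV \<Longrightarrow> sgn (\<gamma>1 t) * cis (- \<tau> t) = c"
    then show ?thesis by simp
  qed
  have "sgn (\<gamma>1 0) = cis (\<tau> 0)" using cis_Arg[OF \<gamma>1_nonzero] by (simp add: \<tau>_def)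
  then have k1: "sgn (\<gamma>1 t) * cis (- \<tau> t) = 1" for t unfolding k[of t] by (simp add: cis_mult)
  have sg: "sgn (\<gamma>1 t) = cis (\<tau> t)" for t
  proof -
    have "sgn (\<gamma>1 t) * cis (- \<tau> t) * cis (\<tau> t) = cis (\<tau> t)" unfolding k1 by simp
    then show ?thesis unfolding mult.assoc cis_mult by simp
  qed
  have "\<gamma>1 t = of_real (norm (\<gamma>1 t)) * cis (\<tau> t)" for t
    unfolding sg[symmetric] sgn_eq using \<gamma>1_nonzero[of t] by simp
  from that[OF d this] show thesis .
qed

text \<open>The substance is that the tangent turns exactly once. Periodicity yields only a positive
  multiple of \<open>2 * pi\<close>; strict support by tangent lines excludes the larger
  ones.\<close>

lemma reparametrisation:
  obtains \<Gamma> \<rho> \<rho>' where "oval \<Gamma> \<rho> \<rho>'" "range \<Gamma> = curve_set \<gamma> L" "\<And>\<theta>. unit_tangent \<gamma> L (\<Gamma> \<theta>) = cis \<theta>"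
proof -
  obtain \<tau> where \<tau>': "\<And>t. (\<tau> has_real_derivative turn t) (at t)"
    and lift: "\<And>t. \<gamma>1 t = of_real (norm (\<gamma>1 t)) * cis (\<tau> t)"
    using tangent_angle by blast
  have \<tau>c: "continuous_on A \<tau>" for A using \<tau>' DERIV_isCont continuous_at_imp_continuous_on by blast
  have mono: "\<tau> s < \<tau> t" if "s < t" for s t
    by (rule DERIV_pos_imp_increasing[OF that]) (use \<tau>' turn_pos in blast)
  define T where "T = \<tau> L - \<tau> 0"
  have shift: "\<tau> (t + L) = \<tau> t + T" for t
  proof -
    have "((\<lambda>t. \<tau> (t + L) - \<tau> t) has_real_derivative turn (t + L) - turn t) (at t)" for t
      using DERIV_diff[OF DERIV_chain2[OF \<tau>' DERIV_add[OF DERIV_ident DERIV_const[of L]]] \<tau>'] by simp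
    moreover have "turn (t + L) = turn t" for t by (simp add: turn_def derivs_periodic)
    ultimately have "((\<lambda>t. \<tau> (t + L) - \<tau> t) has_real_derivative 0) (at t)" for t by simp
    then have "\<tau> (t + L) - \<tau> t = \<tau> (0 + L) - \<tau> 0" using DERIV_isconst_all by blast
    then show ?thesis by (simp add: T_def)
  qed
  have T0: "T > 0" using mono[OF L] by (simp add: T_def)
  have cis_lift: "cis (\<tau> t) = cis (\<tau> s)" if "\<gamma>1 t = \<gamma>1 s" for s t
    using lift[of t] lift[of s] \<gamma>1_nonzero[of s] that
    by (metis mult_cancel_left norm_eq_zero of_real_eq_0_iff)
  \<comment> \<open>For equally directed tangents the two heights are positive multiples of
    \<open>w\<close> and of \<open>- w\<close>, so they cannot both be positive.\<close>
  have par: False if "\<gamma> s \<noteq> \<gamma> t" "cis (\<tau> s) = cis (\<tau> t)" for s t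
  proof -
    have H: "height t (\<gamma> s) > 0" "height s (\<gamma> t) > 0" using height_pos that(1) by auto
    define n m where "n = norm (\<gamma>1 t)" and "m = norm (\<gamma>1 s)"
    have pos: "n > 0" "m > 0" using \<gamma>1_nonzero by (auto simp: n_def m_def)
    define w where "w = Im (cnj (cis (\<tau> t)) * (\<gamma> s - \<gamma> t))"
    have im: "Im (cnj (of_real r * c) * z) = r * Im (cnj c * z)" for r c z
      by (simp add: algebra_simps)
    have ht: "height t x = norm (\<gamma>1 t) * Im (cnj (cis (\<tau> t)) * (x - \<gamma> t))" for t x
      unfolding height_def using arg_cong[OF lift[of t], of "\<lambda>z. Im (cnj z * (x - \<gamma> t))"] unfolding im .
    have "height t (\<gamma> s) = n * w" unfolding ht w_def n_def ..
    moreover have "height s (\<gamma> t) = - (m * w)" unfolding ht that(2) w_def m_def by (simp add: algebra_simps)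
    ultimately show False using H pos by (auto simp: zero_less_mult_iff mult_less_0_iff)
  qed
  have T: "T = 2 * pi"
  proof -
    have "cis (\<tau> (0 + L)) = cis (\<tau> 0)" by (rule cis_lift) (rule derivs_periodic)
    then have "cis (\<tau> 0 + T) = cis (\<tau> 0)" unfolding shift .
    then have "cos (\<tau> 0 + T) = cos (\<tau> 0) \<and> sin (\<tau> 0 + T) = sin (\<tau> 0)" by (simp add: complex_eq_iff)
    then obtain n :: int where "\<tau> 0 + T = \<tau> 0 + 2 * pi * of_int n"
      using sin_cos_eq_iff[of "\<tau> 0 + T" "\<tau> 0"] by (auto simp: mult.assoc)
    then have n: "T = 2 * pi * of_int n" by simp
    then have "n \<ge> 1" using T0 by (simp add: zero_less_mult_iff)
    \<comment> \<open>Otherwise the initial tangent direction would recur strictly inside the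
      period, at a different point because the curve is simple, against \<open>par\<close>.\<close>
    moreover have "\<not> n \<ge> 2"
    proof
      assume "n \<ge> 2"
      then have "2 * pi * 2 \<le> T" unfolding n by (intro mult_left_mono) auto
      then have "\<tau> 0 + 2 * pi \<le> \<tau> L" "\<tau> 0 + 2 * pi \<noteq> \<tau> L" using pi_gt_zero by (auto simp: T_def simp del: pi_gt_zero)
      then obtain t where t: "0 \<le> t" "t \<le> L" "\<tau> t = \<tau> 0 + 2 * pi"
        using IVT'[of \<tau> 0 "\<tau> 0 + 2 * pi" L] \<tau>c L by auto
      then have "t \<noteq> 0" "t \<noteq> L" using \<open>\<tau> 0 + 2 * pi \<noteq> \<tau> L\<close> by auto
      then have "\<gamma> t \<noteq> \<gamma> 0" using inj_onD[OF \<gamma>_inj, of t 0] t L by auto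
      then show False by (rule par) (simp add: t(3) complex_eq_iff)
    qed
    ultimately have "n = 1" by simp
    then show ?thesis using n by simp
  qed
  have shift_n: "\<tau> (of_nat n * L) = \<tau> 0 + of_nat n * (2 * pi)" "\<tau> (- (of_nat n * L)) = \<tau> 0 - of_nat n * (2 * pi)" for n
  proof -
    show "\<tau> (of_nat n * L) = \<tau> 0 + of_nat n * (2 * pi)"
    proof (induction n)
      case (Suc n)
      then show ?case using shift[of "of_nat n * L"] by (simp add: T algebra_simps)
    qed simp
    show "\<tau> (- (of_nat n * L)) = \<tau> 0 - of_nat n * (2 * pi)"
    proof (induction n)
      case (Suc n)
      then show ?case using shift[of "- (of_nat (Suc n) * L)"] by (simp add: T algebra_simps)
    qed simp
  qed
  have surj: "\<exists>t. \<tau> t = \<theta>" for \<theta>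
  proof -
    obtain n :: nat where n: "\<bar>\<theta> - \<tau> 0\<bar> < of_nat n * (2 * pi)"
      using ex_less_of_nat_mult[of "2 * pi"] by auto
    have "- (of_nat n * L) \<le> of_nat n * L" using L by simp
    moreover have "\<tau> (- (of_nat n * L)) \<le> \<theta>" "\<theta> \<le> \<tau> (of_nat n * L)" unfolding shift_n using n by auto
    ultimately show ?thesis using IVT'[of \<tau> "- (of_nat n * L)" \<theta> "of_nat n * L"] \<tau>c by blast
  qed
  define \<sigma> where "\<sigma> \<theta> = (THE t. \<tau> t = \<theta>)" for \<theta>
  have inj: "s = t" if "\<tau> s = \<tau> t" for s t using mono[of s t] mono[of t s] that by (cases s t rule: linorder_cases) auto
  have \<sigma>\<tau>: "\<sigma> (\<tau> t) = t" for t unfolding \<sigma>_def by (rule the_equality) (auto dest: inj)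
  have \<tau>\<sigma>: "\<tau> (\<sigma> \<theta>) = \<theta>" for \<theta> using surj[of \<theta>] \<sigma>\<tau> by metis
  have \<sigma>c: "isCont \<sigma> \<theta>" for \<theta>
  proof -
    have "isCont \<sigma> (\<tau> (\<sigma> \<theta>))"
      by (rule isCont_inverse_function[OF zero_less_one]) (use \<sigma>\<tau> \<tau>' DERIV_isCont in blast)+
    then show ?thesis unfolding \<tau>\<sigma> .
  qed
  have \<sigma>': "(\<sigma> has_real_derivative inverse (turn (\<sigma> \<theta>))) (at \<theta>)" for \<theta>
    by (rule DERIV_inverse_function[OF \<tau>' _ _ _ \<tau>\<sigma> \<sigma>c, of _ "\<theta> - 1" "\<theta> + 1"]) (use turn_pos[of "\<sigma> \<theta>"] in auto)
  define q q' N N' where "q t = Im (cnj (\<gamma>1 t) * \<gamma>2 t)" and "q' t = Im (cnj (\<gamma>1 t) * \<gamma>3 t)"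
    and "N t = norm (\<gamma>1 t)" and "N' t = Re (cnj (sgn (\<gamma>1 t)) * \<gamma>2 t)" for t
  have q: "(q has_real_derivative q' t) (at t)" for t
  proof -
    have "((\<lambda>t. cnj (\<gamma>1 t)) has_vector_derivative cnj (\<gamma>2 t)) (at t)"
      using bounded_linear.has_vector_derivative[OF bounded_linear_cnj \<gamma>_derivs(2)] .
    from has_real_derivative_Re_Im(2)[OF has_vector_derivative_mult[OF this \<gamma>_derivs(3)]]
    show ?thesis unfolding q_def[abs_def] q'_def by simp
  qed
  have N: "(N has_real_derivative N' t) (at t)" for t
    unfolding N_def[abs_def] N'_def by (rule has_real_derivative_norm_curve[OF \<gamma>_derivs(2) \<gamma>1_nonzero])
  have qpos: "q t > 0" and Npos: "N t > 0" for t using curvature_pos \<gamma>1_nonzero by (auto simp: q_def N_def)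
  \<comment> \<open>\<open>r\<close> is the radius of curvature of a regular curve: cubed speed over
    the cross product of velocity and acceleration.\<close>
  define r r' where "r t = N t ^ 3 / q t" and "r' t = (3 * (N t)\<^sup>2 * N' t * q t - N t ^ 3 * q' t) / (q t * q t)" for t
  have r: "(r has_real_derivative r' t) (at t)" for t
    unfolding r_def r'_def using qpos[of t]
    by (auto intro!: derivative_eq_intros N q simp: power2_eq_square)
  have rc: "continuous_on UNIV r'"
  proof -
    have "continuous_on UNIV N'" unfolding N'_def
      by (intro continuous_intros \<gamma>_conts) (use \<gamma>1_nonzero in auto)
    moreover have "continuous_on UNIV q" "continuous_on UNIV q'" "continuous_on UNIV N"
      unfolding q_def q'_def N_def by (intro continuous_intros \<gamma>_conts)+
    ultimately show ?thesis unfolding r'_def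
      by (intro continuous_intros) (use qpos in \<open>auto simp: less_imp_neq[symmetric]\<close>)
  qed
  have rN: "r t = N t / turn t" for t
    using Npos[of t] by (simp add: r_def turn_def q_def N_def power2_eq_square power3_eq_cube)
  define \<Gamma> \<rho> \<rho>' where "\<Gamma> \<theta> = \<gamma> (\<sigma> \<theta>)" and "\<rho> \<theta> = r (\<sigma> \<theta>)" and "\<rho>' \<theta> = r' (\<sigma> \<theta>) * inverse (turn (\<sigma> \<theta>))" for \<theta>
  have "oval \<Gamma> \<rho> \<rho>'"
  proof
    fix \<theta>
    have "(\<Gamma> has_vector_derivative inverse (turn (\<sigma> \<theta>)) *\<^sub>R \<gamma>1 (\<sigma> \<theta>)) (at \<theta>)"
      using vector_diff_chain_at[OF \<sigma>'[unfolded has_real_derivative_iff_has_vector_derivative] \<gamma>_derivs(1)]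
      by (simp add: \<Gamma>_def[abs_def] o_def)
    moreover have "inverse (turn (\<sigma> \<theta>)) *\<^sub>R \<gamma>1 (\<sigma> \<theta>) = of_real (\<rho> \<theta>) * cis \<theta>"
      unfolding \<rho>_def rN N_def using arg_cong[OF lift[of "\<sigma> \<theta>"], of "\<lambda>z. inverse (turn (\<sigma> \<theta>)) *\<^sub>R z"]
      unfolding \<tau>\<sigma> by (simp add: scaleR_conv_of_real divide_inverse mult_ac)
    ultimately show "(\<Gamma> has_vector_derivative of_real (\<rho> \<theta>) * cis \<theta>) (at \<theta>)" by simp
    show "(\<rho> has_real_derivative \<rho>' \<theta>) (at \<theta>)"
      using DERIV_chain2[OF r \<sigma>'] by (simp add: \<rho>_def[abs_def] \<rho>'_def)
    show "\<rho> \<theta> > 0" unfolding \<rho>_def rN using Npos turn_pos by simp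
    show "\<Gamma> (\<theta> + 2 * pi) = \<Gamma> \<theta>"
    proof -
      have "\<tau> (\<sigma> \<theta> + L) = \<theta> + 2 * pi" unfolding shift \<tau>\<sigma> T ..
      then have "\<sigma> (\<theta> + 2 * pi) = \<sigma> \<theta> + L" using \<sigma>\<tau> by metis
      then show ?thesis by (simp add: \<Gamma>_def \<gamma>_periodic)
    qed
  next
    have sc: "continuous_on UNIV \<sigma>" using \<sigma>c continuous_at_imp_continuous_on by blast
    show "continuous_on UNIV \<rho>'" unfolding \<rho>'_def
      by (intro continuous_intros continuous_on_compose2[OF rc sc] continuous_on_compose2[OF turn_cont[of UNIV] sc])
        (use turn_pos in \<open>auto simp: less_imp_neq[symmetric]\<close>)
  qed
  moreover have "range \<Gamma> = curve_set \<gamma> L"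
  proof -
    have "range \<Gamma> = range \<gamma>"
    proof
      show "range \<gamma> \<subseteq> range \<Gamma>"
      proof
        fix x assume "x \<in> range \<gamma>"
        then obtain t where "x = \<gamma> t" by blast
        then have "x = \<Gamma> (\<tau> t)" by (simp add: \<Gamma>_def \<sigma>\<tau>)
        then show "x \<in> range \<Gamma>" by blast
      qed
    qed (auto simp: \<Gamma>_def)
    then show ?thesis by (simp add: range_\<gamma>)
  qed
  moreover have "unit_tangent \<gamma> L (\<Gamma> \<theta>) = cis \<theta>" for \<theta>
  proof -
    define s where "s = (SOME s. s \<in> {0..<L} \<and> \<gamma> s = \<Gamma> \<theta>)"
    have "\<exists>s. s \<in> {0..<L} \<and> \<gamma> s = \<Gamma> \<theta>" unfolding \<Gamma>_def using reduce_period[of "\<sigma> \<theta>"] by metis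
    then have "\<gamma> s = \<gamma> (\<sigma> \<theta>)" unfolding s_def \<Gamma>_def by (metis (mono_tags, lifting) someI_ex)
    then have "\<gamma>1 s = \<gamma>1 (\<sigma> \<theta>)" by (rule \<gamma>1_eq)
    then have "unit_tangent \<gamma> L (\<Gamma> \<theta>) = \<gamma>1 (\<sigma> \<theta>) / of_real (norm (\<gamma>1 (\<sigma> \<theta>)))"
      unfolding unit_tangent_def Let_def s_def[symmetric] by simp
    also have "\<dots> = cis \<theta>"
    proof -
      have "\<gamma>1 (\<sigma> \<theta>) = of_real (norm (\<gamma>1 (\<sigma> \<theta>))) * cis \<theta>" using lift[of "\<sigma> \<theta>"] unfolding \<tau>\<sigma> .
      then show ?thesis using \<gamma>1_nonzero[of "\<sigma> \<theta>"]
        by (metis nonzero_mult_div_cancel_left norm_eq_zero of_real_eq_0_iff)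
    qed
    finally show ?thesis .
  qed
  ultimately show thesis by (rule that)
qed

end

section \<open>The billiard map in tangent-angle coordinates\<close>

locale oval_table = oval +
  fixes \<gamma> :: "real \<Rightarrow> complex" and L :: real
  assumes range: "range \<Gamma> = curve_set \<gamma> L" and tangent: "unit_tangent \<gamma> L (\<Gamma> \<theta>) = cis \<theta>"
begin

lemma hit_point_eq:
  assumes z: "\<theta> < z" "z < \<theta> + 2 * pi" "cos_out \<theta> z = cos \<alpha>" and a: "0 < \<alpha>" "\<alpha> < pi"
  shows "hit_point \<gamma> L (\<Gamma> \<theta>) \<alpha> = \<Gamma> z"
  unfolding hit_point_def tangent
proof (rule the_equality)
  have "\<Gamma> z = \<Gamma> \<theta> + of_real (chord \<theta> z) * (cis \<theta> * cis \<alpha>)"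
    using \<Gamma>_diff[of \<theta> z] dir_of_cos_out[OF z] z a by (simp add: algebra_simps)
  then have "\<exists>r>0. \<Gamma> z = \<Gamma> \<theta> + of_real r * (cis \<theta> * cis \<alpha>)" using chord_pos[OF z(1,2)] by blast
  moreover have "\<Gamma> z \<in> curve_set \<gamma> L" using range by blast
  moreover have "\<Gamma> z \<noteq> \<Gamma> \<theta>" using \<Gamma>_neq[OF z(1,2)] by simp
  ultimately show "\<Gamma> z \<in> curve_set \<gamma> L \<and> \<Gamma> z \<noteq> \<Gamma> \<theta> \<and> (\<exists>r>0. \<Gamma> z = \<Gamma> \<theta> + of_real r * (cis \<theta> * cis \<alpha>))"
    by blast
next
  fix x assume x: "x \<in> curve_set \<gamma> L \<and> x \<noteq> \<Gamma> \<theta> \<and> (\<exists>r>0. x = \<Gamma> \<theta> + of_real r * (cis \<theta> * cis \<alpha>))"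
  then obtain r where r: "r > 0" "x = \<Gamma> \<theta> + of_real r * (cis \<theta> * cis \<alpha>)" by blast
  obtain w where w: "\<theta> < w" "w < \<theta> + 2 * pi" "x = \<Gamma> w"
    using \<Gamma>_representative[of x \<theta>] x range by blast
  have "\<Gamma> w - \<Gamma> \<theta> = of_real r * (cis \<theta> * cis \<alpha>)" using r w by simp
  then have "dir \<theta> w = cis \<theta> * cis \<alpha>"
    unfolding dir_eq[OF w(1)] using r(1) by (simp add: sgn_mult sgn_of_real sgn_cis)
  then have "cis (- \<theta>) * dir \<theta> w = cis \<alpha>" by (simp add: cis_mult)
  then have "cos_out \<theta> w = cos \<alpha>" unfolding cos_out_def by (simp del: times_complex.sel)
  then have "w = z"
    using cos_out_less_iff[of \<theta> w z] cos_out_less_iff[of \<theta> z w] w z by auto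
  then show "x = \<Gamma> z" using w by simp
qed

text \<open>Reflection in the tangent keeps the tangential component, so the departing cosine is the
  arriving one.\<close>

lemma billiard_map_eq:
  assumes z: "\<theta> < z" "z < \<theta> + 2 * pi" "cos_out \<theta> z = cos \<alpha>" and a: "0 < \<alpha>" "\<alpha> < pi"
  shows "billiard_map \<gamma> L (\<Gamma> \<theta>, \<alpha>) = (\<Gamma> z, arccos (cos_in \<theta> z))"
proof -
  have u: "(\<Gamma> z - \<Gamma> \<theta>) / of_real (norm (\<Gamma> z - \<Gamma> \<theta>)) = dir \<theta> z"
    using dir_eq[OF z(1)] by (simp add: sgn_eq)
  have "reflect_line t u \<bullet> t = u \<bullet> t" if "t \<bullet> t = 1" for t u
    unfolding reflect_line_def scaleR_conv_of_real[symmetric] using that by (simp add: inner_diff_left)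
  moreover have "cis z \<bullet> cis z = 1" using norm_cis[of z] by (simp add: dot_square_norm)
  moreover have "dir \<theta> z \<bullet> cis z = cos_in \<theta> z" by (simp add: inner_complex_def cos_in_def)
  ultimately show ?thesis
    unfolding billiard_map_def using a hit_point_eq[OF z a] u tangent by (simp add: Let_def)
qed

lemma level_invariant:
  assumes d: "0 \<le> d" "d \<le> pi / 2" and inv: "T_invariant \<gamma> L (level_curve \<gamma> L d)"
  shows "cos_out \<theta> (\<theta> + 2 * d) = cos d" "cos_in \<theta> (\<theta> + 2 * d) = cos d"
proof -
  have "cos_out \<theta> (\<theta> + 2 * d) = cos d \<and> cos_in \<theta> (\<theta> + 2 * d) = cos d"
  proof (cases "d = 0")
    case False
    then have a: "0 < d" "d < pi" using d pi_gt_zero by linarith+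
    obtain z where z: "\<theta> < z" "z < \<theta> + 2 * pi" "cos_out \<theta> z = cos d" using hit_exists[OF a] by blast
    have "(\<Gamma> \<theta>, d) \<in> level_curve \<gamma> L d" using range by (auto simp: level_curve_def)
    then have "billiard_map \<gamma> L (\<Gamma> \<theta>, d) \<in> level_curve \<gamma> L d" using inv unfolding T_invariant_def by blast
    then have "arccos (cos_in \<theta> z) = d" unfolding billiard_map_eq[OF z a] by (auto simp: level_curve_def)
    then have ci: "cos_in \<theta> z = cos d" using cos_le_1(2)[of \<theta> z] z cos_arccos_abs by force
    \<comment> \<open>The direction of one chord, computed from its two ends:
      \<open>\<theta> + d\<close> and \<open>z - d\<close> agree modulo
      \<open>2 * pi\<close>.\<close>
    have "cis \<theta> * cis d = cis z * cis (- d)"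
      using dir_of_cos_out[OF z] dir_of_cos_in[OF z(1,2) ci] a by simp
    then have "cis \<theta> * cis d * cis d = cis z * cis (- d) * cis d" by simp
    then have "cis (\<theta> + 2 * d) = cis z" by (simp add: cis_mult add.assoc)
    then have "cos (\<theta> + 2 * d) = cos z \<and> sin (\<theta> + 2 * d) = sin z" by (simp add: complex_eq_iff)
    then obtain n :: int where n: "\<theta> + 2 * d = z + 2 * pi * of_int n"
      using sin_cos_eq_iff[of "\<theta> + 2 * d" z] by (auto simp: mult.assoc)
    \<comment> \<open>Both \<open>z\<close> and \<open>\<theta> + 2 * d\<close> lie strictly between
      \<open>\<theta>\<close> and \<open>\<theta> + 2 * pi\<close>, so they differ by less than a
      period.\<close>
    have "2 * pi * of_int n < 2 * pi * 1" "2 * pi * (-1) < 2 * pi * of_int n" using n z a by linarith+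
    then have "real_of_int n < 1" "-1 < real_of_int n"
      using mult_less_cancel_left_pos[of "2 * pi" "real_of_int n" 1]
        mult_less_cancel_left_pos[of "2 * pi" "-1" "real_of_int n"] pi_gt_zero by linarith+
    then have "n = 0" by linarith
    then have "z = \<theta> + 2 * d" using n by simp
    then show ?thesis using z ci by simp
  qed simp
  then show "cos_out \<theta> (\<theta> + 2 * d) = cos d" "cos_in \<theta> (\<theta> + 2 * d) = cos d" by auto
qed

end

section \<open>From the foliation to leaves\<close>

locale oval_table_strip = oval_table + oval_strip
begin

lemma leaf_through:
  assumes fol: "foliated_by_rotational_invariant_curves \<gamma> L (strip \<gamma> L \<delta>1 \<delta>2)"
    and s: "(\<theta>0, y) \<in> str"
  shows "\<exists>F. leaf F \<and> F \<theta>0 = cos_out \<theta>0 y"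
proof -
  define \<alpha> where "\<alpha> = arccos (cos_out \<theta>0 y)"
  have cr: "cos_out \<theta>0 y \<in> {cos \<delta>2..cos \<delta>1}" by (rule cos_out_range[OF s])
  have b: "\<bar>cos_out \<theta>0 y\<bar> \<le> 1" using s str_wedge by (intro cos_le_1) (auto simp: wedge_def)
  have c\<alpha>: "cos \<alpha> = cos_out \<theta>0 y" unfolding \<alpha>_def using b by (simp add: cos_arccos_abs)
  have "arccos (cos \<delta>1) \<le> \<alpha>" "\<alpha> \<le> arccos (cos \<delta>2)"
    unfolding \<alpha>_def using cr b by (auto intro!: arccos_le_arccos)
  then have \<alpha>: "\<delta>1 \<le> \<alpha>" "\<alpha> \<le> \<delta>2" using \<delta> by (auto simp: arccos_cos)
  have "(\<Gamma> \<theta>0, \<alpha>) \<in> strip \<gamma> L \<delta>1 \<delta>2" using \<alpha> range by (auto simp: strip_def)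
  then obtain C where C: "rotational_invariant_curve \<gamma> L C" "C \<subseteq> strip \<gamma> L \<delta>1 \<delta>2" "(\<Gamma> \<theta>0, \<alpha>) \<in> C"
    using fol unfolding foliated_by_rotational_invariant_curves_def by metis
  then obtain f where f: "continuous_on (curve_set \<gamma> L) f" "C = {(x, f x) | x. x \<in> curve_set \<gamma> L}"
    and inv: "T_invariant \<gamma> L C"
    unfolding rotational_invariant_curve_def by blast
  have inC: "(\<Gamma> t, f (\<Gamma> t)) \<in> C" for t unfolding f(2) using range by auto
  have fr: "\<delta>1 \<le> f (\<Gamma> t)" "f (\<Gamma> t) \<le> \<delta>2" for t using inC[of t] C(2) by (auto simp: strip_def)
  define F where "F t = cos (f (\<Gamma> t))" for t
  have Fr: "F t \<in> {cos \<delta>2..cos \<delta>1}" for t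
    unfolding F_def using fr[of t] \<delta> by (auto intro!: cos_monotone_0_pi_le)
  have "leaf F"
    unfolding leaf_def
  proof (intro conjI allI)
    show "continuous_on UNIV F" unfolding F_def
      by (intro continuous_intros continuous_on_compose2[OF f(1) \<Gamma>_cont]) (use range in auto)
    fix t
    show "F (t + 2 * pi) = F t" by (simp add: F_def \<Gamma>_periodic)
    show "F t \<in> {cos \<delta>2..cos \<delta>1}" by (rule Fr)
    show "F (nxt t (F t)) = cos_in t (nxt t (F t))"
    \<comment> \<open>Where the graph touches the boundary circle the map is the identity by
      convention rather than a reflection; correspondingly the next tangent angle is
      \<open>t\<close> itself.\<close>
    proof (cases "f (\<Gamma> t) = 0")
      case True
      then have F1: "F t = 1" by (simp add: F_def)
      have "(t, t) \<in> str" using fr[of t] True \<delta> unfolding str_def by simp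
      from nxt_eq[OF this] have "nxt t (F t) = t" by (simp add: F1)
      then show ?thesis by (simp add: F1)
    next
      case False
      define z where "z = nxt t (F t)"
      have a: "0 < f (\<Gamma> t)" "f (\<Gamma> t) < pi" using False fr[of t] \<delta> pi_gt_zero by linarith+
      have zs: "(t, z) \<in> str" "cos_out t z = cos (f (\<Gamma> t))" using nxt[OF Fr[of t], of t] by (auto simp: z_def F_def)
      have "cos (f (\<Gamma> t)) < cos 0" using a by (intro cos_monotone_0_pi) auto
      then have "t \<noteq> z" using zs(2) by auto
      then have z: "t < z" "z < t + 2 * pi" using zs(1) str_wedge by (auto simp: wedge_def)
      have "billiard_map \<gamma> L (\<Gamma> t, f (\<Gamma> t)) \<in> C" using inC inv unfolding T_invariant_def by blast
      then have "f (\<Gamma> z) = arccos (cos_in t z)" unfolding billiard_map_eq[OF z zs(2) a] f(2) by auto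
      then have "F z = cos_in t z" unfolding F_def using cos_le_1(2)[of t z] z by (simp add: cos_arccos_abs)
      then show ?thesis by (simp add: z_def)
    qed
  qed
  moreover have "F \<theta>0 = cos_out \<theta>0 y"
  proof -
    have "f (\<Gamma> \<theta>0) = \<alpha>" using C(3) unfolding f(2) by auto
    then show ?thesis by (simp add: F_def c\<alpha>)
  qed
  ultimately show ?thesis by blast
qed

end

theorem theorem1p3:
  fixes \<gamma> :: "real \<Rightarrow> complex" and L \<delta>1 \<delta>2 :: real
  assumes "gutkin_table \<gamma> L"
    and "0 \<le> \<delta>1" and "\<delta>1 < \<delta>2" and "\<delta>2 \<le> pi / 2"
    and "T_invariant \<gamma> L (level_curve \<gamma> L \<delta>1)"
    and "T_invariant \<gamma> L (level_curve \<gamma> L \<delta>2)"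
    and "\<forall>\<delta>. \<delta>1 < \<delta> \<and> \<delta> < \<delta>2 \<longrightarrow> \<not> T_invariant \<gamma> L (level_curve \<gamma> L \<delta>)"
    and "foliated_by_rotational_invariant_curves \<gamma> L (strip \<gamma> L \<delta>1 \<delta>2)"
  shows "\<exists>c r. r > 0 \<and> curve_set \<gamma> L = sphere c r"
proof -
  interpret table \<gamma> L by standard (use assms(1) in \<open>simp add: gutkin_table_def\<close>)
  obtain \<Gamma> \<rho> \<rho>' where ov: "oval \<Gamma> \<rho> \<rho>'" and rg: "range \<Gamma> = curve_set \<gamma> L"
    and tg: "\<And>\<theta>. unit_tangent \<gamma> L (\<Gamma> \<theta>) = cis \<theta>"
    using reparametrisation by blast
  interpret O: oval_table \<Gamma> \<rho> \<rho>' \<gamma> L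
    using ov rg tg by (simp add: oval_table_def oval_table_axioms_def)
  interpret S: oval_table_strip \<Gamma> \<rho> \<rho>' \<gamma> L \<delta>1 \<delta>2
    by unfold_locales (use assms O.level_invariant in auto)
  show ?thesis
    using S.foliated_strip_circle[OF S.leaf_through[OF assms(8)]] rg by simp
qed

end
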